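(* Let $P$ be a lattice polygon in $\mathbb{R}^2$ with $I(P)>0$, and let $P'=\sum_{i=1}^m P_i'$ and $P''=\sum_{k=1}^\ell P_k''$ (Minkowski sums, with all $P_i'$ and $P_k''$ nontrivial lattice polygons) be two polygons contained in $P$. Let $X$ be a smooth toric surface over $\mathbb{F}_q$ obtained by refining the normal fan $\Delta$ of $P$ (as described in the context), so that $P'$ and $P''$ correspond to line bundles $\mathcal{O}(D')$ and $\mathcal{O}(D'')$ on $X$. Let $s'=s_1's_2'\cdots s_m'\in H^0(\mathcal{O}(D'))$ and $s''=s_1''s_2''\cdots s_\ell''\in H^0(\mathcal{O}(D''))$ be reducible sections, where $s_i'$ is a section of the line bundle corresponding to $P_i'$ and $s_k''$ is a section of the line bundle corresponding to $P_k''$, with all $V(s_i')$ and $V(s_k'')$ (absolutely) irreducible, of arithmetic genera $g_i'$ and $g_k''$ respectively. Suppose that $m>\ell$ and that $g_i'=I(P_i')=0$ and $g_k''=I(P_k'')=0$ for all $i,k$. Then for all $q>\#(P)+m$, $$|V(s')\cap(\mathbb{F}_q^{*})^2| > |V(s'')\cap(\mathbb{F}_q^{*})^2| .$$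
   Context: A lattice polygon is the convex hull of a finite set of points of $\mathbb{Z}^2$, possibly degenerate (e.g. a line segment); it is nontrivial if it is not a single point. The Minkowski sum is $P+Q=\{x+y : x\in P, y\in Q\}$. $\#(P)=|P\cap\mathbb{Z}^2|$ and $I(P)$ is the number of lattice points in the interior of $P$ (so $I=0$ for a line segment). The surface $X$: let $\Delta$ be the outer normal fan of $P$. Refine $\Delta$ to a fan which also contains as rays the outer normals to the edges of all the subpolygons $P_i'$, $P_k''$ (hence of $P'$, $P''$), and subdivide further so that the resulting complete fan defines a smooth toric surface $X$ over $\mathbb{F}_q$. Then each lattice polygon $Q$ among these corresponds to a globally generated line bundle $\mathcal{O}(D_Q)$ on $X$, whose global sections have as basis the monomials $x^ay^b$ with $(a,b)\in Q\cap\mathbb{Z}^2$; products of sections correspond to Minkowski sums of polygons. Here $\mathcal{O}(D')=\mathcal{O}(D_{P'})$ and $\mathcal{O}(D'')=\mathcal{O}(D_{P''})$. $V(s)$ denotes the zero locus on $X$ of a section $s$, and $(\mathbb{F}_q^{*})^2$ is the set of $\mathbb{F}_q$-rational points of the open torus of $X$, so $V(s)\cap(\mathbb{F}_q^{*})^2$ is the set of points of $(\mathbb{F}_q^{*})^2$ at which the corresponding Laurent polynomial vanishes.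
   Formalization: Two hypotheses are added, without which the claim fails: the curves V(s_i') are pairwise distinct, and each V(s_i') meets the open torus over the algebraic closure (is not a boundary curve); the sections s_i', s_k'' are taken nonzero. *)

theory Defs
  imports
    "HOL-Analysis.Analysis"
    "HOL-Library.Poly_Mapping"
    "HOL-Algebra.Algebraic_Closure_Type"
begin

section \<open>Lattice polygons\<close>

definition lat :: "int \<times> int \<Rightarrow> real \<times> real" where
  "lat m = (of_int (fst m), of_int (snd m))"

definition pairing :: "int \<times> int \<Rightarrow> int \<times> int \<Rightarrow> int" where
  "pairing m u = fst m * fst u + snd m * snd u"

definition lattice_points :: "(real \<times> real) set \<Rightarrow> (int \<times> int) set" where
  "lattice_points Q = {m. lat m \<in> Q}"

definition lattice_polygon :: "(real \<times> real) set \<Rightarrow> bool" where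
  "lattice_polygon Q \<longleftrightarrow> (\<exists>S. finite S \<and> S \<noteq> {} \<and> Q = convex hull (lat ` S))"

definition nontrivial_lattice_polygon :: "(real \<times> real) set \<Rightarrow> bool" where
  "nontrivial_lattice_polygon Q \<longleftrightarrow> lattice_polygon Q \<and> \<not> is_singleton Q"

definition num_lattice_points :: "(real \<times> real) set \<Rightarrow> nat" where
  "num_lattice_points Q = card (lattice_points Q)"

text \<open>The topological interior in the plane is meant, so this is 0 for a segment.\<close>

definition num_interior_points :: "(real \<times> real) set \<Rightarrow> nat" where
  "num_interior_points Q = card (lattice_points (interior Q))"


section \<open>Smooth complete fans in the plane\<close>

text \<open>
  All cones of a smooth fan are simplicial, so a cone is encoded by the finite set of the
  primitive lattice vectors on its rays. The faces of a cone are then the cones spanned by the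
  subsets, the zero cone is the empty set, and the rays are the singletons.
\<close>

type_synonym lattice_cone = "(int \<times> int) set"

definition real_cone :: "lattice_cone \<Rightarrow> (real \<times> real) set" where
  "real_cone \<sigma> = convex_cone hull (lat ` \<sigma>)"

definition smooth_complete_fan :: "lattice_cone set \<Rightarrow> bool" where
  "smooth_complete_fan \<Sigma> \<longleftrightarrow>
     finite \<Sigma> \<and>
     (\<forall>\<sigma>\<in>\<Sigma>. \<exists>u v. \<sigma> \<subseteq> {u, v} \<and> \<bar>fst u * snd v - snd u * fst v\<bar> = 1) \<and>
     (\<forall>\<sigma>\<in>\<Sigma>. \<forall>\<tau>. \<tau> \<subseteq> \<sigma> \<longrightarrow> \<tau> \<in> \<Sigma>) \<and>
     (\<forall>\<sigma>\<in>\<Sigma>. \<forall>\<tau>\<in>\<Sigma>. real_cone \<sigma> \<inter> real_cone \<tau> = real_cone (\<sigma> \<inter> \<tau>)) \<and>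
     (\<Union>\<sigma>\<in>\<Sigma>. real_cone \<sigma>) = UNIV"

definition fan_rays :: "lattice_cone set \<Rightarrow> (int \<times> int) set" where
  "fan_rays \<Sigma> = {v. {v} \<in> \<Sigma>}"

text \<open>
  A primitive vector is an outer normal to an edge of \<open>Q\<close> if it attains its maximum over \<open>Q\<close>
  at more than one point. For a segment this yields both of its normal directions.
\<close>

definition outer_edge_normals :: "(real \<times> real) set \<Rightarrow> (int \<times> int) set" where
  "outer_edge_normals Q =
     {v. coprime (fst v) (snd v) \<and>
         (\<exists>x\<in>Q. \<exists>y\<in>Q. x \<noteq> y \<and> (\<forall>z\<in>Q. z \<bullet> lat v \<le> x \<bullet> lat v \<and> z \<bullet> lat v \<le> y \<bullet> lat v))}"

definition outer_normal_cone :: "(real \<times> real) set \<Rightarrow> real \<times> real \<Rightarrow> (real \<times> real) set" where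
  "outer_normal_cone Q x = {u. \<forall>y\<in>Q. y \<bullet> u \<le> x \<bullet> u}"

definition refines_outer_normal_fan :: "lattice_cone set \<Rightarrow> (real \<times> real) set \<Rightarrow> bool" where
  "refines_outer_normal_fan \<Sigma> Q \<longleftrightarrow> (\<forall>\<sigma>\<in>\<Sigma>. \<exists>x\<in>Q. real_cone \<sigma> \<subseteq> outer_normal_cone Q x)"


section \<open>The toric surface of a fan\<close>

text \<open>
  Normals point outwards, so the affine chart \<open>U\<^sub>\<sigma>\<close> belongs to the monoid of the characters
  that are nonpositive (and not, as with inner normals, nonnegative) on \<open>\<sigma>\<close>.
\<close>

definition regular_chars :: "lattice_cone \<Rightarrow> (int \<times> int) set" where
  "regular_chars \<sigma> = {m. \<forall>u\<in>\<sigma>. pairing m u \<le> 0}"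

definition invertible_chars :: "lattice_cone \<Rightarrow> (int \<times> int) set" where
  "invertible_chars \<sigma> = {m. \<forall>u\<in>\<sigma>. pairing m u = 0}"

text \<open>
  Orbit description of the \<open>k\<close>-rational points. A point of \<open>U\<^sub>\<sigma>\<close> is a monoid homomorphism from
  \<open>regular_chars \<sigma>\<close> to the multiplicative monoid of \<open>k\<close>. It lies in the orbit of a unique face
  \<open>\<tau>\<close> of \<open>\<sigma>\<close>, and it is the extension by 0 of a group homomorphism from \<open>invertible_chars \<tau>\<close>
  to the units of \<open>k\<close>. A point of the surface is thus a pair of a cone \<open>\<tau>\<close> and such a function
  \<open>x\<close>, where \<open>x m\<close> is the value at the point of any character \<open>m\<close> in \<open>regular_chars \<tau>\<close>.
  (The cone must be recorded since opposite rays have the same invertible characters.)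
\<close>

type_synonym 'k toric_point = "lattice_cone \<times> (int \<times> int \<Rightarrow> 'k)"

definition toric_surface :: "lattice_cone set \<Rightarrow> 'k::field toric_point set" where
  "toric_surface \<Sigma> = {(\<tau>, x). \<tau> \<in> \<Sigma> \<and>
     (\<forall>m. x m \<noteq> 0 \<longleftrightarrow> m \<in> invertible_chars \<tau>) \<and>
     (\<forall>m\<in>invertible_chars \<tau>. \<forall>n\<in>invertible_chars \<tau>. x (m + n) = x m * x n)}"

definition affine_chart :: "lattice_cone set \<Rightarrow> lattice_cone \<Rightarrow> 'k::field toric_point set" where
  "affine_chart \<Sigma> \<sigma> = {p \<in> toric_surface \<Sigma>. fst p \<subseteq> \<sigma>}"

definition open_torus :: "lattice_cone set \<Rightarrow> 'k::field toric_point set" where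
  "open_torus \<Sigma> = affine_chart \<Sigma> {}"

text \<open>
  Laurent polynomials in two variables are elements of the group ring
  \<open>(int \<times> int) \<Rightarrow>\<^sub>0 'k\<close>, whose multiplication is the convolution product.
\<close>

type_synonym 'k laurent = "(int \<times> int) \<Rightarrow>\<^sub>0 'k"

definition regular_value :: "'k::field laurent \<Rightarrow> 'k toric_point \<Rightarrow> 'k" where
  "regular_value f p = (\<Sum>m\<in>Poly_Mapping.keys f. Poly_Mapping.lookup f m * snd p m)"

definition zariski_closed :: "lattice_cone set \<Rightarrow> 'k::field toric_point set \<Rightarrow> bool" where
  "zariski_closed \<Sigma> Z \<longleftrightarrow> Z \<subseteq> toric_surface \<Sigma> \<and>
     (\<forall>\<sigma>\<in>\<Sigma>. \<exists>F. (\<forall>f\<in>F. Poly_Mapping.keys f \<subseteq> regular_chars \<sigma>) \<and>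
        Z \<inter> affine_chart \<Sigma> \<sigma> = {p \<in> affine_chart \<Sigma> \<sigma>. \<forall>f\<in>F. regular_value f p = 0})"

text \<open>Irreducibility in the Zariski topology; meaningful for \<open>'k\<close> algebraically closed.\<close>

definition zariski_irreducible :: "lattice_cone set \<Rightarrow> 'k::field toric_point set \<Rightarrow> bool" where
  "zariski_irreducible \<Sigma> Z \<longleftrightarrow> Z \<noteq> {} \<and>
     (\<forall>A B. zariski_closed \<Sigma> A \<longrightarrow> zariski_closed \<Sigma> B \<longrightarrow> Z \<subseteq> A \<union> B \<longrightarrow> Z \<subseteq> A \<or> Z \<subseteq> B)"


section \<open>Line bundles and sections\<close>

text \<open>The global sections of the line bundle \<open>\<O>(D\<^sub>Q)\<close>.\<close>

definition sections_of :: "(real \<times> real) set \<Rightarrow> 'k::field laurent set" where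
  "sections_of Q = {s. Poly_Mapping.keys s \<subseteq> lattice_points Q}"

text \<open>
  Near a point of the orbit of \<open>\<tau>\<close>, the bundle \<open>\<O>(D\<^sub>Q)\<close> is generated by the monomial of any
  lattice point \<open>m\<^sub>0\<close> of the face of \<open>Q\<close> on which all elements of \<open>\<tau>\<close> are maximal. Hence \<open>s\<close>
  vanishes at such a point iff the regular function \<open>s / \<chi>\<^sup>m\<^sup>0\<close> does. Another choice of \<open>m\<^sub>0\<close>
  changes the value by a unit only.
\<close>

definition zero_locus ::
    "lattice_cone set \<Rightarrow> (real \<times> real) set \<Rightarrow> 'k::field laurent \<Rightarrow> 'k toric_point set" where
  "zero_locus \<Sigma> Q s = {(\<tau>, x) \<in> toric_surface \<Sigma>.
     \<exists>m0\<in>lattice_points Q. (\<forall>m\<in>lattice_points Q. m - m0 \<in> regular_chars \<tau>) \<and>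
       (\<Sum>m\<in>Poly_Mapping.keys s. Poly_Mapping.lookup s m * x (m - m0)) = 0}"

text \<open>The points of \<open>V(s)\<close> over the algebraic closure of the ground field.\<close>

definition geometric_zero_locus ::
    "lattice_cone set \<Rightarrow> (real \<times> real) set \<Rightarrow> 'k::field laurent \<Rightarrow> 'k alg_closure toric_point set" where
  "geometric_zero_locus \<Sigma> Q s = zero_locus \<Sigma> Q (Poly_Mapping.map to_ac s)"

text \<open>The zeros of \<open>s\<close> among the \<open>k\<close>-rational points of the torus; cf.\ the lemma below.\<close>

definition torus_zeros :: "'k::field laurent \<Rightarrow> ('k \<times> 'k) set" where
  "torus_zeros s = {(a, b). a \<noteq> 0 \<and> b \<noteq> 0 \<and>
     (\<Sum>m\<in>Poly_Mapping.keys s. Poly_Mapping.lookup s m * (a powi fst m * b powi snd m)) = 0}"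

definition torus_point :: "'k::field \<Rightarrow> 'k \<Rightarrow> 'k toric_point" where
  "torus_point a b = ({}, \<lambda>m. a powi fst m * b powi snd m)"

lemma torus_zeros_eq_zero_locus:
  fixes s :: "'k::field laurent"
  assumes "{} \<in> \<Sigma>" "lattice_points Q \<noteq> {}"
  shows "torus_zeros s = {(a, b). a \<noteq> 0 \<and> b \<noteq> 0 \<and> torus_point a b \<in> zero_locus \<Sigma> Q s}"
proof -
  have "(\<Sum>m\<in>Poly_Mapping.keys s. Poly_Mapping.lookup s m *
            (a powi fst (m - m0) * b powi snd (m - m0))) = 0 \<longleftrightarrow>
        (\<Sum>m\<in>Poly_Mapping.keys s. Poly_Mapping.lookup s m * (a powi fst m * b powi snd m)) = 0"
    if "a \<noteq> 0" "b \<noteq> 0" for a b :: 'k and m0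
  proof -
    have "(\<Sum>m\<in>Poly_Mapping.keys s. Poly_Mapping.lookup s m *
            (a powi fst (m - m0) * b powi snd (m - m0))) =
          (\<Sum>m\<in>Poly_Mapping.keys s. Poly_Mapping.lookup s m * (a powi fst m * b powi snd m)) *
            inverse (a powi fst m0 * b powi snd m0)"
      unfolding sum_distrib_right using that
      by (intro sum.cong refl) (simp add: power_int_diff field_simps)
    then show ?thesis using that by simp
  qed
  moreover have "torus_point a b \<in> toric_surface \<Sigma>" if "a \<noteq> 0" "b \<noteq> 0" for a b :: 'k
    using that assms
    by (auto simp: torus_point_def toric_surface_def invertible_chars_def power_int_add)
  ultimately show ?thesis
    using assms by (auto simp: torus_zeros_def torus_point_def zero_locus_def regular_chars_def)
qed


section \<open>Divisors and arithmetic genus\<close>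

text \<open>
  A torus-invariant divisor \<open>\<Sum> a\<^sub>v D\<^sub>v\<close> is encoded by its coefficients \<open>a\<close>, of which only the
  values on the rays matter. With outer normals, the coefficient of \<open>D\<^sub>Q\<close> at \<open>v\<close> is the maximum
  of \<open>v\<close> on \<open>Q\<close>.
\<close>

type_synonym toric_divisor = "int \<times> int \<Rightarrow> int"

definition polygon_divisor :: "(real \<times> real) set \<Rightarrow> toric_divisor" where
  "polygon_divisor Q v = Max ((\<lambda>m. pairing m v) ` lattice_points Q)"

text \<open>
  If \<open>u\<close> and \<open>w\<close> are the neighbours of the ray \<open>v\<close> then \<open>u + w + (D\<^sub>v \<cdot> D\<^sub>v) v = 0\<close>.
\<close>

definition ray_self_intersection :: "lattice_cone set \<Rightarrow> int \<times> int \<Rightarrow> int" where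
  "ray_self_intersection \<Sigma> v =
     (THE b. (\<Sum>u | u \<noteq> v \<and> {u, v} \<in> \<Sigma>. u) + (b * fst v, b * snd v) = 0)"

definition ray_intersection :: "lattice_cone set \<Rightarrow> int \<times> int \<Rightarrow> int \<times> int \<Rightarrow> int" where
  "ray_intersection \<Sigma> u v =
     (if u = v then ray_self_intersection \<Sigma> v else if {u, v} \<in> \<Sigma> then 1 else 0)"

definition intersection_number ::
    "lattice_cone set \<Rightarrow> toric_divisor \<Rightarrow> toric_divisor \<Rightarrow> int" where
  "intersection_number \<Sigma> D E =
     (\<Sum>u\<in>fan_rays \<Sigma>. \<Sum>v\<in>fan_rays \<Sigma>. D u * E v * ray_intersection \<Sigma> u v)"

definition canonical_divisor :: toric_divisor where
  "canonical_divisor = (\<lambda>v. - 1)"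

text \<open>
  The arithmetic genus \<open>p\<^sub>a\<close> of the curves in the linear system of \<open>D\<close>, by the adjunction formula
  \<open>2 p\<^sub>a - 2 = D \<cdot> (D + K)\<close>. The curve \<open>V(s)\<close> of a nonzero section of \<open>\<O>(D\<^sub>Q)\<close> is in the linear
  system of \<open>D\<^sub>Q\<close>.
\<close>

definition arithmetic_genus :: "lattice_cone set \<Rightarrow> toric_divisor \<Rightarrow> int" where
  "arithmetic_genus \<Sigma> D =
     1 + intersection_number \<Sigma> D (\<lambda>v. D v + canonical_divisor v) div 2"

end

theory Submission
  imports Defs
begin

text \<open>
  Let \<open>q\<close> be the number of elements of the ground field. Adding the components \<open>C\<^sub>i\<close> of \<open>s'\<close> one at a
  time, \<open>C\<^sub>i\<close> contributes at least \<open>q - (#(Q + P\<^sub>i) - #(Q))\<close> new rational points, where \<open>Q\<close> is the sum of the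
  polygons used before. Starting from a point, these differences telescope, so \<open>s'\<close> has at least
  \<open>m q + 1 - #(P')\<close> zeros. On the other hand each component of \<open>s''\<close> has at most \<open>q + 1\<close> rational points.

  Both bounds come from the classification of lattice polygons without interior lattice points: up to a
  unimodular map they have width at most one, or they are twice the unit triangle. In the first case the
  curve is a line or the graph of a rational function; in the second it is a conic, which has a
  rational point and hence a rational parametrisation, or a line. Substituting the parametrisation into the
  equation of the earlier components turns common points into roots of a polynomial in one variable,
  whose degree is compared with \<open>#(Q + P\<^sub>i) - #(Q)\<close> by counting lattice points row by row.
\<close>

text \<open>The differences are those of Pick's theorem. In the model case a rational curve with
  polygon \<open>T\<close> has \<open>q + 1\<close> rational points; up to \<open>#(T)\<close> of
  them lie outside the torus, and up to the mixed volume of \<open>Q\<close> and \<open>T\<close>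
  lie on the earlier components. By Pick's formula \<open>#(Q + T) - #(Q)\<close> is the mixed
  volume plus \<open>#(T) - 1\<close>. Only the inequality in the useful direction is proved, so
  that no mixed volume appears. The lower bound on \<open>q\<close> enters in the last comparison,
  of \<open>m q + 1 - #(P')\<close> with \<open>l (q + 1)\<close>. The obstacle is that
  irreducibility and distinctness are given for closed curves on the surface over the algebraic
  closure, whereas the count takes place in the torus. An irreducible curve that meets the torus is
  recovered from its part there, and one inclusion between irreducible curves of the torus forces
  equality. Hence there is no inclusion between the torus parts of distinct curves, which keeps the
  polynomials obtained by substitution from being zero.\<close>

hide_const (open) Polynomials.degree Polynomials.lead_coeff up_ring.coeff up_ring.monom module.smult
  Coset.order

subsection \<open>Laurent polynomials on the torus\<close>

definition torus_char :: "'a::field \<times> 'a \<Rightarrow> int \<times> int \<Rightarrow> 'a" where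
  "torus_char p m = fst p powi fst m * snd p powi snd m"

definition laurent_eval :: "'a::field laurent \<Rightarrow> 'a \<times> 'a \<Rightarrow> 'a" where
  "laurent_eval f p =
     (\<Sum>m\<in>Poly_Mapping.keys f. Poly_Mapping.lookup f m * torus_char p m)"

definition torus :: "('a::field \<times> 'a) set" where
  "torus = {p. fst p \<noteq> 0 \<and> snd p \<noteq> 0}"

lemma mem_torus [simp]: "(x, y) \<in> torus \<longleftrightarrow> x \<noteq> 0 \<and> y \<noteq> 0"
  by (simp add: torus_def)

lemma torus_char_nonzero: "p \<in> torus \<Longrightarrow> torus_char p m \<noteq> 0"
  by (auto simp: torus_def torus_char_def)

lemma torus_char_add: "p \<in> torus \<Longrightarrow> torus_char p (m + n) = torus_char p m * torus_char p n"
  by (auto simp: torus_def torus_char_def power_int_add)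

lemma torus_char_zero [simp]: "torus_char p 0 = 1"
  by (simp add: torus_char_def)

lemma laurent_eval_superset:
  assumes "finite S" "Poly_Mapping.keys f \<subseteq> S"
  shows "laurent_eval f p = (\<Sum>m\<in>S. Poly_Mapping.lookup f m * torus_char p m)"
  unfolding laurent_eval_def
  using assms by (intro sum.mono_neutral_left) (auto simp: in_keys_iff)

lemma laurent_eval_zero [simp]: "laurent_eval 0 p = 0"
  by (simp add: laurent_eval_def)

lemma laurent_eval_single [simp]:
  "laurent_eval (Poly_Mapping.single m c) p = c * torus_char p m"
  by (simp add: laurent_eval_def)

lemma laurent_eval_one [simp]: "laurent_eval 1 p = 1"
  by (simp flip: single_one)

lemma laurent_eval_add: "laurent_eval (f + g) p = laurent_eval f p + laurent_eval g p"
proof -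
  let ?S = "Poly_Mapping.keys f \<union> Poly_Mapping.keys g"
  have "Poly_Mapping.keys (f + g) \<subseteq> ?S"
    by (rule keys_add)
  then show ?thesis
    by (simp add: laurent_eval_superset[of ?S] lookup_add distrib_right sum.distrib)
qed

lemma laurent_induct [case_names single add]:
  fixes f :: "'k::comm_monoid_add laurent"
  assumes "\<And>m c. P (Poly_Mapping.single m c)"
    and "\<And>f g. P f \<Longrightarrow> P g \<Longrightarrow> P (f + g)"
  shows "P f"
proof (induction f rule: update_induct)
  case const
  show ?case using assms(1)[of 0 0] by simp
next
  case (update f a b)
  have "Poly_Mapping.update a b f = f + Poly_Mapping.single a b"
  proof (rule poly_mapping_eqI)
    fix k
    show "Poly_Mapping.lookup (Poly_Mapping.update a b f) k =
        Poly_Mapping.lookup (f + Poly_Mapping.single a b) k"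
      using update(1) by (auto simp: lookup_update lookup_add lookup_single when_def in_keys_iff)
  qed
  then show ?case using assms update by metis
qed

lemma laurent_eval_mult:
  assumes "p \<in> torus"
  shows "laurent_eval (f * g) p = laurent_eval f p * laurent_eval g p"
proof (induction f rule: laurent_induct)
  case (single m c)
  show ?case
  proof (induction g rule: laurent_induct)
    case (single n d)
    show ?case by (simp add: mult_single torus_char_add[OF assms])
  next
    case (add g h)
    then show ?case by (simp add: distrib_left laurent_eval_add)
  qed
next
  case (add f h)
  then show ?case by (simp add: distrib_right laurent_eval_add)
qed

lemma laurent_eval_prod:
  "p \<in> torus \<Longrightarrow> laurent_eval (\<Prod>i\<in>I. f i) p = (\<Prod>i\<in>I. laurent_eval (f i) p)"
  by (induction I rule: infinite_finite_induct) (auto simp: laurent_eval_mult)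

definition zeros :: "'a::field laurent \<Rightarrow> ('a \<times> 'a) set" where
  "zeros f = {p \<in> torus. laurent_eval f p = 0}"

lemma zeros_mult: "zeros (f * g) = zeros f \<union> zeros g"
  by (auto simp: zeros_def laurent_eval_mult)

lemma zeros_prod: "finite I \<Longrightarrow> zeros (\<Prod>i\<in>I. f i) = (\<Union>i\<in>I. zeros (f i))"
  by (auto simp: zeros_def laurent_eval_prod)

lemma zeros_one [simp]: "zeros 1 = {}"
  by (simp add: zeros_def)

lemma zeros_single_mult:
  "c \<noteq> 0 \<Longrightarrow> zeros (f * Poly_Mapping.single m c) = zeros f"
  by (auto simp: zeros_def laurent_eval_mult torus_char_nonzero)

lemma torus_zeros_eq: "torus_zeros f = zeros f"
  by (auto simp: torus_zeros_def zeros_def laurent_eval_def torus_char_def)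

text \<open>Irreducibility of a closed subset of the torus, tested on hypersurfaces only.\<close>

definition irreducible_zeros :: "('a::field \<times> 'a) set \<Rightarrow> bool" where
  "irreducible_zeros Z \<longleftrightarrow> Z \<noteq> {} \<and>
     (\<forall>f g. Z \<subseteq> zeros f \<union> zeros g \<longrightarrow> Z \<subseteq> zeros f \<or> Z \<subseteq> zeros g)"

lemma irreducible_zerosD:
  "irreducible_zeros Z \<Longrightarrow> Z \<subseteq> zeros f \<union> zeros g \<Longrightarrow> Z \<subseteq> zeros f \<or> Z \<subseteq> zeros g"
  by (auto simp: irreducible_zeros_def)

lemma irreducible_zeros_prod:
  assumes "irreducible_zeros Z" "finite I" "Z \<subseteq> zeros (\<Prod>i\<in>I. f i)"
  obtains i where "i \<in> I" "Z \<subseteq> zeros (f i)"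
proof -
  have "Z \<subseteq> zeros (\<Prod>i\<in>I. f i) \<Longrightarrow> \<exists>i\<in>I. Z \<subseteq> zeros (f i)"
    using assms(2)
  proof (induction I rule: finite_induct)
    case empty
    then show ?case using assms(1) by (auto simp: irreducible_zeros_def)
  next
    case (insert i I)
    then show ?case
      using irreducible_zerosD[OF assms(1), of "f i" "\<Prod>i\<in>I. f i"] by (auto simp: zeros_mult)
  qed
  then show thesis using assms(3) that by blast
qed

subsection \<open>Hollow lattice polygons\<close>

definition unimodular :: "(int \<times> int \<Rightarrow> int \<times> int) \<Rightarrow> bool" where
  "unimodular g \<longleftrightarrow> (\<exists>a b c d. \<bar>a * d - b * c\<bar> = 1 \<and>
     g = (\<lambda>m. (a * fst m + b * snd m, c * fst m + d * snd m)))"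

lemma unimodularI: "\<bar>a * d - b * c\<bar> = 1 \<Longrightarrow>
    unimodular (\<lambda>m. (a * fst m + b * snd m, c * fst m + d * snd m))"
  unfolding unimodular_def by blast

lemma unimodular_compose:
  assumes "unimodular g" "unimodular h"
  shows "unimodular (\<lambda>m. g (h m))"
proof -
  obtain a b c d where 1: "\<bar>a * d - b * c\<bar> = 1"
    "g = (\<lambda>m. (a * fst m + b * snd m, c * fst m + d * snd m))"
    using assms(1) unfolding unimodular_def by blast
  obtain a' b' c' d' where 2: "\<bar>a' * d' - b' * c'\<bar> = 1"
    "h = (\<lambda>m. (a' * fst m + b' * snd m, c' * fst m + d' * snd m))"
    using assms(2) unfolding unimodular_def by blast
  have "(a * a' + b * c') * (c * b' + d * d') - (a * b' + b * d') * (c * a' + d * c') =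
      (a * d - b * c) * (a' * d' - b' * c')"
    by (simp add: algebra_simps)
  then have "\<bar>(a * a' + b * c') * (c * b' + d * d') - (a * b' + b * d') * (c * a' + d * c')\<bar> = 1"
    using 1(1) 2(1) by (simp add: abs_mult)
  from unimodularI[OF this] show ?thesis
    by (simp add: 1(2) 2(2) algebra_simps)
qed

lemma unimodular_inverse:
  assumes "unimodular g"
  obtains h where "unimodular h" "\<And>m. g (h m) = m" "\<And>m. h (g m) = m"
proof -
  obtain a b c d where 1: "\<bar>a * d - b * c\<bar> = 1"
    "g = (\<lambda>m. (a * fst m + b * snd m, c * fst m + d * snd m))"
    using assms(1) unfolding unimodular_def by blast
  define e where "e = a * d - b * c"
  have ee: "e * e = 1" using 1(1) by (auto simp: e_def[symmetric] abs_if split: if_splits)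
  \<comment> \<open>A determinant of absolute value 1 is its own inverse, so \<open>e\<close> times
    the adjugate matrix inverts \<open>g\<close> over the integers.\<close>
  define h where "h = (\<lambda>m. ((e * d) * fst m + (- e * b) * snd m, (- e * c) * fst m + (e * a) * snd m))"
  have "(e * d) * (e * a) - (- e * b) * (- e * c) = (e * e) * e"
    by (simp add: e_def algebra_simps)
  then have "\<bar>(e * d) * (e * a) - (- e * b) * (- e * c)\<bar> = 1"
    using ee 1(1) by (simp add: e_def)
  then have "unimodular h" unfolding h_def by (rule unimodularI)
  moreover have "g (h m) = m" for m
  proof -
    have "g (h m) = (e * e * fst m, e * e * snd m)"
      unfolding 1(2) h_def e_def by (simp add: algebra_simps)
    then show ?thesis by (simp add: ee)
  qed
  moreover have "h (g m) = m" for m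
  proof -
    have "h (g m) = (e * e * fst m, e * e * snd m)"
      unfolding 1(2) h_def e_def by (simp add: algebra_simps)
    then show ?thesis by (simp add: ee)
  qed
  ultimately show thesis using that by blast
qed

lemma unimodular_id: "unimodular (\<lambda>m. m)"
  using unimodularI[of 1 1 0 0] by simp

lemma unimodular_add: "unimodular g \<Longrightarrow> g (m + n) = g m + g n"
  by (auto simp: unimodular_def algebra_simps)

lemma unimodular_diff: "unimodular g \<Longrightarrow> g (m - n) = g m - g n"
  by (auto simp: unimodular_def algebra_simps)

text \<open>The second conjunct says that the lattice points of each triangle with vertices in the set
  belong to the set.\<close>

definition hollow :: "(int \<times> int) set \<Rightarrow> bool" where
  "hollow S \<longleftrightarrow>
     (\<forall>r :: int \<times> int. \<exists>(u :: real) (v :: real). (u \<noteq> 0 \<or> v \<noteq> 0) \<and>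
       (\<forall>m\<in>S. u * of_int (fst m) + v * of_int (snd m) \<le> u * of_int (fst r) + v * of_int (snd r))) \<and>
     (\<forall>a\<in>S. \<forall>b\<in>S. \<forall>c\<in>S. \<forall>r. \<forall>(i :: int) (j :: int) (k :: int). 0 \<le> i \<longrightarrow> 0 \<le> j \<longrightarrow> 0 \<le> k \<longrightarrow> 0 < i + j + k \<longrightarrow>
       (i + j + k) * fst r = i * fst a + j * fst b + k * fst c \<longrightarrow>
       (i + j + k) * snd r = i * snd a + j * snd b + k * snd c \<longrightarrow> r \<in> S)"

lemma hollow_functional:
  assumes "hollow S"
  obtains u v :: real where "u \<noteq> 0 \<or> v \<noteq> 0"
    "\<And>x y. (x, y) \<in> S \<Longrightarrow> u * of_int x + v * of_int y \<le> u * of_int (fst r) + v * of_int (snd r)"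
proof -
  have "\<exists>(u :: real) (v :: real). (u \<noteq> 0 \<or> v \<noteq> 0) \<and>
       (\<forall>m\<in>S. u * of_int (fst m) + v * of_int (snd m) \<le> u * of_int (fst r) + v * of_int (snd r))"
    using assms[unfolded hollow_def, THEN conjunct1] by (rule spec)
  then obtain u v :: real where uv: "(u \<noteq> 0 \<or> v \<noteq> 0) \<and>
      (\<forall>m\<in>S. u * of_int (fst m) + v * of_int (snd m) \<le> u * of_int (fst r) + v * of_int (snd r))" by (elim exE)
  show thesis
  proof (rule that)
    show "u \<noteq> 0 \<or> v \<noteq> 0" by (rule conjunct1[OF uv])
    show "u * x + v * y \<le> u * fst r + v * snd r" if "(x, y) \<in> S" for x y
      using bspec[OF conjunct2[OF uv] that] by simp
  qed
qed

lemma hollow_saturated: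
  assumes "hollow S" "a \<in> S" "b \<in> S" "c \<in> S"
    and "0 \<le> i" "0 \<le> j" "0 \<le> k" "0 < i + j + k"
    and "(i + j + k) * fst r = i * fst a + j * fst b + k * fst c"
    and "(i + j + k) * snd r = i * snd a + j * snd b + k * snd c"
  shows "r \<in> S"
  using assms(1)[unfolded hollow_def, THEN conjunct2, rule_format, OF assms(2-4), of i j k r]
    assms(5-) by blast

definition lattice_equiv :: "(int \<times> int) set \<Rightarrow> (int \<times> int) set \<Rightarrow> bool" where
  "lattice_equiv S S' \<longleftrightarrow> (\<exists>g v. unimodular g \<and> S' = (\<lambda>m. g m + v) ` S)"

lemma lattice_equiv_trans:
  assumes "lattice_equiv S S'" "lattice_equiv S' S''"
  shows "lattice_equiv S S''"
proof -
  obtain g v where 1: "unimodular g" "S' = (\<lambda>m. g m + v) ` S"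
    using assms(1) unfolding lattice_equiv_def by blast
  obtain h w where 2: "unimodular h" "S'' = (\<lambda>m. h m + w) ` S'"
    using assms(2) unfolding lattice_equiv_def by blast
  have "S'' = (\<lambda>m. h (g m) + (h v + w)) ` S"
    by (simp add: 1(2) 2(2) image_image unimodular_add[OF 2(1)] add.assoc)
  then show ?thesis
    using unimodular_compose[OF 2(1) 1(1)] unfolding lattice_equiv_def by blast
qed

lemma lattice_equiv_refl: "lattice_equiv S S"
  unfolding lattice_equiv_def using unimodular_id by (intro exI[of _ "\<lambda>m. m"] exI[of _ 0]) auto

lemma lattice_equiv_linear: "unimodular g \<Longrightarrow> lattice_equiv S (g ` S)"
  unfolding lattice_equiv_def by (intro exI[of _ g] exI[of _ 0]) auto

text \<open>Both conditions are affine: functionals and barycentric relations are transported along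
  the inverse \<open>h (m - w)\<close> of the equivalence.\<close>

lemma hollow_lattice_equiv:
  assumes "hollow S" "lattice_equiv S S'"
  shows "hollow S'"
proof -
  obtain g w where g: "unimodular g" and S': "S' = (\<lambda>m. g m + w) ` S"
    using assms(2) unfolding lattice_equiv_def by blast
  obtain h where h: "unimodular h" "\<And>m. g (h m) = m" "\<And>m. h (g m) = m"
    using unimodular_inverse[OF g] by blast
  obtain a b c d where hd: "h = (\<lambda>m. (a * fst m + b * snd m, c * fst m + d * snd m))"
    and det: "\<bar>a * d - b * c\<bar> = 1"
    using h(1) unfolding unimodular_def by blast
  have S: "m \<in> S' \<longleftrightarrow> h (m - w) \<in> S" for m
  proof
    assume "h (m - w) \<in> S"
    then have "g (h (m - w)) + w \<in> S'" unfolding S' by blast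
    then show "m \<in> S'" by (simp add: h)
  qed (auto simp: S' h)
  have "\<exists>(u :: real) (v :: real). (u \<noteq> 0 \<or> v \<noteq> 0) \<and>
       (\<forall>m\<in>S'. u * of_int (fst m) + v * of_int (snd m) \<le> u * of_int (fst r) + v * of_int (snd r))" for r :: "int \<times> int"
  proof -
    obtain u v :: real where uv: "u \<noteq> 0 \<or> v \<noteq> 0"
      "\<And>x y. (x, y) \<in> S \<Longrightarrow> u * x + v * y \<le> u * fst (h (r - w)) + v * snd (h (r - w))"
      using hollow_functional[OF assms(1)] by blast
    \<comment> \<open>The functional composed with \<open>h\<close>; it is not zero because the
      matrix of \<open>h\<close> is invertible.\<close>
    define u' v' where "u' = u * a + v * c" and "v' = u * b + v * d"
    have "u' \<noteq> 0 \<or> v' \<noteq> 0"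
    proof (rule ccontr)
      assume "\<not> (u' \<noteq> 0 \<or> v' \<noteq> 0)"
      then have "u' * d - v' * c = 0" "v' * a - u' * b = 0" by auto
      then have "u * of_int (a * d - b * c) = 0" "v * of_int (a * d - b * c) = 0"
        by (auto simp: u'_def v'_def algebra_simps)
      moreover have "real_of_int (a * d - b * c) \<noteq> 0"
        using det by (metis abs_0 of_int_eq_0_iff zero_neq_one)
      ultimately show False using uv(1) by (metis mult_eq_0_iff)
    qed
    moreover have "u' * fst m + v' * snd m \<le> u' * fst r + v' * snd r" if "m \<in> S'" for m
      using uv(2)[of "fst (h (m - w))" "snd (h (m - w))"] that S[of m]
      by (simp add: hd u'_def v'_def algebra_simps)
    ultimately show ?thesis by blast
  qed
  moreover have "r \<in> S'" if "x \<in> S'" "y \<in> S'" "z \<in> S'" "0 \<le> i" "0 \<le> j" "0 \<le> k" "0 < i + j + k"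
    "(i + j + k) * fst r = i * fst x + j * fst y + k * fst z"
    "(i + j + k) * snd r = i * snd x + j * snd y + k * snd z" for x y z r and i j k :: int
  proof -
    \<comment> \<open>Arbitrary \<open>t\<close> and \<open>s\<close> are allowed because both rows
      of the matrix of \<open>h\<close> are inserted for them afterwards.\<close>
    have "(i + j + k) * (t * (fst r - fst w) + s * (snd r - snd w)) =
        i * (t * (fst x - fst w) + s * (snd x - snd w)) +
        j * (t * (fst y - fst w) + s * (snd y - snd w)) +
        k * (t * (fst z - fst w) + s * (snd z - snd w))" for t s
    proof -
      have "(i + j + k) * (t * (fst r - fst w) + s * (snd r - snd w)) =
          t * ((i + j + k) * fst r) + s * ((i + j + k) * snd r) -
          (i + j + k) * (t * fst w + s * snd w)"
        by (simp add: algebra_simps)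
      then show ?thesis by (simp only: that) (simp add: algebra_simps)
    qed
    then have "(i + j + k) * fst (h (r - w)) =
        i * fst (h (x - w)) + j * fst (h (y - w)) + k * fst (h (z - w))"
      "(i + j + k) * snd (h (r - w)) =
        i * snd (h (x - w)) + j * snd (h (y - w)) + k * snd (h (z - w))"
      by (simp_all add: hd)
    moreover have "h (x - w) \<in> S" "h (y - w) \<in> S" "h (z - w) \<in> S"
      using that S by auto
    ultimately have "h (r - w) \<in> S"
      using hollow_saturated[OF assms(1)] that(4-7) by blast
    then show ?thesis by (simp add: S)
  qed
  ultimately show ?thesis unfolding hollow_def by (intro conjI allI ballI impI)
qed

definition unit_strip :: "(int \<times> int) set \<Rightarrow> bool" where
  "unit_strip S \<longleftrightarrow> (\<forall>m\<in>S. snd m = 0 \<or> snd m = 1)"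

text \<open>The inequalities make a section a quadratic polynomial. The vertices are demanded
  because the lower bound needs all of twice the unit triangle inside the polygon.\<close>

definition double_triangle :: "(int \<times> int) set \<Rightarrow> bool" where
  "double_triangle S \<longleftrightarrow> {(0, 0), (2, 0), (0, 2)} \<subseteq> S \<and>
     (\<forall>m\<in>S. 0 \<le> fst m \<and> 0 \<le> snd m \<and> fst m + snd m \<le> 2)"

lemma primitive_to_unit:
  assumes "coprime (fst e) (snd e)"
  obtains g where "unimodular g" "g e = (1, 0)"
proof -
  obtain x y where xy: "x * fst e + y * snd e = 1"
    using assms bezout_int[of "fst e" "snd e"] by auto
  \<comment> \<open>Bezout coefficients in the first row send \<open>e\<close> to 1; the second row
    is \<open>e\<close> turned by a right angle, which kills \<open>e\<close> and makes the
    determinant 1.\<close>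
  have "unimodular (\<lambda>m. (x * fst m + y * snd m, (- snd e) * fst m + fst e * snd m))"
    using xy by (intro unimodularI) (simp add: algebra_simps)
  moreover have "(\<lambda>m. (x * fst m + y * snd m, (- snd e) * fst m + fst e * snd m)) e = (1, 0)"
    using xy by simp
  ultimately show thesis using that by blast
qed

text \<open>The point \<open>(1, 0)\<close> lies strictly inside a segment of the hull, so its
  supporting line is the first axis and the set lies on one side of it. A point at height
  \<open>h \<ge> 2\<close> spans with the segment a triangle that has an integer strictly inside its
  row 1, contrary to hollowness, unless \<open>h = L = 2\<close> and its abscissa is even. In the
  exceptional case a shear produces the vertices of twice the unit triangle, and supporting lines at
  the midpoints of its edges confine the set.\<close>

lemma hollow_long_edge:
  assumes S: "hollow S" and 0: "(0, 0) \<in> S" "(L, 0) \<in> S" and L: "L \<ge> 2"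
  shows "\<exists>S'. lattice_equiv S S' \<and> (unit_strip S' \<or> double_triangle S')"
proof -
  obtain u v :: real where uv: "u \<noteq> 0 \<or> v \<noteq> 0"
    "\<And>x y. (x, y) \<in> S \<Longrightarrow> u * x + v * y \<le> u * fst (1 :: int, 0 :: int) + v * snd (1 :: int, 0 :: int)"
    using hollow_functional[OF S, where r = "(1, 0)"] by blast
  have "0 \<le> u" using uv(2)[OF 0(1)] by simp
  moreover have "u * (L - 1) \<le> 0" using uv(2)[OF 0(2)] by (simp add: algebra_simps)
  ultimately have u: "u = 0" using L by (simp add: mult_le_0_iff)
  have "\<exists>S1. lattice_equiv S S1 \<and> (0, 0) \<in> S1 \<and> (L, 0) \<in> S1 \<and> (\<forall>m\<in>S1. 0 \<le> snd m)"
  proof (cases "v < 0")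
    case True
    then have "0 \<le> y" if "(x, y) \<in> S" for x y
      using uv(2)[OF that] u by (simp add: mult_le_0_iff)
    then show ?thesis using 0 lattice_equiv_refl by (metis prod.collapse)
  next
    case False
    then have "v > 0" using uv(1) u by simp
    then have "y \<le> 0" if "(x, y) \<in> S" for x y
      using uv(2)[OF that] u by (simp add: mult_le_0_iff)
    moreover have "unimodular (\<lambda>m. (1 * fst m + 0 * snd m, 0 * fst m + (- 1) * snd m))"
      by (rule unimodularI) simp
    then have "lattice_equiv S ((\<lambda>m. (fst m, - snd m)) ` S)"
      using lattice_equiv_linear by fastforce
    ultimately show ?thesis using 0
      by (intro exI[of _ "(\<lambda>m. (fst m, - snd m)) ` S"]) force
  qed
  then obtain S1 where S1: "lattice_equiv S S1" "(0, 0) \<in> S1" "(L, 0) \<in> S1"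
    "\<And>x y. (x, y) \<in> S1 \<Longrightarrow> 0 \<le> y" by force
  have hS1: "hollow S1" using hollow_lattice_equiv[OF S S1(1)] .
  have top: "h = 2 \<and> L = 2 \<and> even p" if ph: "(p, h) \<in> S1" "h \<ge> 2" for p h
  proof (rule ccontr)
    assume neg: "\<not> (h = 2 \<and> L = 2 \<and> even p)"
    \<comment> \<open>The least integer greater than \<open>p / h\<close>. Row 1 of the triangle
      runs from \<open>p / h\<close> to \<open>(p + L * (h - 1)) / h\<close>, and the facts
      \<open>1\<close> and \<open>3\<close> say that \<open>j\<close> lies strictly between.\<close>
    define j where "j = p div h + 1"
    have jh: "j * h = p div h * h + h" by (simp add: j_def algebra_simps)
    have dm: "p div h * h + p mod h = p" "0 \<le> p mod h" "p mod h < h"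
      using ph(2) by auto
    have 1: "p < j * h" and 2: "j * h \<le> p + h"
      using jh dm by linarith+
    have 3: "j * h < p + L * (h - 1)"
    proof (cases "L = 2 \<and> h = 2")
      case True
      then have "odd p" using neg by auto
      then have "j * 2 \<noteq> p + 2" by presburger
      then have "j * h \<noteq> p + h" using True by simp
      then show ?thesis using 2 True by simp
    next
      case False
      have "2 * (h - 1) \<le> L * (h - 1)" using L ph(2) by (intro mult_right_mono) auto
      moreover have "3 * (h - 1) \<le> L * (h - 1)" if "L \<noteq> 2"
        using L ph(2) that by (intro mult_right_mono) auto
      ultimately have "h < L * (h - 1)" using False ph(2) by (cases "L = 2") auto
      then show ?thesis using 2 by simp
    qed
    obtain u v :: real where uv: "u \<noteq> 0 \<or> v \<noteq> 0"
      "\<And>x y. (x, y) \<in> S1 \<Longrightarrow> u * x + v * y \<le> u * fst (j, 1 :: int) + v * snd (j, 1 :: int)"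
      using hollow_functional[OF hS1, where r = "(j, 1)"] by blast
    have a: "0 \<le> u * j + v" using uv(2)[OF S1(2)] by simp
    have b: "u * L \<le> u * j + v" using uv(2)[OF S1(3)] by simp
    have c: "u * p + v * h \<le> u * j + v" using uv(2)[OF ph(1)] by simp
    have h1: "real_of_int h - 1 > 0" using ph(2) by simp
    have "(u * p + v * h) + (h - 1) * 0 \<le> u * j + v" using c by simp
    \<comment> \<open>Combining two inequalities eliminates \<open>v\<close>: the corners
      \<open>(0, 0)\<close> and \<open>(p, h)\<close> give \<open>u \<ge> 0\<close>, the corners
      \<open>(L, 0)\<close> and \<open>(p, h)\<close> give \<open>u \<le> 0\<close>.\<close>
    have "u * (j * h - p) \<ge> 0"
    proof -
      have "(h - 1) * (u * j + v) \<ge> 0" using a h1 by (intro mult_nonneg_nonneg) auto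
      then show ?thesis using c by (simp add: algebra_simps)
    qed
    moreover have "real_of_int (j * h - p) > 0" using 1 by linarith
    ultimately have u0: "u \<ge> 0" by (simp add: zero_le_mult_iff)
    have "u * (p + L * (h - 1) - j * h) \<le> 0"
    proof -
      have "(h - 1) * (u * j + v - u * L) \<ge> 0" using b h1 by (intro mult_nonneg_nonneg) auto
      then show ?thesis using c by (simp add: algebra_simps)
    qed
    moreover have "real_of_int (p + L * (h - 1) - j * h) > 0" using 3 by linarith
    ultimately have "u \<le> 0" by (meson linorder_not_le mult_pos_pos)
    then have "u = 0" using u0 by simp
    then have "v \<ge> 0" "v * (h - 1) \<le> 0" using a c by (auto simp: algebra_simps)
    then have "v = 0" using h1 by (auto simp: mult_le_0_iff)
    then show False using uv(1) \<open>u = 0\<close> by simp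
  qed
  show ?thesis
  proof (cases "\<exists>p h. (p, h) \<in> S1 \<and> h \<ge> 2")
    case False
    then have "unit_strip S1" using S1(4) by (force simp: unit_strip_def)
    then show ?thesis using S1(1) by blast
  next
    case True
    then obtain p where p: "(p, 2) \<in> S1" "L = 2" "even p" using top by blast
    obtain t where t: "p = 2 * t" using p(3) by (elim evenE)
    define S2 where "S2 = (\<lambda>m. (1 * fst m + (- t) * snd m, 0 * fst m + 1 * snd m)) ` S1"
    have "lattice_equiv S1 S2"
      unfolding S2_def by (intro lattice_equiv_linear unimodularI) simp
    then have eq: "lattice_equiv S S2" using S1(1) lattice_equiv_trans by blast
    then have hS2: "hollow S2" using hollow_lattice_equiv[OF S] by blast
    have in2: "(0, 0) \<in> S2" "(2, 0) \<in> S2" "(0, 2) \<in> S2"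
      using S1(2,3) p unfolding S2_def t by (force simp: image_iff)+
    have pos: "0 \<le> y" if "(x, y) \<in> S2" for x y
      using that S1(4) unfolding S2_def by force
    \<comment> \<open>\<open>(1, 1)\<close> is the midpoint of the edge from \<open>(2, 0)\<close>
      to \<open>(0, 2)\<close>, which forces the functional to be a positive multiple of
      \<open>x + y\<close>.\<close>
    obtain u v :: real where uv: "u \<noteq> 0 \<or> v \<noteq> 0"
      "\<And>x y. (x, y) \<in> S2 \<Longrightarrow> u * x + v * y \<le> u * fst (1 :: int, 1 :: int) + v * snd (1 :: int, 1 :: int)"
      using hollow_functional[OF hS2, where r = "(1, 1)"] by blast
    have "u = v" "0 \<le> u + v" using uv(2)[OF in2(1)] uv(2)[OF in2(2)] uv(2)[OF in2(3)] by auto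
    then have u0: "u > 0" using uv(1) by auto
    have c: "x + y \<le> 2" if "(x, y) \<in> S2" for x y
    proof -
      have "u * (x + y) \<le> u * 2" using uv(2)[OF that] \<open>u = v\<close> by (simp add: algebra_simps)
      then show ?thesis using u0 by (simp add: mult_le_cancel_left_pos)
    qed
    \<comment> \<open>\<open>(0, 1)\<close> is the midpoint of the edge from \<open>(0, 0)\<close>
      to \<open>(0, 2)\<close>, which leaves a negative multiple of \<open>x\<close>.\<close>
    obtain u v :: real where uv: "u \<noteq> 0 \<or> v \<noteq> 0"
      "\<And>x y. (x, y) \<in> S2 \<Longrightarrow> u * x + v * y \<le> u * fst (0 :: int, 1 :: int) + v * snd (0 :: int, 1 :: int)"
      using hollow_functional[OF hS2, where r = "(0, 1)"] by blast
    have "v = 0" "u \<le> 0" using uv(2)[OF in2(1)] uv(2)[OF in2(2)] uv(2)[OF in2(3)] by auto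
    then have "u < 0" using uv(1) by auto
    then have "0 \<le> x" if "(x, y) \<in> S2" for x y
      using uv(2)[OF that] \<open>v = 0\<close> by (simp add: mult_le_0_iff)
    then have "double_triangle S2" using in2 pos c by (force simp: double_triangle_def)
    then show ?thesis using eq by blast
  qed
qed

lemma lattice_equiv_shear: "lattice_equiv S ((\<lambda>m. (fst m + t * snd m, snd m)) ` S)"
  using lattice_equiv_linear[OF unimodularI[of 1 1 t 0], of S] by simp

lemma lattice_equiv_flip: "lattice_equiv S ((\<lambda>m. (fst m, - snd m)) ` S)"
  using lattice_equiv_linear[OF unimodularI[of 1 "-1" 0 0], of S] by simp

lemma lattice_equiv_swap: "lattice_equiv S ((\<lambda>m. (snd m, fst m)) ` S)"
  using lattice_equiv_linear[OF unimodularI[of 0 0 1 1], of S] by simp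

lemma lattice_equiv_diagonal: "lattice_equiv S ((\<lambda>m. (fst m, fst m + snd m)) ` S)"
  using lattice_equiv_linear[OF unimodularI[of 1 1 0 1], of S] by simp

text \<open>In the primitive case the points are pairwise incongruent modulo 2, so besides the corners of
  a unit triangle there is at most one further point, with odd coordinates.\<close>

lemma hollow_primitive:
  assumes S: "hollow S" and 0: "(0, 0) \<in> S" "(1, 0) \<in> S"
    and prim: "\<And>a b. a \<in> S \<Longrightarrow> b \<in> S \<Longrightarrow> a \<noteq> b \<Longrightarrow> odd (fst b - fst a) \<or> odd (snd b - snd a)"
  shows "\<exists>S'. lattice_equiv S S' \<and> unit_strip S'"
proof (cases "\<forall>m\<in>S. snd m = 0")
  case True
  then have "unit_strip S" by (auto simp: unit_strip_def)
  then show ?thesis using lattice_equiv_refl by blast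
next
  case False
  let ?prim = "\<lambda>S. \<forall>a\<in>S. \<forall>b\<in>S. a \<noteq> b \<longrightarrow> odd (fst b - fst a) \<or> odd (snd b - snd a)"
  obtain p h where ph: "(p, h) \<in> S" "h \<noteq> 0" using False by force
  have "\<exists>S1 h1. lattice_equiv S S1 \<and> (0, 0) \<in> S1 \<and> (1, 0) \<in> S1 \<and> (p, h1) \<in> S1 \<and> h1 > 0 \<and> ?prim S1"
  proof (cases "h > 0")
    case True
    then show ?thesis using 0 ph prim lattice_equiv_refl by blast
  next
    case neg: False
    let ?S = "(\<lambda>m. (fst m, - snd m)) ` S"
    have "?prim ?S"
    proof (intro ballI impI)
      fix a b assume "a \<in> ?S" "b \<in> ?S" "a \<noteq> b"
      then obtain a' b' where ab: "a' \<in> S" "b' \<in> S" "a' \<noteq> b'"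
        "a = (fst a', - snd a')" "b = (fst b', - snd b')" by blast
      then show "odd (fst b - fst a) \<or> odd (snd b - snd a)"
        using prim[OF ab(1-3)] by (simp add: ab(4,5)) presburger
    qed
    moreover have "(0, 0) \<in> ?S" "(1, 0) \<in> ?S" "(p, - h) \<in> ?S" using 0 ph by force+
    ultimately show ?thesis using neg ph(2) lattice_equiv_flip[of S]
      by (intro exI[of _ ?S] exI[of _ "- h"]) simp
  qed
  then obtain S1 h1 where S1: "lattice_equiv S S1" "(0, 0) \<in> S1" "(1, 0) \<in> S1" "(p, h1) \<in> S1"
    "h1 > 0" "?prim S1" by blast
  \<comment> \<open>The shear brings the abscissa of the point at height \<open>h1\<close> into the
    range from 0 to \<open>h1 - 1\<close>.\<close>
  define t where "t = - (p div h1)"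
  define p2 where "p2 = p mod h1"
  define S2 where "S2 = (\<lambda>m. (fst m + t * snd m, snd m)) ` S1"
  have eq2: "lattice_equiv S S2"
    unfolding S2_def using S1(1) lattice_equiv_shear lattice_equiv_trans by blast
  have p2: "p + t * h1 = p2" "0 \<le> p2" "p2 < h1"
    using S1(5) by (auto simp: t_def p2_def minus_div_mult_eq_mod)
  have in2: "(0, 0) \<in> S2" "(1, 0) \<in> S2" "(p2, h1) \<in> S2"
    using S1(2-4) p2(1) unfolding S2_def by force+
  have prim2: "?prim S2"
  proof (intro ballI impI)
    fix a b assume "a \<in> S2" "b \<in> S2" "a \<noteq> b"
    then obtain a' b' where ab: "a' \<in> S1" "b' \<in> S1" "a' \<noteq> b'"
      "a = (fst a' + t * snd a', snd a')" "b = (fst b' + t * snd b', snd b')"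
      unfolding S2_def by auto
    then show "odd (fst b - fst a) \<or> odd (snd b - snd a)"
      using S1(6) by (metis (no_types, lifting) add_diff_add dvd_add_left_iff dvd_mult fst_conv
          right_diff_distrib snd_conv)
  qed
  have hS2: "hollow S2" using hollow_lattice_equiv[OF S eq2] .
  \<comment> \<open>Saturation yields a point in row 1: weights with sum \<open>h1\<close> express
    it as a barycentre of points on the axis and \<open>(p2, h1)\<close>.\<close>
  have "\<exists>c. (c, 1) \<in> S2"
  proof (cases "p2 = 0")
    case True
    have "(0, 1) \<in> S2"
      using hollow_saturated[OF hS2 in2(1) in2(1) in2(3), of "h1 - 1" 0 1 "(0, 1)"] S1(5) True by simp
    then show ?thesis by blast
  next
    case False
    have "(1, 1) \<in> S2"
      using hollow_saturated[OF hS2 in2(1) in2(2) in2(3), of "p2 - 1" "h1 - p2" 1 "(1, 1)"] p2 False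
      by simp
    then show ?thesis by blast
  qed
  then obtain c where c: "(c, 1) \<in> S2" by blast
  define S3 where "S3 = (\<lambda>m. (fst m + (- c) * snd m, snd m)) ` S2"
  have eq3: "lattice_equiv S S3"
    unfolding S3_def using eq2 lattice_equiv_shear lattice_equiv_trans by blast
  have in3: "(0, 0) \<in> S3" "(1, 0) \<in> S3" "(0, 1) \<in> S3"
    using in2(1,2) c unfolding S3_def by force+
  have prim3: "odd (fst b - fst a) \<or> odd (snd b - snd a)" if "a \<in> S3" "b \<in> S3" "a \<noteq> b" for a b
  proof -
    from that obtain a' b' where ab: "a' \<in> S2" "b' \<in> S2" "a' \<noteq> b'"
      "a = (fst a' + (- c) * snd a', snd a')" "b = (fst b' + (- c) * snd b', snd b')"
      unfolding S3_def by auto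
    have "odd (fst b' - fst a') \<or> odd (snd b' - snd a')" using prim2 ab by blast
    then show ?thesis unfolding ab by (simp add: algebra_simps) presburger
  qed
  have hS3: "hollow S3" using hollow_lattice_equiv[OF S eq3] .
  \<comment> \<open>The three corners occupy three of the four classes modulo 2, so any other point
    lies in the class of \<open>(1, 1)\<close>.\<close>
  have rest: "odd x \<and> odd y" if "(x, y) \<in> S3" "(x, y) \<notin> {(0, 0), (1, 0), (0, 1)}" for x y
    using prim3[OF in3(1) that(1)] prim3[OF in3(2) that(1)] prim3[OF in3(3) that(1)] that(2) by auto
  show ?thesis
  proof (cases "S3 \<subseteq> {(0, 0), (1, 0), (0, 1)}")
    case True
    then have "unit_strip S3" by (auto simp: unit_strip_def)
    then show ?thesis using eq3 by blast
  next
    case False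
    then obtain x y where xy: "(x, y) \<in> S3" "(x, y) \<notin> {(0, 0), (1, 0), (0, 1)}" by auto
    have oxy: "odd x" "odd y" using rest[OF xy] by auto
    have S3: "m = (0, 0) \<or> m = (1, 0) \<or> m = (0, 1) \<or> m = (x, y)" if "m \<in> S3" for m
    proof (rule ccontr)
      assume neg: "\<not> ?thesis"
      then have "odd (fst m)" "odd (snd m)" using rest[of "fst m" "snd m"] that by auto
      then show False using prim3[OF xy(1) that] neg oxy by auto
    qed
    have x: "x \<noteq> 0" "y \<noteq> 0" "x + y \<noteq> 1" using oxy by presburger+
    have "x = 1 \<or> y = 1 \<or> x + y = 0"
    proof (rule ccontr)
      assume neg: "\<not> (x = 1 \<or> y = 1 \<or> x + y = 0)"
      \<comment> \<open>In each of the six sectors that remain, this lattice point is interior to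
        the hull of the three corners and \<open>(x, y)\<close>, so no nonzero functional can attain
        its maximum there.\<close>
      define r :: "int \<times> int" where "r = (if 0 < x \<and> 0 < y then (1, 1) else
        if x < 0 \<and> y < 0 then (0, 0) else
        if 0 < x then (if x + y > 0 then (1, 0) else (1, -1)) else
        (if x + y > 0 then (0, 1) else (-1, 1)))"
      obtain u v :: real where uv: "u \<noteq> 0 \<or> v \<noteq> 0" and
        uv2: "\<And>x y. (x, y) \<in> S3 \<Longrightarrow> u * of_int x + v * of_int y \<le> u * of_int (fst r) + v * of_int (snd r)"
        using hollow_functional[OF hS3, where r = r] by blast
      note w = uv2[OF in3(1)] uv2[OF in3(2)] uv2[OF in3(3)] uv2[OF xy(1)]
      have pos: "a = 0 \<and> b = 0" if "a \<ge> 0" "b \<ge> 0" "i > 0" "j > 0" "of_int i * a + of_int j * b \<le> 0"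
        for a b :: real and i j :: int
      proof -
        have "of_int i * a \<ge> 0" "of_int j * b \<ge> 0" using that by auto
        then have "of_int i * a = 0" "of_int j * b = 0" using that(5) by linarith+
        then show ?thesis using that by auto
      qed
      consider (a) "0 < x" "0 < y" | (b) "x < 0" "y < 0" | (c) "0 < x" "y < 0" "x + y > 0"
        | (d) "0 < x" "y < 0" "x + y < 0" | (e) "x < 0" "0 < y" "x + y > 0"
        | (f) "x < 0" "0 < y" "x + y < 0"
        using x neg by (metis linorder_less_linear)
      then show False
      proof cases
        case a
        then have "x > 1" "y > 1" using neg by auto
        then show False using pos[of u v "x - 1" "y - 1"] w uv a by (auto simp: r_def algebra_simps)
      next
        case b
        then show False using pos[of "- u" "- v" "- x" "- y"] w uv by (auto simp: r_def algebra_simps)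
      next
        case c
        then have "x + y > 1" using x by auto
        then show False using pos[of u "u - v" "x + y - 1" "- y"] w uv c
          by (auto simp: r_def algebra_simps)
      next
        case d
        then have "x > 1" using neg by auto
        then show False using pos[of "u - v" "- v" "x - 1" "- x - y"] w uv d
          by (auto simp: r_def algebra_simps)
      next
        case e
        then have "x + y > 1" using x by auto
        then show False using pos[of v "v - u" "x + y - 1" "- x"] w uv e
          by (auto simp: r_def algebra_simps)
      next
        case f
        then have "y > 1" using neg by auto
        then show False using pos[of "v - u" "- u" "y - 1" "- x - y"] w uv f
          by (auto simp: r_def algebra_simps)
      qed
    qed
    then consider "x = 1" | "y = 1" | "x + y = 0" by blast
    then show ?thesis
    proof cases
      case 1
      then have "unit_strip ((\<lambda>m. (snd m, fst m)) ` S3)" using S3 by (force simp: unit_strip_def)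
      then show ?thesis using eq3 lattice_equiv_swap lattice_equiv_trans by blast
    next
      case 2
      then have "unit_strip S3" using S3 by (force simp: unit_strip_def)
      then show ?thesis using eq3 by blast
    next
      case 3
      then have "unit_strip ((\<lambda>m. (fst m, fst m + snd m)) ` S3)"
        using S3 by (force simp: unit_strip_def)
      then show ?thesis using eq3 lattice_equiv_diagonal lattice_equiv_trans by blast
    qed
  qed
qed

text \<open>Two points that are congruent modulo 2 span a segment of even lattice length, which is
  moved onto the first axis as a long edge. If no two points are congruent, the segment between the
  given points is moved there: if its length is 1 the primitive case applies, otherwise it is a long
  edge again. Unimodular maps preserve incongruence modulo 2.\<close>

lemma hollow_classification:
  assumes S: "hollow S" and ab: "a \<in> S" "b \<in> S" "a \<noteq> b"
  shows "\<exists>S'. lattice_equiv S S' \<and> (unit_strip S' \<or> double_triangle S')"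
proof -
  \<comment> \<open>The difference is the gcd \<open>L\<close> of its coordinates times a primitive
    vector, and the latter is moved to \<open>(1, 0)\<close>.\<close>
  have normal: "\<exists>g. unimodular g \<and> (\<exists>L>0. g (d - c) = (L, 0)) \<and>
      (\<forall>L. g (d - c) = (L, 0) \<longrightarrow> L dvd fst (d - c) \<and> L dvd snd (d - c)) \<and>
      (\<forall>k. k dvd fst (d - c) \<longrightarrow> k dvd snd (d - c) \<longrightarrow> k dvd fst (g (d - c)))"
    if "c \<noteq> d" for c d :: "int \<times> int"
  proof -
    define L where "L = gcd (fst (d - c)) (snd (d - c))"
    have "fst (d - c) \<noteq> 0 \<or> snd (d - c) \<noteq> 0" using that by (auto simp: prod_eq_iff)
    then have L: "L > 0" unfolding L_def by auto
    define e where "e = (fst (d - c) div L, snd (d - c) div L)"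
    have "coprime (fst e) (snd e)"
      unfolding e_def L_def using \<open>fst (d - c) \<noteq> 0 \<or> snd (d - c) \<noteq> 0\<close>
      by (simp add: div_gcd_coprime)
    then obtain g where g: "unimodular g" "g e = (1, 0)" using primitive_to_unit by blast
    have "fst (d - c) = L * fst e" "snd (d - c) = L * snd e"
      unfolding e_def L_def by auto
    then have "g (d - c) = (L * fst (g e), L * snd (g e))"
      using g(1) unfolding unimodular_def by (auto simp: algebra_simps)
    then have "g (d - c) = (L, 0)" using g(2) by simp
    then show ?thesis using g(1) L unfolding L_def
      by (intro exI[of _ g]) auto
  qed
  show ?thesis
  proof (cases "\<exists>c\<in>S. \<exists>d\<in>S. c \<noteq> d \<and> even (fst d - fst c) \<and> even (snd d - snd c)")
    case True
    then obtain c d where cd: "c \<in> S" "d \<in> S" "c \<noteq> d" "even (fst (d - c))" "even (snd (d - c))"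
      by auto
    obtain g L where g: "unimodular g" "L > 0" "g (d - c) = (L, 0)"
      "\<And>k. k dvd fst (d - c) \<Longrightarrow> k dvd snd (d - c) \<Longrightarrow> k dvd fst (g (d - c))"
      using normal[OF cd(3)] by blast
    have "even L" using g(4)[OF cd(4,5)] g(3) by simp
    then have L: "L \<ge> 2" using g(2) by presburger
    define S1 where "S1 = (\<lambda>m. g m + (- g c)) ` S"
    have eq: "lattice_equiv S S1" unfolding S1_def lattice_equiv_def using g(1) by blast
    have "g c + (- g c) \<in> S1" "g d + (- g c) \<in> S1" unfolding S1_def using cd by blast+
    moreover have "g d + (- g c) = (L, 0)" using g(3) unimodular_diff[OF g(1), of d c] by simp
    moreover have "g c + (- g c) = (0, 0)" by (simp add: prod_eq_iff)
    ultimately have "(0, 0) \<in> S1" "(L, 0) \<in> S1" by simp_all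
    then show ?thesis
      using hollow_long_edge[OF hollow_lattice_equiv[OF S eq] _ _ L] eq lattice_equiv_trans by blast
  next
    case False
    obtain g L where g: "unimodular g" "L > 0" "g (b - a) = (L, 0)"
      "\<And>L. g (b - a) = (L, 0) \<Longrightarrow> L dvd fst (b - a) \<and> L dvd snd (b - a)"
      using normal[OF ab(3)] by blast
    define S1 where "S1 = (\<lambda>m. g m + (- g a)) ` S"
    have eq: "lattice_equiv S S1" unfolding S1_def lattice_equiv_def using g(1) by blast
    have "g a + (- g a) \<in> S1" "g b + (- g a) \<in> S1" unfolding S1_def using ab by blast+
    moreover have "g b + (- g a) = (L, 0)" using g(3) unimodular_diff[OF g(1), of b a] by simp
    moreover have "g a + (- g a) = (0, 0)" by (simp add: prod_eq_iff)
    ultimately have in1: "(0, 0) \<in> S1" "(L, 0) \<in> S1" by simp_all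
    show ?thesis
    proof (cases "L = 1")
      case True
      have "odd (fst y - fst x) \<or> odd (snd y - snd x)" if xy: "x \<in> S1" "y \<in> S1" "x \<noteq> y" for x y
      proof (rule ccontr)
        assume neg: "\<not> ?thesis"
        obtain x' y' where xy': "x' \<in> S" "y' \<in> S" "x = g x' + (- g a)" "y = g y' + (- g a)"
          using xy unfolding S1_def by blast
        have ne: "x' \<noteq> y'" using xy' xy(3) by auto
        obtain h where h: "unimodular h" "\<And>m. h (g m) = m"
          by (rule unimodular_inverse[OF g(1)]) blast
        have "y' - x' = h (y - x)" by (simp add: xy' h flip: unimodular_diff[OF g(1)])
        moreover have "even (fst (y - x))" "even (snd (y - x))" using neg by auto
        then have "even (fst (h (y - x)))" "even (snd (h (y - x)))"
          using h(1) unfolding unimodular_def by auto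
        ultimately have "even (fst (y' - x'))" "even (snd (y' - x'))" by simp_all
        then show False using False xy' ne by auto
      qed
      then show ?thesis
        using hollow_primitive[OF hollow_lattice_equiv[OF S eq]] in1 eq True lattice_equiv_trans
        by blast
    next
      case False
      then have "L \<ge> 2" using g(2) by simp
      then show ?thesis
        using hollow_long_edge[OF hollow_lattice_equiv[OF S eq] in1] eq lattice_equiv_trans by blast
    qed
  qed
qed

subsection \<open>Lattice points of Minkowski sums\<close>

lemma lattice_polygon_convex: "lattice_polygon Q \<Longrightarrow> convex Q"
  by (auto simp: lattice_polygon_def)

lemma lattice_polygon_compact: "lattice_polygon Q \<Longrightarrow> compact Q"
  by (auto simp: lattice_polygon_def intro: finite_imp_compact_convex_hull)

lemma finite_lattice_points:
  assumes "bounded Q"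
  shows "finite (lattice_points Q)"
proof -
  obtain B where B: "\<And>x. x \<in> Q \<Longrightarrow> norm x \<le> B"
    using assms unfolding bounded_iff by blast
  have "lattice_points Q \<subseteq> {- \<lceil>B\<rceil>..\<lceil>B\<rceil>} \<times> {- \<lceil>B\<rceil>..\<lceil>B\<rceil>}"
  proof
    fix m assume "m \<in> lattice_points Q"
    then have n: "norm (lat m) \<le> B" using B by (simp add: lattice_points_def)
    have "\<bar>real_of_int (fst m)\<bar> \<le> norm (lat m)" "\<bar>real_of_int (snd m)\<bar> \<le> norm (lat m)"
      using norm_fst_le[of "fst (lat m)" "snd (lat m)"] norm_snd_le[of "snd (lat m)" "fst (lat m)"]
      by (auto simp: lat_def)
    then have "\<bar>real_of_int (fst m)\<bar> \<le> \<lceil>B\<rceil>" "\<bar>real_of_int (snd m)\<bar> \<le> \<lceil>B\<rceil>"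
      using n le_of_int_ceiling[of B] by linarith+
    then show "m \<in> {- \<lceil>B\<rceil>..\<lceil>B\<rceil>} \<times> {- \<lceil>B\<rceil>..\<lceil>B\<rceil>}"
      by (cases m) auto
  qed
  then show ?thesis by (rule finite_subset) auto
qed

lemma lattice_polygon_finite: "lattice_polygon Q \<Longrightarrow> finite (lattice_points Q)"
  by (simp add: finite_lattice_points compact_imp_bounded lattice_polygon_compact)

lemma lat_add: "lat (m + n) = lat m + lat n"
  by (simp add: lat_def)

lemma lattice_polygon_hull:
  assumes "lattice_polygon Q"
  shows "Q = convex hull (lat ` lattice_points Q)"
proof -
  obtain S where S: "Q = convex hull (lat ` S)" using assms by (auto simp: lattice_polygon_def)
  have "S \<subseteq> lattice_points Q" by (auto simp: S lattice_points_def hull_inc)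
  moreover have "lat ` lattice_points Q \<subseteq> Q" by (auto simp: lattice_points_def)
  ultimately show ?thesis
    using lattice_polygon_convex[OF assms] S
    by (metis hull_minimal hull_mono image_mono subset_antisym)
qed

lemma lattice_polygon_nonempty: "lattice_polygon Q \<Longrightarrow> lattice_points Q \<noteq> {}"
  using lattice_polygon_hull by (fastforce simp: lattice_polygon_def)

lemma lattice_polygon_plus:
  assumes "lattice_polygon P" "lattice_polygon Q"
  shows "lattice_polygon (P + Q)"
proof -
  obtain S T where S: "finite S" "S \<noteq> {}" "P = convex hull (lat ` S)"
    and T: "finite T" "T \<noteq> {}" "Q = convex hull (lat ` T)"
    using assms by (auto simp: lattice_polygon_def)
  have "lat ` (S + T) = lat ` S + lat ` T"
  proof (intro equalityI subsetI)
    fix x assume "x \<in> lat ` (S + T)"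
    then show "x \<in> lat ` S + lat ` T"
      by (auto simp del: add_Pair simp: lat_add elim!: set_plus_elim intro!: set_plus_intro imageI)
  next
    fix x assume "x \<in> lat ` S + lat ` T"
    then obtain m n where "m \<in> S" "n \<in> T" "x = lat (m + n)"
      by (auto simp: lat_add elim!: set_plus_elim)
    then show "x \<in> lat ` (S + T)" by blast
  qed
  then have "P + Q = convex hull (lat ` (S + T))"
    by (simp add: S T convex_hull_set_plus)
  moreover have "finite (S + T)" "S + T \<noteq> {}"
    using S T by (auto simp: finite_set_plus)
  ultimately show ?thesis unfolding lattice_polygon_def by blast
qed

lemma lattice_polygon_bound:
  assumes "lattice_polygon Q" "x \<in> Q"
    and "\<And>m. m \<in> lattice_points Q \<Longrightarrow> u \<bullet> lat m \<le> c"
  shows "u \<bullet> x \<le> c"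
proof -
  have "Q \<subseteq> {x. u \<bullet> x \<le> c}"
    using assms(3) by (subst lattice_polygon_hull[OF assms(1)])
      (intro hull_minimal convex_halfspace_le; auto)
  then show ?thesis using assms(2) by auto
qed

lemma lattice_points_plus:
  "m \<in> lattice_points P \<Longrightarrow> n \<in> lattice_points Q \<Longrightarrow> m + n \<in> lattice_points (P + Q)"
  by (auto simp: lattice_points_def lat_add)

section \<open>Counting lattice points row by row\<close>

definition slice :: "(int \<times> int) set \<Rightarrow> int \<Rightarrow> int set" where
  "slice S y = {i. (i, y) \<in> S}"

lemma card_slices:
  assumes "finite S" "finite Y" "\<And>m. m \<in> S \<Longrightarrow> snd m \<in> Y"
  shows "card S = (\<Sum>y\<in>Y. card (slice S y))"
proof -
  have "S = (\<Union>y\<in>Y. (\<lambda>i. (i, y)) ` slice S y)"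
    using assms(3) by (force simp: slice_def)
  also have "card \<dots> = (\<Sum>y\<in>Y. card ((\<lambda>i. (i, y)) ` slice S y))"
  proof (rule card_UN_disjoint)
    have "(\<lambda>i. (i, y)) ` slice S y \<subseteq> S" for y by (auto simp: slice_def)
    then show "\<forall>y\<in>Y. finite ((\<lambda>i. (i, y)) ` slice S y)"
      using assms(1) finite_subset by blast
  qed (use assms in auto)
  also have "\<dots> = (\<Sum>y\<in>Y. card (slice S y))"
    by (intro sum.cong refl card_image) (auto simp: inj_on_def)
  finally show ?thesis .
qed

text \<open>A Minkowski sum can have rows beyond those that are counted, so only an intersection is
  decomposed.\<close>

lemma card_slices_restrict:
  assumes "finite S" "finite Y"
  shows "card (S \<inter> {m. snd m \<in> Y}) = (\<Sum>y\<in>Y. card (slice S y))"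
proof -
  have "card (S \<inter> {m. snd m \<in> Y}) = (\<Sum>y\<in>Y. card (slice (S \<inter> {m. snd m \<in> Y}) y))"
    using assms by (intro card_slices) auto
  also have "\<dots> = (\<Sum>y\<in>Y. card (slice S y))"
    by (intro sum.cong refl arg_cong[where f = card]) (auto simp: slice_def)
  finally show ?thesis .
qed

text \<open>If the two ends of the slice are \<open>l \<le> r\<close> then it contains
  \<open>\<lfloor>r\<rfloor> - \<lceil>l\<rceil> + 1\<close> lattice points, also if this number is 0.\<close>

lemma slice_interval:
  assumes Q: "lattice_polygon Q" and y: "(x1, y1) \<in> Q" "(x2, y2) \<in> Q" "y1 \<le> of_int y" "of_int y \<le> y2"
  obtains l r where "l \<le> r" "(l, of_int y) \<in> Q" "(r, of_int y) \<in> Q"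
    "slice (lattice_points Q) y = {\<lceil>l\<rceil>..\<lfloor>r\<rfloor>}"
    "\<And>x. (x, of_int y) \<in> Q \<Longrightarrow> l \<le> x \<and> x \<le> r"
proof -
  let ?H = "{p :: real \<times> real. snd p = of_int y}"
  define A where "A = fst ` (Q \<inter> ?H)"
  have A: "x \<in> A \<longleftrightarrow> (x, of_int y) \<in> Q" for x by (force simp: A_def)
  have "closed ?H" by (intro closed_Collect_eq continuous_intros)
  then have "compact (Q \<inter> ?H)" using lattice_polygon_compact[OF Q] by (simp add: compact_Int_closed)
  then have cA: "compact A" unfolding A_def by (intro compact_continuous_image continuous_intros)
  have convQ: "convex Q" using lattice_polygon_convex[OF Q] .
  have "A \<noteq> {}"
  proof (cases "y1 = y2")
    case True
    then show ?thesis using y A by (metis antisym empty_iff)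
  next
    case False
    define t where "t = (of_int y - y1) / (y2 - y1)"
    have t: "0 \<le> t" "t \<le> 1" using y False by (auto simp: t_def divide_simps)
    have "(1 - t) *\<^sub>R (x1, y1) + t *\<^sub>R (x2, y2) \<in> Q"
      using convexD_alt[OF convQ y(1,2) t] .
    moreover have "(1 - t) * y1 + t * y2 = of_int y"
    proof -
      have "t * (y2 - y1) = of_int y - y1" using False by (simp add: t_def)
      then show ?thesis by (simp add: algebra_simps)
    qed
    ultimately have "(1 - t) * x1 + t * x2 \<in> A" by (simp add: A)
    then show ?thesis by blast
  qed
  obtain l where l: "l \<in> A" "\<And>x. x \<in> A \<Longrightarrow> l \<le> x" using compact_attains_inf[OF cA \<open>A \<noteq> {}\<close>] by blast
  obtain r where r: "r \<in> A" "\<And>x. x \<in> A \<Longrightarrow> x \<le> r" using compact_attains_sup[OF cA \<open>A \<noteq> {}\<close>] by blast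
  have between: "x \<in> A" if "l \<le> x" "x \<le> r" for x
  proof (cases "l = r")
    case True
    then show ?thesis using that l by simp
  next
    case False
    define t where "t = (x - l) / (r - l)"
    have t: "0 \<le> t" "t \<le> 1" using that False by (auto simp: t_def divide_simps)
    have "(1 - t) *\<^sub>R (l, of_int y) + t *\<^sub>R (r, of_int y) \<in> Q"
      using convexD_alt[OF convQ _ _ t] l(1) r(1) A by blast
    moreover have "(1 - t) * l + t * r = x"
    proof -
      have "t * (r - l) = x - l" using False by (simp add: t_def)
      then show ?thesis by (simp add: algebra_simps)
    qed
    ultimately show ?thesis by (simp add: A algebra_simps)
  qed
  have "slice (lattice_points Q) y = {\<lceil>l\<rceil>..\<lfloor>r\<rfloor>}"
  proof -
    have "i \<in> slice (lattice_points Q) y \<longleftrightarrow> of_int i \<in> A" for i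
      by (simp add: slice_def lattice_points_def lat_def A)
    moreover have "of_int i \<in> A \<longleftrightarrow> l \<le> of_int i \<and> of_int i \<le> r" for i
      using l(2) r(2) between by blast
    ultimately show ?thesis by (auto simp: ceiling_le_iff le_floor_iff)
  qed
  moreover have "l \<le> r" using l(2) r(1) by blast
  ultimately show thesis using that[of l r] l r A by blast
qed

text \<open>The right ends of the slices of \<open>Q + T\<close> dominate the right ends of \<open>Q\<close>, shifted by
  \<open>r0\<close> up to row \<open>b\<close> and by \<open>r1\<close> from row \<open>b\<close> on, so that row \<open>b\<close> is used twice; similarly on
  the left.\<close>

lemma sum_switch_once:
  fixes f :: "int \<Rightarrow> int"
  assumes "y0 \<le> b" "b \<le> y1"
  shows "(\<Sum>y=y0..y1+1. if y \<le> b then f y + r else f (y - 1) + s) =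
    (\<Sum>y=y0..y1. f y) + f b + (b - y0 + 1) * r + (y1 + 1 - b) * s"
proof -
  have "(\<Sum>y=y0..y1+1. if y \<le> b then f y + r else f (y - 1) + s) =
      (\<Sum>y=y0..b. f y + r) + (\<Sum>y=b+1..y1+1. f (y - 1) + s)"
  proof -
    have "{y0..y1+1} = {y0..b} \<union> {b+1..y1+1}" using assms by auto
    then have "(\<Sum>y=y0..y1+1. if y \<le> b then f y + r else f (y - 1) + s) =
      (\<Sum>y=y0..b. if y \<le> b then f y + r else f (y - 1) + s) +
      (\<Sum>y=b+1..y1+1. if y \<le> b then f y + r else f (y - 1) + s)"
      by (simp add: sum.union_disjoint)
    then show ?thesis by simp
  qed
  also have "(\<Sum>y=b+1..y1+1. f (y - 1) + s) = (\<Sum>y=b..y1. f y + s)"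
    by (rule sum.reindex_bij_witness[of _ "\<lambda>y. y + 1" "\<lambda>y. y - 1"]) auto
  also have "(\<Sum>y=y0..b. f y + r) + (\<Sum>y=b..y1. f y + s) =
      (\<Sum>y=y0..b. f y) + (\<Sum>y=b..y1. f y) + (b - y0 + 1) * r + (y1 + 1 - b) * s"
    using assms by (simp add: sum.distrib algebra_simps)
  also have "(\<Sum>y=b..y1. f y) = f b + (\<Sum>y=b+1..y1. f y)"
  proof -
    have "{b..y1} = insert b {b+1..y1}" using assms by auto
    then show ?thesis by simp
  qed
  also have "(\<Sum>y=y0..b. f y) + (f b + (\<Sum>y=b+1..y1. f y)) = (\<Sum>y=y0..y1. f y) + f b"
  proof -
    have "{y0..y1} = {y0..b} \<union> {b+1..y1}" using assms by auto
    then show ?thesis by (simp add: sum.union_disjoint)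
  qed
  finally show ?thesis .
qed

text \<open>Only four points of \<open>T\<close> enter, the ends \<open>l0\<close>,
  \<open>r0\<close> and \<open>l1\<close>, \<open>r1\<close> in rows 0 and 1. Each of the
  \<open>y1 - y0 + 2\<close> rows of \<open>Q + T\<close> that are counted gets its right end from a
  row of \<open>Q\<close> shifted by \<open>r0\<close> or \<open>r1\<close>. The row
  \<open>b\<close> at which \<open>r0\<close> gives way to \<open>r1\<close> is used twice, and
  \<open>f b \<ge> u\<close> accounts for the second use; the left ends switch at a row
  \<open>c\<close> of their own. The additional row gives the final 1.\<close>

lemma card_lattice_points_plus_strip:
  assumes Q: "lattice_polygon Q" and T: "lattice_polygon T"
    and corners: "(l0, 0) \<in> lattice_points T" "(r0, 0) \<in> lattice_points T"
      "(l1, 1) \<in> lattice_points T" "(r1, 1) \<in> lattice_points T"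
    and rows: "\<And>x y. (x, y) \<in> lattice_points Q \<Longrightarrow> y0 \<le> y \<and> y \<le> y1"
    and attained: "(x0, y0) \<in> lattice_points Q" "(x1, y1) \<in> lattice_points Q"
    and b: "(u, b) \<in> lattice_points Q" and c: "(v, c) \<in> lattice_points Q"
  shows "int (card (lattice_points Q)) + (u + (b - y0) * r0 + (y1 - b) * r1) -
      (v + (c - y0) * l0 + (y1 - c) * l1) + (r0 - l0) + (r1 - l1) + 1
    \<le> int (card (lattice_points (Q + T)))"
proof -
  have QT: "lattice_polygon (Q + T)" using lattice_polygon_plus[OF Q T] .
  have y01: "y0 \<le> y1" using rows[OF attained(1)] by simp
  have in_Q: "(of_int x0, of_int y0) \<in> Q" "(of_int x1, of_int y1) \<in> Q"
    using attained by (auto simp: lattice_points_def lat_def)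
  have "\<exists>l r. l \<le> r \<and> (l, of_int y) \<in> Q \<and> (r, of_int y) \<in> Q \<and>
      slice (lattice_points Q) y = {\<lceil>l\<rceil>..\<lfloor>r\<rfloor>} \<and>
      (\<forall>x. (x, of_int y) \<in> Q \<longrightarrow> l \<le> x \<and> x \<le> r)" if "y0 \<le> y" "y \<le> y1" for y
    using slice_interval[OF Q in_Q, of y] that by (metis of_int_le_iff)
  then obtain L R where LR: "\<And>y. y0 \<le> y \<Longrightarrow> y \<le> y1 \<Longrightarrow> L y \<le> R y \<and> (L y, of_int y) \<in> Q \<and>
      (R y, of_int y) \<in> Q \<and> slice (lattice_points Q) y = {\<lceil>L y\<rceil>..\<lfloor>R y\<rfloor>} \<and>
      (\<forall>x. (x, of_int y) \<in> Q \<longrightarrow> L y \<le> x \<and> x \<le> R y)" by metis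
  define f where "f y = \<lfloor>R y\<rfloor>" for y
  define g where "g y = \<lceil>L y\<rceil>" for y
  have bc: "y0 \<le> b" "b \<le> y1" "y0 \<le> c" "c \<le> y1" using rows b c by auto
  have fb: "u \<le> f b" and gc: "g c \<le> v"
    using LR bc b c by (auto simp: f_def g_def le_floor_iff ceiling_le_iff lattice_points_def lat_def)
  have cardQ: "int (card (lattice_points Q)) = (\<Sum>y=y0..y1. f y - g y + 1)"
  proof -
    have "card (lattice_points Q) = (\<Sum>y=y0..y1. card (slice (lattice_points Q) y))"
      using rows by (intro card_slices lattice_polygon_finite[OF Q]) auto
    \<comment> \<open>By \<open>L y \<le> R y\<close> the integer on the right is nonnegative, so
      the equation also holds for a row without lattice points.\<close>
    moreover have "int (card (slice (lattice_points Q) y)) = f y - g y + 1" if "y \<in> {y0..y1}" for y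
    proof -
      have "L y \<le> R y" "slice (lattice_points Q) y = {\<lceil>L y\<rceil>..\<lfloor>R y\<rfloor>}" using LR that by auto
      then show ?thesis unfolding f_def g_def by simp linarith
    qed
    ultimately show ?thesis by (simp del: of_nat_sum add: of_nat_sum)
  qed
  define F where "F y = (if y \<le> b then f y + r0 else f (y - 1) + r1)" for y
  define G where "G y = (if y \<le> c then g y + l0 else g (y - 1) + l1)" for y
  have T4: "(of_int l0, 0) \<in> T" "(of_int r0, 0) \<in> T" "(of_int l1, 1) \<in> T" "(of_int r1, 1) \<in> T"
    using corners by (auto simp: lattice_points_def lat_def)
  have slice: "F y - G y + 1 \<le> int (card (slice (lattice_points (Q + T)) y))"
    if y: "y \<in> {y0..y1+1}" for y
  proof -
    define R' where "R' = (if y \<le> b then R y + of_int r0 else R (y - 1) + of_int r1)"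
    define L' where "L' = (if y \<le> c then L y + of_int l0 else L (y - 1) + of_int l1)"
    have "(R', of_int y) \<in> Q + T"
    proof (cases "y \<le> b")
      case True
      then have "(R y, of_int y) + (of_int r0, 0) \<in> Q + T"
        using LR y bc T4 by (intro set_plus_intro) auto
      then show ?thesis using True by (simp add: R'_def)
    next
      case False
      then have "(R (y - 1), of_int (y - 1)) + (of_int r1, 1) \<in> Q + T"
        using LR[of "y - 1"] y bc T4 by (intro set_plus_intro) auto
      then show ?thesis using False by (simp add: R'_def)
    qed
    moreover have "(L', of_int y) \<in> Q + T"
    proof (cases "y \<le> c")
      case True
      then have "(L y, of_int y) + (of_int l0, 0) \<in> Q + T"
        using LR y bc T4 by (intro set_plus_intro) auto
      then show ?thesis using True by (simp add: L'_def)
    next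
      case False
      then have "(L (y - 1), of_int (y - 1)) + (of_int l1, 1) \<in> Q + T"
        using LR[of "y - 1"] y bc T4 by (intro set_plus_intro) auto
      then show ?thesis using False by (simp add: L'_def)
    qed
    ultimately obtain l r where lr: "l \<le> r" "slice (lattice_points (Q + T)) y = {\<lceil>l\<rceil>..\<lfloor>r\<rfloor>}"
      "l \<le> L'" "R' \<le> r"
      using slice_interval[OF QT, of R' "of_int y" R' "of_int y" y] by (metis order_refl)
    have "F y = \<lfloor>R'\<rfloor>" "G y = \<lceil>L'\<rceil>" by (auto simp: F_def G_def R'_def L'_def f_def g_def)
    then have "F y \<le> \<lfloor>r\<rfloor>" "\<lceil>l\<rceil> \<le> G y" using lr by (auto intro: floor_mono ceiling_mono)
    then show ?thesis using lr by simp
  qed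
  have "(\<Sum>y=y0..y1+1. F y - G y + 1) \<le> (\<Sum>y=y0..y1+1. int (card (slice (lattice_points (Q + T)) y)))"
    by (intro sum_mono slice)
  also have "\<dots> = int (\<Sum>y=y0..y1+1. card (slice (lattice_points (Q + T)) y))" by simp
  also have "(\<Sum>y=y0..y1+1. card (slice (lattice_points (Q + T)) y)) =
      card (lattice_points (Q + T) \<inter> {m. snd m \<in> {y0..y1+1}})"
    by (rule card_slices_restrict[symmetric]) (simp_all add: lattice_polygon_finite[OF QT])
  also have "\<dots> \<le> int (card (lattice_points (Q + T)))"
    using lattice_polygon_finite[OF QT] by (simp add: card_mono)
  finally have le: "(\<Sum>y=y0..y1+1. F y - G y + 1) \<le> int (card (lattice_points (Q + T)))" .
  have "(\<Sum>y=y0..y1+1. F y - G y + 1) = (\<Sum>y=y0..y1+1. F y) - (\<Sum>y=y0..y1+1. G y) + (y1 - y0 + 2)"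
    using y01 by (simp add: sum.distrib sum_subtractf)
  also have "(\<Sum>y=y0..y1+1. F y) = (\<Sum>y=y0..y1. f y) + f b + (b - y0 + 1) * r0 + (y1 + 1 - b) * r1"
    unfolding F_def by (rule sum_switch_once[OF bc(1,2)])
  also have "(\<Sum>y=y0..y1+1. G y) = (\<Sum>y=y0..y1. g y) + g c + (c - y0 + 1) * l0 + (y1 + 1 - c) * l1"
    unfolding G_def by (rule sum_switch_once[OF bc(3,4)])
  finally have sum: "(\<Sum>y=y0..y1+1. F y - G y + 1) =
    (\<Sum>y=y0..y1. f y) + f b + (b - y0 + 1) * r0 + (y1 + 1 - b) * r1 -
    ((\<Sum>y=y0..y1. g y) + g c + (c - y0 + 1) * l0 + (y1 + 1 - c) * l1) + (y1 - y0 + 2)" .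
  have "int (card (lattice_points Q)) = (\<Sum>y=y0..y1. f y) - (\<Sum>y=y0..y1. g y) + (y1 - y0 + 1)"
    unfolding cardQ using y01 by (simp add: sum.distrib sum_subtractf)
  then show ?thesis using le sum fb gc by (simp add: algebra_simps)
qed

text \<open>Each row of \<open>Q\<close> gains at least one lattice point, since its left and right
  ends are shifted by the different integers \<open>l0 < r0\<close>.\<close>

lemma card_lattice_points_plus_segment:
  assumes Q: "lattice_polygon Q" and T: "lattice_polygon T"
    and corners: "(l0, t) \<in> lattice_points T" "(r0, t) \<in> lattice_points T" "l0 < r0"
    and attained: "(x0, y0) \<in> lattice_points Q" "(x1, y1) \<in> lattice_points Q"
    and rows: "\<And>x y. (x, y) \<in> lattice_points Q \<Longrightarrow> y0 \<le> y \<and> y \<le> y1"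
  shows "int (card (lattice_points Q)) + (y1 - y0) + 1 \<le> int (card (lattice_points (Q + T)))"
proof -
  have QT: "lattice_polygon (Q + T)" using lattice_polygon_plus[OF Q T] .
  have y01: "y0 \<le> y1" using rows[OF attained(1)] by simp
  have in_Q: "(of_int x0, of_int y0) \<in> Q" "(of_int x1, of_int y1) \<in> Q"
    using attained by (auto simp: lattice_points_def lat_def)
  have T2: "(of_int l0, of_int t) \<in> T" "(of_int r0, of_int t) \<in> T"
    using corners by (auto simp: lattice_points_def lat_def)
  have slice: "int (card (slice (lattice_points Q) y)) + 1 \<le> int (card (slice (lattice_points (Q + T)) (y + t)))"
    if y: "y \<in> {y0..y1}" for y
  proof -
    obtain l r where lr: "l \<le> r" "(l, of_int y) \<in> Q" "(r, of_int y) \<in> Q"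
      "slice (lattice_points Q) y = {\<lceil>l\<rceil>..\<lfloor>r\<rfloor>}"
      using slice_interval[OF Q in_Q, of y] y by (metis atLeastAtMost_iff of_int_le_iff)
    have "(l, of_int y) + (of_int l0, of_int t) \<in> Q + T" "(r, of_int y) + (of_int r0, of_int t) \<in> Q + T"
      using lr T2 by (intro set_plus_intro; auto)+
    then have "(l + of_int l0, of_int (y + t)) \<in> Q + T" "(r + of_int r0, of_int (y + t)) \<in> Q + T" by auto
    then obtain l' r' where lr': "l' \<le> r'" "slice (lattice_points (Q + T)) (y + t) = {\<lceil>l'\<rceil>..\<lfloor>r'\<rfloor>}"
      "l' \<le> l + of_int l0" "r + of_int r0 \<le> r'"
      using slice_interval[OF QT, of _ "of_int (y + t)" _ "of_int (y + t)" "y + t"] by (metis order_refl)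
    have "\<lceil>l'\<rceil> \<le> \<lceil>l + of_int l0\<rceil>" "\<lfloor>r + of_int r0\<rfloor> \<le> \<lfloor>r'\<rfloor>"
      using lr'(3,4) ceiling_mono floor_mono by blast+
    then have "\<lceil>l'\<rceil> \<le> \<lceil>l\<rceil> + l0" "\<lfloor>r\<rfloor> + r0 \<le> \<lfloor>r'\<rfloor>" by auto
    \<comment> \<open>Rows of \<open>Q\<close> without lattice points have to gain one as
      well.\<close>
    moreover have "\<lceil>l\<rceil> \<le> \<lfloor>r\<rfloor> + 1" using lr(1) by linarith
    ultimately show ?thesis using corners(3) by (simp add: lr(4) lr'(2))
  qed
  have "card (lattice_points Q) = (\<Sum>y=y0..y1. card (slice (lattice_points Q) y))"
    using rows by (intro card_slices lattice_polygon_finite[OF Q]) auto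
  then have "int (card (lattice_points Q)) + (y1 - y0) + 1 =
      (\<Sum>y=y0..y1. int (card (slice (lattice_points Q) y)) + 1)"
    using y01 by (simp add: sum.distrib)
  also have "\<dots> \<le> (\<Sum>y=y0..y1. int (card (slice (lattice_points (Q + T)) (y + t))))"
    by (intro sum_mono slice)
  also have "\<dots> = int (\<Sum>y=y0..y1. card (slice (lattice_points (Q + T)) (y + t)))" by simp
  also have "(\<Sum>y=y0..y1. card (slice (lattice_points (Q + T)) (y + t))) =
      (\<Sum>y=y0+t..y1+t. card (slice (lattice_points (Q + T)) y))"
    by (rule sum.reindex_bij_witness[of _ "\<lambda>y. y - t" "\<lambda>y. y + t"]) auto
  also have "\<dots> = card (lattice_points (Q + T) \<inter> {m. snd m \<in> {y0+t..y1+t}})"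
    by (rule card_slices_restrict[symmetric]) (simp_all add: lattice_polygon_finite[OF QT])
  also have "\<dots> \<le> int (card (lattice_points (Q + T)))"
    using lattice_polygon_finite[OF QT] by (simp add: card_mono)
  finally show ?thesis .
qed

subsection \<open>Inclusions of irreducible curves\<close>

text \<open>Over a finite field, 1 plus the product of all \<open>X - a\<close> is a nonconstant
  polynomial without roots.\<close>

lemma alg_closed_infinite: "infinite (UNIV :: 'a::alg_closed_field set)"
proof
  assume fin: "finite (UNIV :: 'a set)"
  define p :: "'a poly" where "p = (\<Prod>a\<in>UNIV. [:-a, 1:]) + 1"
  have d: "degree (\<Prod>a\<in>(UNIV :: 'a set). [:-a, 1:]) = card (UNIV :: 'a set)"
    by (subst degree_prod_eq_sum_degree) auto
  have "card (UNIV :: 'a set) > 0" using fin by (simp add: card_gt_0_iff)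
  then have "degree p > 0" unfolding p_def using d by (subst degree_add_eq_left) auto
  then obtain x where "poly p x = 0" using alg_closed_imp_poly_has_root by blast
  moreover have "poly (\<Prod>a\<in>(UNIV :: 'a set). [:-a, 1:]) x = 0"
    using fin by (simp add: poly_prod prod_zero_iff)
  ultimately show False by (simp add: p_def)
qed

text \<open>The ring is \<open>K[x][y]\<close>: the outer variable is \<open>y\<close>, the
  coefficients are polynomials in \<open>x\<close>.\<close>

definition poly2 :: "'a::comm_semiring_1 poly poly \<Rightarrow> 'a \<Rightarrow> 'a \<Rightarrow> 'a" where
  "poly2 p x y = poly (poly p [:y:]) x"

lemma poly2_simps [simp]:
  "poly2 (p + q) x y = poly2 p x y + poly2 q x y"
  "poly2 (p * q) x y = poly2 p x y * poly2 q x y"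
  "poly2 0 x y = 0"
  "poly2 (smult c p) x y = poly c x * poly2 p x y"
  "poly2 (monom c n) x y = poly c x * y ^ n"
  "poly2 [:c:] x y = poly c x"
  by (simp_all add: poly2_def poly_monom)

lemma poly2_one [simp]: "poly2 (1 :: 'a::comm_semiring_1 poly poly) x y = 1"
  by (simp add: poly2_def)

lemma poly2_power [simp]: "poly2 (p ^ n :: 'a::comm_semiring_1 poly poly) x y = poly2 p x y ^ n"
  by (induction n) auto

lemma poly2_prod_mset: "poly2 (prod_mset A :: 'a::comm_semiring_1 poly poly) x y = (\<Prod>p\<in>#A. poly2 p x y)"
  by (induction A) auto

lemma poly2_eq_poly_map_poly: "poly2 p x y = poly (map_poly (\<lambda>c. poly c x) p) y"
proof (induction p)
  case (pCons a p)
  then show ?case by (simp add: poly2_def map_poly_pCons)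
qed (auto simp: poly2_def)

definition zeros2 :: "'a::field poly poly \<Rightarrow> ('a \<times> 'a) set" where
  "zeros2 p = {(x, y). x \<noteq> 0 \<and> y \<noteq> 0 \<and> poly2 p x y = 0}"

lemma zeros2_mult: "zeros2 (p * q) = zeros2 p \<union> zeros2 q"
  by (auto simp: zeros2_def)

text \<open>Multiplication by \<open>x^N y^N\<close> clears the negative exponents, and monomials
  have no zeros in the torus. That \<open>p\<close> is not zero is recorded so that the multiplicity
  of a prime in it is finite.\<close>

lemma laurent_shift_to_poly:
  fixes f :: "'a::field laurent"
  shows "\<exists>p. zeros f = zeros2 p \<and> (f \<noteq> 0 \<longrightarrow> p \<noteq> 0)"
proof -
  define N where "N = Max (insert 0 ((\<lambda>m. max (- fst m) (- snd m)) ` Poly_Mapping.keys f))"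
  have N: "0 \<le> N + fst m" "0 \<le> N + snd m" if "m \<in> Poly_Mapping.keys f" for m
  proof -
    have "max (- fst m) (- snd m) \<le> N" unfolding N_def using that by (intro Max_ge) auto
    then show "0 \<le> N + fst m" "0 \<le> N + snd m" by auto
  qed
  define p where "p = (\<Sum>m\<in>Poly_Mapping.keys f.
    monom (monom (Poly_Mapping.lookup f m) (nat (N + fst m))) (nat (N + snd m)))"
  have sum: "poly2 (\<Sum>m\<in>S. P m) x y = (\<Sum>m\<in>S. poly2 (P m) x y)" for S and P :: "int \<times> int \<Rightarrow> 'a poly poly" and x y
    by (induction S rule: infinite_finite_induct) auto
  have "poly2 p x y = x powi N * y powi N * laurent_eval f (x, y)" if "x \<noteq> 0" "y \<noteq> 0" for x y
  proof -
    have "poly2 p x y = (\<Sum>m\<in>Poly_Mapping.keys f. Poly_Mapping.lookup f m * x ^ nat (N + fst m) * y ^ nat (N + snd m))"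
      by (simp add: p_def sum poly_monom)
    also have "\<dots> = (\<Sum>m\<in>Poly_Mapping.keys f.
        x powi N * y powi N * (Poly_Mapping.lookup f m * torus_char (x, y) m))"
    proof (rule sum.cong)
      fix m assume "m \<in> Poly_Mapping.keys f"
      then have "x ^ nat (N + fst m) = x powi (N + fst m)" "y ^ nat (N + snd m) = y powi (N + snd m)"
        using N by (simp_all add: power_int_def)
      then show "Poly_Mapping.lookup f m * x ^ nat (N + fst m) * y ^ nat (N + snd m) =
          x powi N * y powi N * (Poly_Mapping.lookup f m * torus_char (x, y) m)"
        using that by (simp add: power_int_add torus_char_def)
    qed simp
    finally show ?thesis by (simp add: laurent_eval_def sum_distrib_left)
  qed
  then have "zeros f = zeros2 p" by (auto simp: zeros_def zeros2_def torus_def)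
  moreover have "p \<noteq> 0" if "f \<noteq> 0"
  proof -
    have "\<exists>m. Poly_Mapping.lookup f m \<noteq> 0"
    proof (rule ccontr)
      assume "\<nexists>m. Poly_Mapping.lookup f m \<noteq> 0"
      then have "f = 0" by (intro poly_mapping_eqI) auto
      then show False using that by simp
    qed
    then obtain m where m: "m \<in> Poly_Mapping.keys f" by (metis in_keys_iff)
    have "coeff (coeff p (nat (N + snd m))) (nat (N + fst m)) =
        (\<Sum>n\<in>Poly_Mapping.keys f. if n = m then Poly_Mapping.lookup f n else 0)"
      unfolding p_def coeff_sum
    proof (rule sum.cong)
      fix n assume n: "n \<in> Poly_Mapping.keys f"
      have "nat (N + fst n) = nat (N + fst m) \<longleftrightarrow> fst n = fst m"
        "nat (N + snd n) = nat (N + snd m) \<longleftrightarrow> snd n = snd m"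
        using N[OF m] N[OF n] by (auto simp: nat_eq_iff)
      then show "coeff (coeff (monom (monom (Poly_Mapping.lookup f n) (nat (N + fst n))) (nat (N + snd n)))
          (nat (N + snd m))) (nat (N + fst m)) = (if n = m then Poly_Mapping.lookup f n else 0)"
        by (simp add: prod_eq_iff)
    qed simp
    also have "\<dots> \<noteq> 0" using m by (simp add: in_keys_iff)
    finally show ?thesis by auto
  qed
  ultimately show ?thesis by blast
qed

definition poly_to_laurent :: "'a::field poly poly \<Rightarrow> 'a laurent" where
  "poly_to_laurent p = (\<Sum>j\<le>degree p. \<Sum>i\<le>degree (coeff p j).
     Poly_Mapping.single (int i, int j) (coeff (coeff p j) i))"

lemma laurent_eval_sum: "laurent_eval (\<Sum>i\<in>I. f i) p = (\<Sum>i\<in>I. laurent_eval (f i) p)"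
  by (induction I rule: infinite_finite_induct) (auto simp: laurent_eval_add)

lemma laurent_eval_poly_to_laurent: "laurent_eval (poly_to_laurent p) (x, y) = poly2 p x y"
proof -
    have "laurent_eval (poly_to_laurent p) (x, y) =
        (\<Sum>j\<le>degree p. \<Sum>i\<le>degree (coeff p j). coeff (coeff p j) i * x ^ i * y ^ j)"
      by (simp add: poly_to_laurent_def laurent_eval_sum torus_char_def mult.assoc)
    also have "\<dots> = (\<Sum>j\<le>degree p. poly (coeff p j) x * y ^ j)"
      by (simp add: poly_altdef sum_distrib_right)
    also have "\<dots> = poly2 p x y"
      by (simp add: poly2_def poly_altdef[of p] poly_sum)
    finally show ?thesis .
qed

lemma zeros_poly_to_laurent: "zeros (poly_to_laurent p) = zeros2 p"
  by (auto simp: zeros_def zeros2_def torus_def laurent_eval_poly_to_laurent)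

lemma irreducible_zeros2D:
  assumes "irreducible_zeros Z" "Z \<subseteq> zeros2 p \<union> zeros2 q"
  shows "Z \<subseteq> zeros2 p \<or> Z \<subseteq> zeros2 q"
  using irreducible_zerosD[OF assms(1), of "poly_to_laurent p" "poly_to_laurent q"] assms(2)
  by (simp add: zeros_poly_to_laurent)

text \<open>An element of least degree in \<open>y\<close> of the ideal \<open>(p, h)\<close> divides \<open>p\<close> and \<open>h\<close> up to factors
  from \<open>K[x]\<close>.\<close>

lemma prime_combination:
  fixes p h :: "'a::field poly poly"
  assumes p: "prime_elem p" "degree p > 0" and "\<not> p dvd h"
  obtains u v r where "u * p + v * h = [:r:]" "r \<noteq> 0"
proof -
  define I where "I = {r. r \<noteq> 0 \<and> (\<exists>u v. r = u * p + v * h)}"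
  have p0: "p \<noteq> 0" using p by auto
  have "p \<in> I" 
  proof -
    have "p = 1 * p + 0 * h" by simp
    then show ?thesis unfolding I_def using p0 by blast
  qed
  then obtain r where r: "r \<in> I" "\<And>r'. r' \<in> I \<Longrightarrow> degree r \<le> degree r'"
    using ex_has_least_nat[of "\<lambda>r. r \<in> I" p degree] by blast
  have r0: "r \<noteq> 0" using r(1) by (simp add: I_def)
  obtain u v where uv: "r = u * p + v * h" using r(1) by (auto simp: I_def)
  \<comment> \<open>The coefficients form only the ring \<open>K[x]\<close>, so division by
    \<open>r\<close> is pseudo-division and costs a factor \<open>a\<close>. The remainder lies in
    the ideal and has smaller degree if it is not zero, hence it is zero.\<close>
  have div: "\<exists>a q. a \<noteq> 0 \<and> smult a f = r * q" if f: "f = s * p + t * h" for f s t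
  proof -
    obtain a q where aq: "a \<noteq> 0" "smult a f = r * q + pseudo_mod f r"
      using pseudo_mod(1)[OF r0] by blast
    have "pseudo_mod f r = 0"
    proof (rule ccontr)
      assume ne: "pseudo_mod f r \<noteq> 0"
      have "pseudo_mod f r = smult a f - r * q" using aq(2) by simp
      also have "\<dots> = (smult a s - q * u) * p + (smult a t - q * v) * h"
        by (simp add: f uv algebra_simps smult_add_right)
      finally have "pseudo_mod f r \<in> I" using ne unfolding I_def by blast
      then show False using r(2) pseudo_mod(2)[OF r0, of f] ne by fastforce
    qed
    then show ?thesis using aq by auto
  qed
  have "degree r = 0"
  proof (rule ccontr)
    assume dr: "degree r \<noteq> 0"
    obtain a q where aq: "a \<noteq> 0" "smult a p = r * q" using div[of p 1 0] by auto
    obtain b q' where bq: "b \<noteq> 0" "smult b h = r * q'" using div[of h 0 1] by auto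
    \<comment> \<open>If \<open>p\<close> divides \<open>r\<close>, it divides \<open>b h\<close>
      and hence \<open>b\<close>, against its positive degree in \<open>y\<close>. If it divides
      \<open>q\<close>, then \<open>r\<close> divides \<open>a\<close> and has degree 0.\<close>
    have "p dvd r * q" by (metis aq(2) dvd_refl dvd_smult)
    then consider "p dvd r" | "p dvd q" using p(1) prime_elem_dvd_multD by blast
    then show False
    proof cases
      case 1
      then have "p dvd smult b h" by (simp add: bq)
      then have "p dvd [:b:] * h" by simp
      then have "p dvd [:b:]" using p(1) assms(3) prime_elem_dvd_multD by blast
      then have "degree p \<le> degree [:b:]" using bq(1) by (intro dvd_imp_degree_le) auto
      then show False using p(2) by simp
    next
      case 2
      then obtain q1 where "q = p * q1" by (elim dvdE)
      then have "p * (r * q1) = p * [:a:]" using aq(2) by (simp add: algebra_simps)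
      then have "r * q1 = [:a:]" using p0 by (metis mult_cancel_left)
      moreover have "q1 \<noteq> 0" using calculation aq(1) by auto
      ultimately show False using dr r0 by (metis add_is_0 degree_mult_eq degree_pCons_0)
    qed
  qed
  then obtain c where "r = [:c:]" by (elim degree_eq_zeroE)
  then show thesis using that uv r0 by (metis pCons_eq_0_iff)
qed

text \<open>A Nullstellensatz for a prime with a zero in the torus. If \<open>p\<close> does not
  divide \<open>h\<close>, a nonzero \<open>r\<close> in \<open>K[x]\<close> is a combination of
  both and vanishes at the first coordinate of every zero of \<open>p\<close>; but outside a finite
  set of \<open>x\<close> the polynomial \<open>p(x, y)\<close> has a nonzero root \<open>y\<close>.
  A prime of degree 0 in \<open>y\<close> describes the line \<open>x = x0\<close> and is treated
  apart.\<close>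

lemma zeros2_prime_subset:
  fixes p h :: "'a::alg_closed_field poly poly"
  assumes p: "prime_elem p" and ne: "zeros2 p \<noteq> {}" and sub: "zeros2 p \<subseteq> zeros2 h"
  shows "p dvd h"
proof (rule ccontr)
  assume ndvd: "\<not> p dvd h"
  have p0: "p \<noteq> 0" using p by auto
  obtain x0 y0 where xy0: "x0 \<noteq> 0" "y0 \<noteq> 0" "poly2 p x0 y0 = 0" using ne by (auto simp: zeros2_def)
  note irr = irreducibleD'[OF prime_elem_imp_irreducible[OF p]]
  show False
  proof (cases "degree p = 0")
    case True
    then obtain a where a: "p = [:a:]" by (elim degree_eq_zeroE)
    define c where "c = [:-x0, 1:]"
    have "c dvd a" using xy0 by (simp add: a c_def poly_eq_0_iff_dvd)
    then have "[:c:] dvd p" by (simp add: a const_poly_dvd_const_poly_iff)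
    moreover have "\<not> is_unit [:c:]" by (simp add: c_def is_unit_const_poly_iff is_unit_pCons_iff)
    ultimately have "p dvd [:c:]" using irr by blast
    moreover have "[:c:] dvd h"
    proof -
      have "poly (map_poly (\<lambda>c. poly c x0) h) y = 0" if "y \<noteq> 0" for y
      proof -
        have "(x0, y) \<in> zeros2 p" using xy0 that by (simp add: zeros2_def a)
        then show ?thesis using sub by (auto simp: zeros2_def poly2_eq_poly_map_poly)
      qed
      then have "UNIV - {0} \<subseteq> {y. poly (map_poly (\<lambda>c. poly c x0) h) y = 0}" by auto
      then have "infinite {y. poly (map_poly (\<lambda>c. poly c x0) h) y = 0}"
        using alg_closed_infinite by (meson finite_subset finite_Diff2 finite.emptyI finite.insertI)
      then have "map_poly (\<lambda>c. poly c x0) h = 0" using poly_roots_finite by blast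
      then have "poly (coeff h n) x0 = 0" for n by (metis coeff_0 coeff_map_poly poly_0)
      then show ?thesis by (simp add: const_poly_dvd_iff c_def poly_eq_0_iff_dvd)
    qed
    ultimately show False using ndvd dvd_trans by blast
  next
    case False
    then obtain u v r where uv: "u * p + v * h = [:r:]" "r \<noteq> 0"
      using prime_combination[OF p _ ndvd] by blast
    have r: "poly r x = 0" if "(x, y) \<in> zeros2 p" for x y
    proof -
      have "poly2 (u * p + v * h) x y = 0" using that sub by (auto simp: zeros2_def)
      then show ?thesis by (simp add: uv)
    qed
    \<comment> \<open>Otherwise \<open>p\<close> is associated to \<open>y\<close>, which has no
      zero in the torus.\<close>
    have "coeff p 0 \<noteq> 0"
    proof
      assume "coeff p 0 = 0"
      then have "[:0, 1:] dvd p" by (simp add: dvd_iff_poly_eq_0 poly_0_coeff_0)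
      moreover have "\<not> is_unit ([:0, 1:] :: 'a poly poly)" by (auto simp: is_unit_poly_iff)
      ultimately have "p dvd [:0, 1:]" using irr by blast
      then obtain k where "[:0, 1:] = p * k" by (elim dvdE)
      then have "poly2 [:0, 1:] x0 y0 = 0" using xy0 by simp
      then show False using xy0 by (simp add: poly2_def)
    qed
    \<comment> \<open>At a non-root \<open>x\<close> of \<open>s\<close>, the value of
      \<open>r\<close> is not zero, the degree of \<open>p\<close> in \<open>y\<close> is preserved,
      roots \<open>y\<close> are nonzero, and \<open>x\<close> itself is nonzero.\<close>
    define s where "s = r * lead_coeff p * coeff p 0 * [:0, 1:]"
    have "s \<noteq> 0" using uv(2) p0 \<open>coeff p 0 \<noteq> 0\<close> by (simp add: s_def)
    then have "finite {x. poly s x = 0}" by (rule poly_roots_finite)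
    then have "{x. poly s x = 0} \<noteq> UNIV" using alg_closed_infinite by metis
    then obtain x where "poly s x \<noteq> 0" by blast
    then have x: "poly r x \<noteq> 0" "poly (lead_coeff p) x \<noteq> 0" "poly (coeff p 0) x \<noteq> 0" "x \<noteq> 0"
      by (auto simp: s_def)
    define q where "q = map_poly (\<lambda>c. poly c x) p"
    have "degree q = degree p" unfolding q_def using x(2) by (rule map_poly_degree_eq)
    then obtain y where y: "poly q y = 0" using alg_closed_imp_poly_has_root[of q] False by auto
    have "poly q 0 \<noteq> 0" using x(3) by (simp add: q_def poly_0_coeff_0 coeff_map_poly)
    then have "y \<noteq> 0" using y by auto
    then have "(x, y) \<in> zeros2 p" using x(4) y by (simp add: zeros2_def poly2_eq_poly_map_poly q_def)
    then show False using r x(1) by blast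
  qed
qed

text \<open>Some prime factor \<open>p\<close> of \<open>G\<close> has a zero in the torus, and all
  its zeros lie on \<open>h\<close>, so it divides \<open>H\<close>. Once all powers of
  \<open>p\<close> are split off from \<open>H\<close>, irreducibility puts \<open>zeros h\<close>
  either into the zeros of \<open>p\<close>, and thus of \<open>g\<close>, or into those of the
  cofactor; the latter would make \<open>p\<close> divide the cofactor.\<close>

lemma irreducible_zeros_antisym:
  fixes g h :: "'a::{alg_closed_field, factorial_ring_gcd, semiring_gcd_mult_normalize} laurent"
  assumes g: "irreducible_zeros (zeros g)" and h: "irreducible_zeros (zeros h)" "h \<noteq> 0"
    and sub: "zeros g \<subseteq> zeros h"
  shows "zeros h \<subseteq> zeros g"
proof -
  obtain G where G: "zeros g = zeros2 G" using laurent_shift_to_poly by blast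
  obtain H where H: "zeros h = zeros2 H" "H \<noteq> 0" using laurent_shift_to_poly[of h] h(2) by blast
  show ?thesis
  proof (cases "G = 0")
    case True
    then show ?thesis by (auto simp: G H zeros2_def)
  next
    case False
    obtain x y where xy: "x \<noteq> 0" "y \<noteq> 0" "poly2 G x y = 0"
      using g by (auto simp: irreducible_zeros_def G zeros2_def)
    obtain A where A: "\<forall>p. p \<in># A \<longrightarrow> prime_elem p" "normalize (prod_mset A) = normalize G"
      using prime_factorization_exists[OF False] by blast
    have "G dvd prod_mset A" "prod_mset A dvd G" using A(2) by (metis associatedD1 associatedD2)+
    then obtain k where "prod_mset A = G * k" by (elim dvdE)
    then have "poly2 (prod_mset A) x y = 0" using xy by simp
    then obtain p where p: "p \<in># A" "poly2 p x y = 0" by (auto simp: poly2_prod_mset prod_mset_zero_iff)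
    have "p dvd G" using p(1) \<open>prod_mset A dvd G\<close> by (meson dvd_prod_mset dvd_trans)
    then have pG: "zeros2 p \<subseteq> zeros2 G" by (auto simp: zeros2_mult elim!: dvdE)
    have prime: "prime_elem p" using A(1) p(1) by blast
    have ne: "zeros2 p \<noteq> {}" using xy p by (auto simp: zeros2_def)
    have "p dvd H" using zeros2_prime_subset[OF prime ne] pG sub G H by blast
    have "\<not> is_unit p" using prime by auto
    then obtain H' where H': "H = p ^ multiplicity p H * H'" "\<not> p dvd H'"
      using multiplicity_decompose'[of H p] H(2) by metis
    have "zeros h \<subseteq> zeros2 p \<union> zeros2 H'"
    proof -
      have "zeros2 H \<subseteq> zeros2 (p ^ multiplicity p H) \<union> zeros2 H'" by (subst H'(1)) (simp add: zeros2_mult)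
      also have "zeros2 (p ^ multiplicity p H) \<subseteq> zeros2 p" by (auto simp: zeros2_def)
      finally show ?thesis by (auto simp: H)
    qed
    then consider "zeros h \<subseteq> zeros2 p" | "zeros h \<subseteq> zeros2 H'" using irreducible_zeros2D[OF h(1)] by blast
    then show ?thesis
    proof cases
      case 1
      then show ?thesis using pG G by blast
    next
      case 2
      then have "p dvd H'" using zeros2_prime_subset[OF prime ne] pG sub G by blast
      then show ?thesis using H'(2) by blast
    qed
  qed
qed

subsection \<open>Curves whose polygon has width one\<close>

definition frobenius_stable :: "nat \<Rightarrow> ('a::field \<times> 'a) set \<Rightarrow> bool" where
  "frobenius_stable q Z \<longleftrightarrow> (\<forall>x y. (x, y) \<in> Z \<longrightarrow> (x ^ q, y ^ q) \<in> Z)"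

text \<open>In the application these are the points over the field with \<open>q\<close> elements,
  described inside its algebraic closure as fixed points of the \<open>q\<close>-th power
  map.\<close>

definition rational_points :: "nat \<Rightarrow> ('a::field \<times> 'a) set \<Rightarrow> ('a \<times> 'a) set" where
  "rational_points q Z = {(x, y). (x, y) \<in> Z \<and> x ^ q = x \<and> y ^ q = y}"

text \<open>The row \<open>j\<close> of \<open>f\<close> divided by \<open>x^l\<close>. It is meant
  for \<open>l\<close> at or below the exponents of the row, as \<open>nat\<close> cuts off negative
  differences.\<close>

definition row_poly :: "'a::field laurent \<Rightarrow> int \<Rightarrow> int \<Rightarrow> 'a poly" where
  "row_poly f j l = (\<Sum>m | m \<in> Poly_Mapping.keys f \<and> snd m = j.
     monom (Poly_Mapping.lookup f m) (nat (fst m - l)))"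

lemma degree_row_poly:
  assumes "\<And>m. m \<in> Poly_Mapping.keys f \<Longrightarrow> snd m = j \<Longrightarrow> fst m \<le> r"
  shows "degree (row_poly f j l) \<le> nat (r - l)"
  unfolding row_poly_def
proof (rule degree_sum_le)
  fix m assume m: "m \<in> {m. m \<in> Poly_Mapping.keys f \<and> snd m = j}"
  have "degree (monom (Poly_Mapping.lookup f m) (nat (fst m - l))) \<le> nat (fst m - l)"
    by (rule degree_monom_le)
  also have "\<dots> \<le> nat (r - l)" using assms[of m] m by (intro nat_mono) auto
  finally show "degree (monom (Poly_Mapping.lookup f m) (nat (fst m - l))) \<le> nat (r - l)" .
qed simp

lemma poly_row_poly:
  assumes "\<And>m. m \<in> Poly_Mapping.keys f \<Longrightarrow> snd m = j \<Longrightarrow> l \<le> fst m" "x \<noteq> 0"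
  shows "(\<Sum>m | m \<in> Poly_Mapping.keys f \<and> snd m = j. Poly_Mapping.lookup f m * x powi fst m) =
    x powi l * poly (row_poly f j l) x"
  unfolding row_poly_def poly_sum sum_distrib_left
proof (rule sum.cong)
  fix m assume m: "m \<in> {m. m \<in> Poly_Mapping.keys f \<and> snd m = j}"
  then have "x powi (fst m - l) = x ^ nat (fst m - l)" using assms(1)[of m] by (simp add: power_int_def)
  then show "Poly_Mapping.lookup f m * x powi fst m =
      x powi l * poly (monom (Poly_Mapping.lookup f m) (nat (fst m - l))) x"
    using assms(2) by (simp add: poly_monom power_int_diff field_simps)
qed simp

lemma coeff_row_poly:
  assumes "\<And>m. m \<in> Poly_Mapping.keys f \<Longrightarrow> snd m = j \<Longrightarrow> l \<le> fst m"
    and m: "m \<in> Poly_Mapping.keys f" "snd m = j"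
  shows "coeff (row_poly f j l) (nat (fst m - l)) = Poly_Mapping.lookup f m"
proof -
  have "coeff (row_poly f j l) (nat (fst m - l)) =
      (\<Sum>n | n \<in> Poly_Mapping.keys f \<and> snd n = j. if n = m then Poly_Mapping.lookup f n else 0)"
    unfolding row_poly_def coeff_sum
  proof (rule sum.cong)
    fix n assume n: "n \<in> {n. n \<in> Poly_Mapping.keys f \<and> snd n = j}"
    have "nat (fst n - l) = nat (fst m - l) \<longleftrightarrow> n = m"
      using assms(1)[of n] assms(1)[of m] n m by (auto simp: prod_eq_iff nat_eq_iff)
    then show "coeff (monom (Poly_Mapping.lookup f n) (nat (fst n - l))) (nat (fst m - l)) =
        (if n = m then Poly_Mapping.lookup f n else 0)" by auto
  qed simp
  also have "\<dots> = Poly_Mapping.lookup f m" using m by simp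
  finally show ?thesis .
qed

text \<open>A Laurent polynomial with two rows describes a graph over the first coordinate, unless its two
  row polynomials have a common zero.\<close>

definition strip_zeros :: "int \<Rightarrow> int \<Rightarrow> 'a::field poly \<Rightarrow> 'a poly \<Rightarrow> ('a \<times> 'a) set" where
  "strip_zeros l0 l1 a b =
     {(x, y). x \<noteq> 0 \<and> y \<noteq> 0 \<and> x powi l0 * poly a x + x powi l1 * poly b x * y = 0}"

lemma zeros_eq_strip_zeros:
  fixes f :: "'a::field laurent"
  assumes "\<And>m. m \<in> Poly_Mapping.keys f \<Longrightarrow> (snd m = 0 \<and> l0 \<le> fst m) \<or> (snd m = 1 \<and> l1 \<le> fst m)"
  shows "zeros f = strip_zeros l0 l1 (row_poly f 0 l0) (row_poly f 1 l1)"
proof -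
  have "laurent_eval f (x, y) = x powi l0 * poly (row_poly f 0 l0) x + x powi l1 * poly (row_poly f 1 l1) x * y"
    if "x \<noteq> 0" for x y
  proof -
    have "laurent_eval f (x, y) =
        (\<Sum>m\<in>{m \<in> Poly_Mapping.keys f. snd m = 0} \<union> {m \<in> Poly_Mapping.keys f. snd m = 1}.
          Poly_Mapping.lookup f m * torus_char (x, y) m)"
      unfolding laurent_eval_def using assms by (intro sum.cong) blast+
    also have "\<dots> = (\<Sum>m | m \<in> Poly_Mapping.keys f \<and> snd m = 0. Poly_Mapping.lookup f m * x powi fst m) +
        (\<Sum>m | m \<in> Poly_Mapping.keys f \<and> snd m = 1. Poly_Mapping.lookup f m * x powi fst m) * y"
    proof -
      have "(\<Sum>m | m \<in> Poly_Mapping.keys f \<and> snd m = 0. Poly_Mapping.lookup f m * torus_char (x, y) m) =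
          (\<Sum>m | m \<in> Poly_Mapping.keys f \<and> snd m = 0. Poly_Mapping.lookup f m * x powi fst m)"
        by (intro sum.cong) (auto simp: torus_char_def)
      moreover have "(\<Sum>m | m \<in> Poly_Mapping.keys f \<and> snd m = 1. Poly_Mapping.lookup f m * torus_char (x, y) m) =
          (\<Sum>m | m \<in> Poly_Mapping.keys f \<and> snd m = 1. Poly_Mapping.lookup f m * x powi fst m) * y"
        unfolding sum_distrib_right by (intro sum.cong) (auto simp: torus_char_def)
      ultimately show ?thesis by (subst sum.union_disjoint) auto
    qed
    also have "(\<Sum>m | m \<in> Poly_Mapping.keys f \<and> snd m = 0. Poly_Mapping.lookup f m * x powi fst m) =
        x powi l0 * poly (row_poly f 0 l0) x"
      using assms that by (intro poly_row_poly) force+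
    also have "(\<Sum>m | m \<in> Poly_Mapping.keys f \<and> snd m = 1. Poly_Mapping.lookup f m * x powi fst m) =
        x powi l1 * poly (row_poly f 1 l1) x"
      using assms that by (intro poly_row_poly) force+
    finally show ?thesis .
  qed
  then show ?thesis by (auto simp: zeros_def strip_zeros_def torus_def)
qed

text \<open>Factors \<open>X - c\<close> common to both are split off until one cofactor is nonzero
  at \<open>c\<close>; the sum of the degrees decreases.\<close>

lemma common_root_factor:
  fixes a b :: "'a::field poly"
  assumes "a \<noteq> 0 \<or> b \<noteq> 0"
  obtains n a' b' where "a = [:- c, 1:] ^ n * a'" "b = [:- c, 1:] ^ n * b'"
    "poly a' c \<noteq> 0 \<or> poly b' c \<noteq> 0"
proof -
  have "\<exists>n a' b'. a = [:- c, 1:] ^ n * a' \<and> b = [:- c, 1:] ^ n * b' \<and> (poly a' c \<noteq> 0 \<or> poly b' c \<noteq> 0)"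
    using assms
  proof (induction "degree a + degree b" arbitrary: a b rule: less_induct)
    case less
    show ?case
    proof (cases "poly a c = 0 \<and> poly b c = 0")
      case False
      then show ?thesis by (intro exI[of _ 0] exI[of _ a] exI[of _ b]) auto
    next
      case True
      then obtain a1 b1 where ab: "a = [:- c, 1:] * a1" "b = [:- c, 1:] * b1"
        by (auto simp: poly_eq_0_iff_dvd elim!: dvdE)
      have "a1 \<noteq> 0 \<or> b1 \<noteq> 0" using less.prems ab by auto
      moreover have "degree a1 + degree b1 < degree a + degree b"
        using calculation unfolding ab
        by (cases "a1 = 0"; cases "b1 = 0") (auto simp: degree_mult_eq simp del: mult_pCons_left)
      ultimately obtain n a' b' where "a1 = [:- c, 1:] ^ n * a'" "b1 = [:- c, 1:] ^ n * b'"
        "poly a' c \<noteq> 0 \<or> poly b' c \<noteq> 0" using less.hyps by blast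
      then show ?thesis unfolding ab
        by (intro exI[of _ "Suc n"] exI[of _ a'] exI[of _ b'] conjI) (simp_all only: power_Suc mult.assoc)
    qed
  qed
  then show thesis using that by blast
qed

lemma infinite_field_two:
  assumes "infinite (UNIV :: 'a::field set)"
  obtains y :: "'a::field" where "y \<noteq> 0" "y \<noteq> 1"
proof -
  have "\<exists>y. y \<notin> {0, 1 :: 'a}" using assms by (intro ex_new_if_finite) auto
  then show thesis using that by auto
qed

text \<open>The line \<open>x = c\<close> lies in the zero set, which is covered by this line and
  the zeros of the equation freed from its common factors \<open>x - c\<close>. The second set
  cannot contain the whole curve: on \<open>x = c\<close> the reduced equation is of degree at most
  1 in \<open>y\<close> and not identically zero.\<close>

lemma strip_common_root:
  fixes a b :: "'a::alg_closed_field poly"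
  assumes irr: "irreducible_zeros (strip_zeros l0 l1 a b)"
    and ab: "a \<noteq> 0 \<or> b \<noteq> 0" and c: "c \<noteq> 0" "poly a c = 0" "poly b c = 0"
  shows "strip_zeros l0 l1 a b = {c} \<times> (UNIV - {0})"
proof -
  obtain n a' b' where n: "a = [:- c, 1:] ^ n * a'" "b = [:- c, 1:] ^ n * b'"
    "poly a' c \<noteq> 0 \<or> poly b' c \<noteq> 0"
    using common_root_factor[OF ab] by metis
  define h where "h = poly_to_laurent [:a':] * Poly_Mapping.single (l0, 0) 1 +
    poly_to_laurent [:b':] * Poly_Mapping.single (l1, 1) (1 :: 'a)"
  have h: "laurent_eval h (x, y) = x powi l0 * poly a' x + x powi l1 * poly b' x * y" if "x \<noteq> 0" "y \<noteq> 0" for x y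
    using that by (simp add: h_def laurent_eval_add laurent_eval_mult laurent_eval_poly_to_laurent torus_char_def)
  have line: "(x, y) \<in> zeros (poly_to_laurent [:[:- c, 1:]:]) \<longleftrightarrow> x = c \<and> x \<noteq> 0 \<and> y \<noteq> 0" for x y
    by (auto simp: zeros_poly_to_laurent zeros2_def)
  have sub: "{c} \<times> (UNIV - {0}) \<subseteq> strip_zeros l0 l1 a b" using c by (auto simp: strip_zeros_def)
  have "strip_zeros l0 l1 a b \<subseteq> zeros (poly_to_laurent [:[:- c, 1:]:]) \<union> zeros h"
  proof
    fix p assume p: "p \<in> strip_zeros l0 l1 a b"
    obtain x y where xy: "p = (x, y)" by fastforce
    have "(x - c) ^ n * (x powi l0 * poly a' x + x powi l1 * poly b' x * y) = 0"
      using p xy n by (simp add: strip_zeros_def algebra_simps)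
    then show "p \<in> zeros (poly_to_laurent [:[:- c, 1:]:]) \<union> zeros h"
      using p xy line by (auto simp: zeros_def h strip_zeros_def)
  qed
  then consider "strip_zeros l0 l1 a b \<subseteq> zeros (poly_to_laurent [:[:- c, 1:]:])"
    | "strip_zeros l0 l1 a b \<subseteq> zeros h"
    using irreducible_zerosD[OF irr] by blast
  then show ?thesis
  proof cases
    case 1
    then show ?thesis using sub line by auto
  next
    case 2
    obtain y :: 'a where y: "y \<noteq> 0" "y \<noteq> 1" using infinite_field_two[OF alg_closed_infinite] .
    have "(c, z) \<in> zeros h" if "z \<noteq> 0" for z using 2 sub that by blast
    then have e: "c powi l0 * poly a' c + c powi l1 * poly b' c * z = 0" if "z \<noteq> 0" for z
      using that h[OF c(1) that] by (auto simp: zeros_def)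
    have "c powi l1 * poly b' c * (y - 1) = (c powi l0 * poly a' c + c powi l1 * poly b' c * y) -
        (c powi l0 * poly a' c + c powi l1 * poly b' c * 1)" by (simp add: algebra_simps)
    also have "\<dots> = 0" by (simp only: e[OF y(1)] e[OF one_neq_zero]) simp
    finally have "c powi l1 * poly b' c * (y - 1) = 0" .
    then have "poly b' c = 0" using c(1) y by auto
    then have "poly a' c = 0" using e[of 1] c(1) by simp
    then show ?thesis using n(3) \<open>poly b' c = 0\<close> by simp
  qed
qed

lemma card_nonroots:
  fixes p :: "'a::field poly"
  assumes "p \<noteq> 0" "finite F"
  shows "card F \<le> card {x \<in> F. poly p x \<noteq> 0} + degree p"
proof -
  have "card F = card {x \<in> F. poly p x \<noteq> 0} + card {x \<in> F. poly p x = 0}"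
    using assms(2) by (subst card_Un_disjoint[symmetric]) (auto intro!: arg_cong[where f = card])
  moreover have "card {x \<in> F. poly p x = 0} \<le> card {x. poly p x = 0}"
    using poly_roots_finite[OF assms(1)] by (intro card_mono) auto
  moreover have "card {x. poly p x = 0} \<le> degree p" using assms(1) by (rule card_poly_roots_bound)
  ultimately show ?thesis by linarith
qed

lemma power_nat_eq: "0 \<le> k \<Longrightarrow> x ^ nat k = x powi k"
  by (simp add: power_int_def)

lemma card_nonzero_fixed:
  assumes "card {x :: 'a::field. x ^ q = x} = q" "q > 0"
  shows "card ({x :: 'a. x ^ q = x} - {0}) = q - 1" "finite {x :: 'a. x ^ q = x}"
  using assms by (simp_all add: card_ge_0_finite)

lemma finite_rational_points:
  assumes "card {x :: 'a::field. x ^ q = x} = q" "q > 0"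
  shows "finite (rational_points q (Z :: ('a \<times> 'a) set))"
proof (rule finite_subset)
  show "rational_points q Z \<subseteq> {x. x ^ q = x} \<times> {x. x ^ q = x}"
    unfolding rational_points_def by blast
  show "finite ({x :: 'a. x ^ q = x} \<times> {x :: 'a. x ^ q = x})"
    using card_nonzero_fixed(2)[OF assms] by (intro finite_cartesian_product)
qed

text \<open>On the line, \<open>f\<close> becomes a power of \<open>y\<close> times a polynomial of
  degree at most \<open>y1 - y0\<close>, and of the \<open>q - 1\<close> rational points at most
  that many are lost.\<close>

lemma strip_lower_line:
  fixes c :: "'a::alg_closed_field"
  assumes Z: "Z = {c} \<times> (UNIV - {0})" "c \<noteq> 0"
    and q: "card {x :: 'a. x ^ q = x} = q" "q > 0" and frob: "frobenius_stable q Z"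
    and f: "\<And>m. m \<in> Poly_Mapping.keys f \<Longrightarrow> y0 \<le> snd m \<and> snd m \<le> y1" "\<not> Z \<subseteq> zeros f" "y0 \<le> y1"
  shows "int q \<le> int (card (rational_points q (Z - zeros f))) + (y1 - y0) + 1"
proof -
  let ?F = "{x :: 'a. x ^ q = x} - {0}"
  \<comment> \<open>The Frobenius image of a point of the line lies on the line again, so
    \<open>c\<close> is rational.\<close>
  have "(c, 1) \<in> Z" by (simp add: Z)
  then have "(c ^ q, 1 ^ q) \<in> Z" using frob unfolding frobenius_stable_def by blast
  then have cq: "c ^ q = c" by (simp add: Z)
  define h where "h = (\<Sum>m\<in>Poly_Mapping.keys f.
    monom (Poly_Mapping.lookup f m * c powi fst m) (nat (snd m - y0)))"
  have h: "laurent_eval f (c, y) = y powi y0 * poly h y" if "y \<noteq> 0" for y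
    unfolding laurent_eval_def h_def poly_sum sum_distrib_left
  proof (rule sum.cong)
    fix m assume m: "m \<in> Poly_Mapping.keys f"
    then have "y powi (snd m - y0) = y ^ nat (snd m - y0)" using f(1)[of m] by (simp add: power_int_def)
    then show "Poly_Mapping.lookup f m * torus_char (c, y) m =
      y powi y0 * poly (monom (Poly_Mapping.lookup f m * c powi fst m) (nat (snd m - y0))) y"
      using that by (simp add: poly_monom torus_char_def power_int_diff field_simps)
  qed simp
  have deg: "degree h \<le> nat (y1 - y0)"
    unfolding h_def
  proof (rule degree_sum_le)
    fix m assume m: "m \<in> Poly_Mapping.keys f"
    have "degree (monom (Poly_Mapping.lookup f m * c powi fst m) (nat (snd m - y0))) \<le> nat (snd m - y0)"
      by (rule degree_monom_le)
    also have "\<dots> \<le> nat (y1 - y0)" using f(1)[OF m] by (intro nat_mono) auto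
    finally show "degree (monom (Poly_Mapping.lookup f m * c powi fst m) (nat (snd m - y0))) \<le> nat (y1 - y0)" .
  qed simp
  have zf: "(c, y) \<in> zeros f \<longleftrightarrow> poly h y = 0" if "y \<noteq> 0" for y
    using that Z h by (auto simp: zeros_def)
  have "h \<noteq> 0"
  proof
    assume "h = 0"
    then have "(c, y) \<in> zeros f" if "y \<noteq> 0" for y using zf[OF that] by simp
    then have "Z \<subseteq> zeros f" unfolding Z(1) by blast
    then show False using f(2) by blast
  qed
  then have "card ?F \<le> card {x \<in> ?F. poly h x \<noteq> 0} + degree h"
    by (rule card_nonroots) (use card_nonzero_fixed[OF q] in auto)
  moreover have "card {x \<in> ?F. poly h x \<noteq> 0} = card (rational_points q (Z - zeros f))"
  proof -
    have "rational_points q (Z - zeros f) = Pair c ` {x \<in> ?F. poly h x \<noteq> 0}"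
      using zf cq by (auto simp: rational_points_def Z)
    then show ?thesis by (simp add: card_image inj_on_def)
  qed
  ultimately show ?thesis using card_nonzero_fixed[OF q] deg f(3) q(2) by linarith
qed

lemma strip_graph:
  assumes "\<And>x. x \<noteq> 0 \<Longrightarrow> poly a x \<noteq> 0 \<or> poly b x \<noteq> 0"
  shows "strip_zeros l0 l1 a b = {(x, y). x \<noteq> 0 \<and> poly a x \<noteq> 0 \<and> poly b x \<noteq> 0 \<and>
    y = - (x powi l0 * poly a x) / (x powi l1 * poly b x)}"
proof -
  have "y \<noteq> 0 \<and> x powi l0 * poly a x + x powi l1 * poly b x * y = 0 \<longleftrightarrow>
      poly a x \<noteq> 0 \<and> poly b x \<noteq> 0 \<and> y = - (x powi l0 * poly a x) / (x powi l1 * poly b x)"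
    if "x \<noteq> 0" for x y
  proof (cases "poly b x = 0")
    case True
    then show ?thesis using assms[OF that] that by auto
  next
    case False
    then have "x powi l0 * poly a x + x powi l1 * poly b x * y = 0 \<longleftrightarrow>
        y = - (x powi l0 * poly a x) / (x powi l1 * poly b x)"
    proof -
      have "x powi l1 * poly b x \<noteq> 0" using False that by simp
      then have "y = - (x powi l0 * poly a x) / (x powi l1 * poly b x) \<longleftrightarrow>
          y * (x powi l1 * poly b x) = - (x powi l0 * poly a x)"
        by (rule nonzero_eq_divide_eq)
      also have "\<dots> \<longleftrightarrow> x powi l0 * poly a x + x powi l1 * poly b x * y = 0"
        by (metis add_eq_0_iff mult.commute)
      finally show ?thesis by blast
    qed
    then show ?thesis using False that by auto
  qed
  then show ?thesis unfolding strip_zeros_def by blast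
qed

text \<open>The curve is parametrised by \<open>x\<close>. Of the \<open>q - 1\<close> nonzero
  rational values, those are lost that are roots of \<open>a\<close> or \<open>b\<close>, where the
  graph leaves the torus, or of \<open>h\<close>, which is \<open>f\<close> on the graph with
  denominators cleared and has degree at most \<open>M - N\<close>. Frobenius stability makes
  \<open>y\<close> rational along with \<open>x\<close>.\<close>

lemma strip_lower_graph:
  fixes a b :: "'a::alg_closed_field poly"
  assumes Z: "Z = strip_zeros l0 l1 a b" and nr: "\<And>x. x \<noteq> 0 \<Longrightarrow> poly a x \<noteq> 0 \<or> poly b x \<noteq> 0"
    and ab: "a \<noteq> 0" "b \<noteq> 0" "int (degree a) \<le> r0 - l0" "int (degree b) \<le> r1 - l1"
    and q: "card {x :: 'a. x ^ q = x} = q" "q > 0" and frob: "frobenius_stable q Z"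
    and f: "\<And>m. m \<in> Poly_Mapping.keys f \<Longrightarrow> y0 \<le> snd m \<and> snd m \<le> y1" "\<not> Z \<subseteq> zeros f"
    and bounds: "\<And>m. m \<in> Poly_Mapping.keys f \<Longrightarrow> fst m + (snd m - y0) * r0 + (y1 - snd m) * r1 \<le> M"
      "\<And>m. m \<in> Poly_Mapping.keys f \<Longrightarrow> N \<le> fst m + (snd m - y0) * l0 + (y1 - snd m) * l1"
  shows "int q \<le> int (card (rational_points q (Z - zeros f))) + (M - N) + (r0 - l0) + (r1 - l1) + 1"
proof -
  let ?F = "{x :: 'a. x ^ q = x} - {0}"
  have Z2: "Z = {(x, y). x \<noteq> 0 \<and> poly a x \<noteq> 0 \<and> poly b x \<noteq> 0 \<and>
      y = - (x powi l0 * poly a x) / (x powi l1 * poly b x)}"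
    unfolding Z by (rule strip_graph[OF nr])
  \<comment> \<open>The exponent of \<open>x\<close> that the monomial \<open>m\<close> contributes
    once numerator and denominator of \<open>y\<close> occur with the exponents
    \<open>snd m - y0\<close> and \<open>y1 - snd m\<close>, lowered by \<open>N\<close> so that it
    is never negative.\<close>
  define e where "e m = fst m + (snd m - y0) * l0 + (y1 - snd m) * l1 - N" for m :: "int \<times> int"
  define t where "t m = smult (Poly_Mapping.lookup f m)
    (monom 1 (nat (e m)) * (- a) ^ nat (snd m - y0) * b ^ nat (y1 - snd m))" for m
  define h where "h = (\<Sum>m\<in>Poly_Mapping.keys f. t m)"
  have e0: "0 \<le> e m" if "m \<in> Poly_Mapping.keys f" for m using bounds(2)[OF that] by (simp add: e_def)
  have deg: "degree h \<le> nat (M - N)"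
    unfolding h_def
  proof (rule degree_sum_le)
    fix m assume m: "m \<in> Poly_Mapping.keys f"
    have "degree (t m) \<le> degree (monom (1 :: 'a) (nat (e m)) * (- a) ^ nat (snd m - y0) * b ^ nat (y1 - snd m))"
      unfolding t_def by (rule degree_smult_le)
    also have "\<dots> \<le> degree (monom (1 :: 'a) (nat (e m))) + degree ((- a) ^ nat (snd m - y0)) + degree (b ^ nat (y1 - snd m))"
      by (intro order_trans[OF degree_mult_le] add_mono degree_mult_le order_refl)
    also have "\<dots> \<le> nat (e m) + nat (snd m - y0) * degree a + nat (y1 - snd m) * degree b"
      by (intro add_mono) (auto simp: degree_monom_eq degree_power_eq ab)
    finally have "int (degree (t m)) \<le> int (nat (e m) + nat (snd m - y0) * degree a + nat (y1 - snd m) * degree b)"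
      by (simp only: of_nat_le_iff)
    also have "\<dots> = e m + (snd m - y0) * degree a + (y1 - snd m) * degree b"
    proof -
      have "0 \<le> e m" "0 \<le> snd m - y0" "0 \<le> y1 - snd m" using e0[OF m] f(1)[OF m] by auto
      then show ?thesis by (simp only: of_nat_add of_nat_mult int_nat_eq if_True)
    qed
    also have "\<dots> \<le> e m + (snd m - y0) * (r0 - l0) + (y1 - snd m) * (r1 - l1)"
      using f(1)[OF m] ab by (intro add_mono mult_left_mono) auto
    also have "\<dots> \<le> M - N" using bounds(1)[OF m] by (simp add: e_def algebra_simps)
    finally show "degree (t m) \<le> nat (M - N)" by linarith
  qed simp
  have h: "laurent_eval f (x, y) * ((- (x powi l0 * poly a x)) powi (- y0) * (x powi l1 * poly b x) powi y1) =
      x powi N * poly h x" if xy: "(x, y) \<in> Z" for x y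
  proof -
    define A B where "A = x powi l0 * poly a x" and "B = x powi l1 * poly b x"
    have x: "x \<noteq> 0" "poly a x \<noteq> 0" "poly b x \<noteq> 0" and y: "y = - A / B"
      using xy unfolding Z2 by (auto simp: A_def B_def)
    have A: "- A \<noteq> 0" and B: "B \<noteq> 0" using x by (auto simp: A_def B_def)
    have "laurent_eval f (x, y) * ((- A) powi (- y0) * B powi y1) = x powi N * poly h x"
      unfolding laurent_eval_def h_def poly_sum sum_distrib_left sum_distrib_right
    proof (rule sum.cong)
      fix m assume m: "m \<in> Poly_Mapping.keys f"
      have "y powi snd m * ((- A) powi (- y0) * B powi y1) = (- A) powi (snd m - y0) * B powi (y1 - snd m)"
      proof -
        have "y powi snd m = (- A) powi snd m / B powi snd m"
          by (simp only: y power_int_divide_distrib)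
        then show ?thesis
          using A B by (simp only: power_int_diff[OF disjI1[OF A]] power_int_diff[OF disjI1[OF B]]
              power_int_minus) (simp add: field_simps)
      qed
      also have "\<dots> = (- A) ^ nat (snd m - y0) * B ^ nat (y1 - snd m)"
        using f(1)[OF m] by (simp add: power_nat_eq)
      also have "(- A) ^ nat (snd m - y0) = x powi (l0 * (snd m - y0)) * (- poly a x) ^ nat (snd m - y0)"
      proof -
        have "- A = x powi l0 * (- poly a x)" by (simp add: A_def)
        moreover have "(x powi l0) ^ nat (snd m - y0) = x powi (l0 * (snd m - y0))"
          using f(1)[OF m] by (simp add: power_int_mult power_nat_eq)
        ultimately show ?thesis by (simp only: power_mult_distrib)
      qed
      also have "B ^ nat (y1 - snd m) = x powi (l1 * (y1 - snd m)) * poly b x ^ nat (y1 - snd m)"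
      proof -
        have "(x powi l1) ^ nat (y1 - snd m) = x powi (l1 * (y1 - snd m))"
          using f(1)[OF m] by (simp add: power_int_mult power_nat_eq)
        then show ?thesis by (simp only: B_def power_mult_distrib)
      qed
      finally have 1: "y powi snd m * ((- A) powi (- y0) * B powi y1) =
        x powi (l0 * (snd m - y0)) * (- poly a x) ^ nat (snd m - y0) *
        (x powi (l1 * (y1 - snd m)) * poly b x ^ nat (y1 - snd m))" .
      have "x powi N * x ^ nat (e m) = x powi (N + e m)"
        using x e0[OF m] by (simp add: power_int_add power_nat_eq)
      also have "\<dots> = x powi fst m * x powi (l0 * (snd m - y0)) * x powi (l1 * (y1 - snd m))"
        using x by (simp add: e_def algebra_simps flip: power_int_add)
      finally have 2: "x powi N * x ^ nat (e m) =
        x powi fst m * x powi (l0 * (snd m - y0)) * x powi (l1 * (y1 - snd m))" .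
      have "Poly_Mapping.lookup f m * torus_char (x, y) m * ((- A) powi (- y0) * B powi y1) =
          Poly_Mapping.lookup f m * x powi fst m * (y powi snd m * ((- A) powi (- y0) * B powi y1))"
        by (simp add: torus_char_def)
      also have "\<dots> = Poly_Mapping.lookup f m * (x powi N * x ^ nat (e m)) *
          (- poly a x) ^ nat (snd m - y0) * poly b x ^ nat (y1 - snd m)"
        unfolding 1 2 by (simp add: mult_ac)
      also have "\<dots> = x powi N * poly (t m) x"
        by (simp add: t_def poly_monom mult_ac)
      finally show "Poly_Mapping.lookup f m * torus_char (x, y) m * ((- A) powi (- y0) * B powi y1) =
          x powi N * poly (t m) x" .
    qed simp
    then show ?thesis by (simp add: A_def B_def)
  qed
  have zf: "(x, y) \<in> zeros f \<longleftrightarrow> poly h x = 0" if xy: "(x, y) \<in> Z" for x y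
  proof -
    have "x \<noteq> 0" "y \<noteq> 0" "poly a x \<noteq> 0" "poly b x \<noteq> 0" using xy unfolding Z2 by auto
    moreover have "(- (x powi l0 * poly a x)) powi (- y0) * (x powi l1 * poly b x) powi y1 \<noteq> 0"
      using calculation by simp
    ultimately show ?thesis using h[OF xy] by (auto simp: zeros_def)
  qed
  have "h \<noteq> 0" using f(2) zf by force
  then have p0: "a * b * h \<noteq> 0" using ab by simp
  let ?G = "{x \<in> ?F. poly (a * b * h) x \<noteq> 0}"
  let ?y = "\<lambda>x. - (x powi l0 * poly a x) / (x powi l1 * poly b x)"
  have "(\<lambda>x. (x, ?y x)) ` ?G \<subseteq> rational_points q (Z - zeros f)"
  proof
    fix p assume "p \<in> (\<lambda>x. (x, ?y x)) ` ?G"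
    then obtain x where x: "p = (x, ?y x)" "x \<in> ?G" by blast
    have xy: "(x, ?y x) \<in> Z" using x(2) unfolding Z2 by simp
    then have "(x ^ q, ?y x ^ q) \<in> Z" using frob unfolding frobenius_stable_def by blast
    moreover have xq: "x ^ q = x" using x(2) by simp
    ultimately have "?y x ^ q = ?y x" unfolding Z2 by simp
    then show "p \<in> rational_points q (Z - zeros f)"
      using xy xq zf[OF xy] x by (simp add: rational_points_def)
  qed
  moreover have "finite (rational_points q (Z - zeros f))"
    by (rule finite_rational_points[OF q])
  ultimately have "card ((\<lambda>x. (x, ?y x)) ` ?G) \<le> card (rational_points q (Z - zeros f))"
    by (intro card_mono)
  moreover have "card ((\<lambda>x. (x, ?y x)) ` ?G) = card ?G" by (intro card_image) (auto simp: inj_on_def)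
  moreover have "card ?F \<le> card ?G + degree (a * b * h)"
    by (rule card_nonroots[OF p0]) (use card_nonzero_fixed[OF q] in auto)
  moreover have "degree (a * b * h) = degree a + degree b + degree h"
    using ab \<open>h \<noteq> 0\<close> by (simp add: degree_mult_eq)
  \<comment> \<open>The degree bound is the truncated \<open>nat (M - N)\<close>.\<close>
  moreover have "0 \<le> M - N"
  proof -
    obtain m where m: "m \<in> Poly_Mapping.keys f"
      using \<open>h \<noteq> 0\<close> unfolding h_def by (metis sum.neutral equals0D sum.infinite)
    have "0 \<le> e m + (snd m - y0) * (r0 - l0) + (y1 - snd m) * (r1 - l1)"
      using f(1)[OF m] ab e0[OF m] by (intro add_nonneg_nonneg mult_nonneg_nonneg) auto
    also have "\<dots> \<le> M - N" using bounds(1)[OF m] by (simp add: e_def algebra_simps)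
    finally show ?thesis .
  qed
  ultimately show ?thesis using card_nonzero_fixed[OF q] deg ab q(2) by linarith
qed

text \<open>An empty row gets the ends 0 and 0, so that \<open>l \<le> r\<close> and the degree
  bounds derived from it hold in every case.\<close>

lemma row_ends:
  fixes S :: "(int \<times> int) set"
  assumes "finite S"
  obtains l r where "\<And>i. (i, j) \<in> S \<Longrightarrow> l \<le> i \<and> i \<le> r" "l \<le> r"
    "(\<exists>i. (i, j) \<in> S) \<Longrightarrow> (l, j) \<in> S \<and> (r, j) \<in> S"
proof (cases "\<exists>i. (i, j) \<in> S")
  case False
  then show thesis by (intro that[of 0 0]) auto
next
  case True
  let ?R = "slice S j"
  have "?R \<subseteq> fst ` S" by (force simp: slice_def)
  then have fin: "finite ?R" using assms by (meson finite_imageI finite_subset)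
  have ne: "?R \<noteq> {}" using True by (auto simp: slice_def)
  show thesis
  proof (rule that[of "Min ?R" "Max ?R"])
    fix i assume "(i, j) \<in> S"
    then show "Min ?R \<le> i \<and> i \<le> Max ?R" using fin by (auto simp: slice_def)
  next
    show "Min ?R \<le> Max ?R" using fin ne by (meson Max_ge Min_in)
    have "Min ?R \<in> ?R" "Max ?R \<in> ?R" using fin ne by auto
    then show "(Min ?R, j) \<in> S \<and> (Max ?R, j) \<in> S" by (auto simp: slice_def)
  qed
qed

lemma finite_attains_max:
  fixes w :: "'b \<Rightarrow> int"
  assumes "finite S" "S \<noteq> {}"
  obtains m where "m \<in> S" "\<And>n. n \<in> S \<Longrightarrow> w n \<le> w m"
proof -
  have "Max (w ` S) \<in> w ` S" using assms by simp
  then obtain m where "m \<in> S" "w m = Max (w ` S)" by auto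
  then show thesis using that[of m] assms by auto
qed

lemma strip_rows:
  fixes s :: "'a::alg_closed_field laurent"
  assumes T: "finite S" "unit_strip S" and s: "Poly_Mapping.keys s \<subseteq> S" "s \<noteq> 0"
  obtains l0 r0 l1 r1 a b where
    "zeros s = strip_zeros l0 l1 a b" "a \<noteq> 0 \<or> b \<noteq> 0"
    "int (degree a) \<le> r0 - l0" "int (degree b) \<le> r1 - l1"
    "a \<noteq> 0 \<Longrightarrow> (l0, 0) \<in> S \<and> (r0, 0) \<in> S" "b \<noteq> 0 \<Longrightarrow> (l1, 1) \<in> S \<and> (r1, 1) \<in> S"
proof -
  obtain l0 r0 where 0: "\<And>i. (i, 0) \<in> S \<Longrightarrow> l0 \<le> i \<and> i \<le> r0" "l0 \<le> r0"
    "(\<exists>i. (i, 0) \<in> S) \<Longrightarrow> (l0, 0) \<in> S \<and> (r0, 0) \<in> S"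
    using row_ends[OF T(1), of 0] by metis
  obtain l1 r1 where 1: "\<And>i. (i, 1) \<in> S \<Longrightarrow> l1 \<le> i \<and> i \<le> r1" "l1 \<le> r1"
    "(\<exists>i. (i, 1) \<in> S) \<Longrightarrow> (l1, 1) \<in> S \<and> (r1, 1) \<in> S"
    using row_ends[OF T(1), of 1] by metis
  have k0: "l0 \<le> fst m \<and> fst m \<le> r0" if "m \<in> Poly_Mapping.keys s" "snd m = 0" for m
    using 0(1)[of "fst m"] that s(1) by (metis prod.collapse subsetD)
  have k1: "l1 \<le> fst m \<and> fst m \<le> r1" if "m \<in> Poly_Mapping.keys s" "snd m = 1" for m
    using 1(1)[of "fst m"] that s(1) by (metis prod.collapse subsetD)
  have k: "snd m = 0 \<or> snd m = 1" if "m \<in> Poly_Mapping.keys s" for m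
    using that s(1) T(2) unfolding unit_strip_def by blast
  let ?a = "row_poly s 0 l0" and ?b = "row_poly s 1 l1"
  have row_ne: "\<exists>i. (i, j) \<in> S" if "row_poly s j l \<noteq> 0" for j l
  proof -
    have "{m. m \<in> Poly_Mapping.keys s \<and> snd m = j} \<noteq> {}"
      using that unfolding row_poly_def by (metis sum.empty)
    then obtain m where "m \<in> Poly_Mapping.keys s" "snd m = j" by blast
    then show ?thesis using s(1) by (metis prod.collapse subsetD)
  qed
  show thesis
  proof (rule that)
    show "zeros s = strip_zeros l0 l1 ?a ?b" using k k0 k1 by (intro zeros_eq_strip_zeros) blast
    have "\<exists>m. Poly_Mapping.lookup s m \<noteq> 0"
    proof (rule ccontr)
      assume "\<nexists>m. Poly_Mapping.lookup s m \<noteq> 0"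
      then have "s = 0" by (intro poly_mapping_eqI) auto
      then show False using s(2) by simp
    qed
    then obtain m where m: "Poly_Mapping.lookup s m \<noteq> 0" by blast
    then have mk: "m \<in> Poly_Mapping.keys s" by (simp add: in_keys_iff)
    show "?a \<noteq> 0 \<or> ?b \<noteq> 0"
    proof (cases "snd m = 0")
      case True
      then have "coeff ?a (nat (fst m - l0)) = Poly_Mapping.lookup s m"
        using k0 mk by (intro coeff_row_poly) blast+
      then show ?thesis using m by auto
    next
      case False
      then have "coeff ?b (nat (fst m - l1)) = Poly_Mapping.lookup s m"
        using k[OF mk] k1 mk by (intro coeff_row_poly) blast+
      then show ?thesis using m by auto
    qed
    have "degree ?a \<le> nat (r0 - l0)" using k0 by (intro degree_row_poly) blast
    then show "int (degree ?a) \<le> r0 - l0" using 0(2) by linarith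
    have "degree ?b \<le> nat (r1 - l1)" using k1 by (intro degree_row_poly) blast
    then show "int (degree ?b) \<le> r1 - l1" using 1(2) by linarith
    show "?a \<noteq> 0 \<Longrightarrow> (l0, 0) \<in> S \<and> (r0, 0) \<in> S" using 0(3) row_ne by blast
    show "?b \<noteq> 0 \<Longrightarrow> (l1, 1) \<in> S \<and> (r1, 1) \<in> S" using 1(3) row_ne by blast
  qed
qed

text \<open>The algebraic and the combinatorial estimate have the same error term:
  \<open>y1 - y0 + 1\<close> for a line \<open>x = c\<close>, and \<open>M - N\<close> plus both row
  lengths plus 1 for a graph. \<open>M\<close> and \<open>N\<close> are extreme values over
  \<open>Q\<close> of the functionals that measure exponents of \<open>x\<close> on the graph; the
  points \<open>m\<close> and \<open>k\<close> where they are attained give the rows at which the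
  count of \<open>Q + T\<close> switches.\<close>

lemma strip_step:
  fixes s f :: "'a::alg_closed_field laurent"
  assumes T: "lattice_polygon T" "unit_strip (lattice_points T)"
    and s: "Poly_Mapping.keys s \<subseteq> lattice_points T" "s \<noteq> 0"
    and irr: "irreducible_zeros (zeros s)" and frob: "frobenius_stable q (zeros s)"
    and q: "card {x :: 'a. x ^ q = x} = q" "q > 0"
    and Q: "lattice_polygon Q" and f: "Poly_Mapping.keys f \<subseteq> lattice_points Q" "\<not> zeros s \<subseteq> zeros f"
  shows "q + card (lattice_points Q) \<le>
    card (rational_points q (zeros s - zeros f)) + card (lattice_points (Q + T))"
proof -
  obtain l0 r0 l1 r1 a b where Z: "zeros s = strip_zeros l0 l1 a b" and ab: "a \<noteq> 0 \<or> b \<noteq> 0"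
    and deg: "int (degree a) \<le> r0 - l0" "int (degree b) \<le> r1 - l1"
    and ends: "a \<noteq> 0 \<Longrightarrow> (l0, 0) \<in> lattice_points T \<and> (r0, 0) \<in> lattice_points T"
      "b \<noteq> 0 \<Longrightarrow> (l1, 1) \<in> lattice_points T \<and> (r1, 1) \<in> lattice_points T"
    by (rule strip_rows[OF lattice_polygon_finite[OF T(1)] T(2) s]) blast
  note finQ = lattice_polygon_finite[OF Q] lattice_polygon_nonempty[OF Q]
  obtain p1 where p1: "p1 \<in> lattice_points Q" "\<And>n. n \<in> lattice_points Q \<Longrightarrow> snd n \<le> snd p1"
    using finite_attains_max[OF finQ, where w = snd] by blast
  obtain p0 where p0: "p0 \<in> lattice_points Q" "\<And>n. n \<in> lattice_points Q \<Longrightarrow> - snd n \<le> - snd p0"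
    using finite_attains_max[OF finQ, where w = "\<lambda>n. - snd n"] by blast
  define y0 y1 where "y0 = snd p0" and "y1 = snd p1"
  have attained: "(fst p0, y0) \<in> lattice_points Q" "(fst p1, y1) \<in> lattice_points Q"
    using p0 p1 by (simp_all add: y0_def y1_def)
  have rows: "y0 \<le> y \<and> y \<le> y1" if "(x, y) \<in> lattice_points Q" for x y
    using p0(2)[OF that] p1(2)[OF that] by (auto simp: y0_def y1_def)
  have rows': "y0 \<le> snd m \<and> snd m \<le> y1" if "m \<in> Poly_Mapping.keys f" for m
    using rows[of "fst m" "snd m"] that f(1) by auto
  show ?thesis
  proof (cases "\<exists>c. c \<noteq> 0 \<and> poly a c = 0 \<and> poly b c = 0")
    case True
    then obtain c where c: "c \<noteq> 0" "poly a c = 0" "poly b c = 0" by blast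
    have line: "zeros s = {c} \<times> (UNIV - {0})"
      using strip_common_root[OF _ ab c] irr Z by simp
    have y01: "y0 \<le> y1" using rows[OF attained(1)] by simp
    have lower: "int q \<le> int (card (rational_points q (zeros s - zeros f))) + (y1 - y0) + 1"
      using strip_lower_line[OF line c(1) q frob rows' f(2) y01] by blast
    have pos: "degree p > 0" if "p \<noteq> 0" "poly p c = 0" for p :: "'a poly"
    proof (rule ccontr)
      assume "\<not> degree p > 0"
      then obtain d where "p = [:d:]" using degree_eq_zeroE by blast
      then show False using that by simp
    qed
    have "int (card (lattice_points Q)) + (y1 - y0) + 1 \<le> int (card (lattice_points (Q + T)))"
    proof (cases "a \<noteq> 0")
      case a: True
      \<comment> \<open>A nonzero row polynomial with a root has positive degree, so this row of
        \<open>T\<close> contains a segment.\<close>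
      have "l0 < r0" using deg(1) pos[OF a c(2)] by linarith
      show ?thesis
        by (rule card_lattice_points_plus_segment[OF Q T(1) _ _ \<open>l0 < r0\<close> attained])
          (use ends(1)[OF a] rows in blast)+
    next
      case False
      then have b: "b \<noteq> 0" using ab by blast
      then have "l1 < r1" using deg(2) pos[OF b c(3)] by linarith
      show ?thesis
        by (rule card_lattice_points_plus_segment[OF Q T(1) _ _ \<open>l1 < r1\<close> attained])
          (use ends(2)[OF b] rows in blast)+
    qed
    then show ?thesis using lower by linarith
  next
    case False
    then have nr: "poly a x \<noteq> 0 \<or> poly b x \<noteq> 0" if "x \<noteq> 0" for x using that by blast
    have graph: "strip_zeros l0 l1 a b = {(x, y). x \<noteq> 0 \<and> poly a x \<noteq> 0 \<and> poly b x \<noteq> 0 \<and>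
      y = - (x powi l0 * poly a x) / (x powi l1 * poly b x)}"
      by (rule strip_graph[OF nr])
    \<comment> \<open>A point of the graph shows that both row polynomials are nonzero, hence that
      all four row ends belong to \<open>T\<close>.\<close>
    obtain x y where xy: "(x, y) \<in> zeros s" using irr by (auto simp: irreducible_zeros_def)
    have "poly a x \<noteq> 0" "poly b x \<noteq> 0"
      using xy unfolding Z graph by auto
    then have ab: "a \<noteq> 0" "b \<noteq> 0" by auto
    obtain m where m: "m \<in> lattice_points Q"
      "\<And>n. n \<in> lattice_points Q \<Longrightarrow> fst n + (snd n - y0) * r0 + (y1 - snd n) * r1 \<le>
        fst m + (snd m - y0) * r0 + (y1 - snd m) * r1"
      using finite_attains_max[OF finQ, where w = "\<lambda>n. fst n + (snd n - y0) * r0 + (y1 - snd n) * r1"] by blast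
    obtain k where k: "k \<in> lattice_points Q"
      "\<And>n. n \<in> lattice_points Q \<Longrightarrow> - (fst n + (snd n - y0) * l0 + (y1 - snd n) * l1) \<le>
        - (fst k + (snd k - y0) * l0 + (y1 - snd k) * l1)"
      using finite_attains_max[OF finQ, where w = "\<lambda>n. - (fst n + (snd n - y0) * l0 + (y1 - snd n) * l1)"] by blast
    define M where "M = fst m + (snd m - y0) * r0 + (y1 - snd m) * r1"
    define N where "N = fst k + (snd k - y0) * l0 + (y1 - snd k) * l1"
    have MN: "fst n + (snd n - y0) * r0 + (y1 - snd n) * r1 \<le> M"
      "N \<le> fst n + (snd n - y0) * l0 + (y1 - snd n) * l1" if "n \<in> Poly_Mapping.keys f" for n
      using m(2)[of n] k(2)[of n] that f(1) by (auto simp: M_def N_def)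
    have "int q \<le> int (card (rational_points q (zeros s - zeros f))) + (M - N) + (r0 - l0) + (r1 - l1) + 1"
      using strip_lower_graph[OF Z nr ab deg q frob rows' f(2) MN] by blast
    moreover have "int (card (lattice_points Q)) + M - N + (r0 - l0) + (r1 - l1) + 1
        \<le> int (card (lattice_points (Q + T)))"
    proof -
      note e = ends(1)[OF ab(1)] ends(2)[OF ab(2)]
      have mk: "(fst m, snd m) \<in> lattice_points Q" "(fst k, snd k) \<in> lattice_points Q" using m(1) k(1) by auto
      have "int (card (lattice_points Q)) + (fst m + (snd m - y0) * r0 + (y1 - snd m) * r1) -
          (fst k + (snd k - y0) * l0 + (y1 - snd k) * l1) + (r0 - l0) + (r1 - l1) + 1
        \<le> int (card (lattice_points (Q + T)))"
        by (rule card_lattice_points_plus_strip[OF Q T(1) _ _ _ _ _ attained mk]) (use e rows in blast)+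
      then show ?thesis by (simp add: M_def N_def)
    qed
    ultimately show ?thesis by linarith
  qed
qed

text \<open>A coordinate projection is injective on the curve: the second one for a line
  \<open>x = c\<close>, the first one for a graph.\<close>

lemma strip_upper:
  fixes s :: "'a::alg_closed_field laurent"
  assumes T: "finite S" "unit_strip S"
    and s: "Poly_Mapping.keys s \<subseteq> S" "s \<noteq> 0"
    and irr: "irreducible_zeros (zeros s)"
    and q: "card {x :: 'a. x ^ q = x} = q" "q > 0"
  shows "card (rational_points q (zeros s)) \<le> q"
proof -
  obtain l0 r0 l1 r1 a b where Z: "zeros s = strip_zeros l0 l1 a b" and ab: "a \<noteq> 0 \<or> b \<noteq> 0"
    by (rule strip_rows[OF T s]) metis
  have fin: "finite {x :: 'a. x ^ q = x}" using card_nonzero_fixed(2)[OF q] .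
  have "\<exists>g :: 'a \<times> 'a \<Rightarrow> 'a. inj_on g (rational_points q (zeros s)) \<and>
      g ` rational_points q (zeros s) \<subseteq> {x. x ^ q = x}"
  proof (cases "\<exists>c. c \<noteq> 0 \<and> poly a c = 0 \<and> poly b c = 0")
    case True
    then obtain c where c: "c \<noteq> 0" "poly a c = 0" "poly b c = 0" by blast
    have line: "zeros s = {c} \<times> (UNIV - {0})" using strip_common_root[OF _ ab c] irr Z by simp
    show ?thesis unfolding line by (intro exI[of _ snd]) (auto simp: rational_points_def inj_on_def)
  next
    case False
    then have nr: "poly a x \<noteq> 0 \<or> poly b x \<noteq> 0" if "x \<noteq> 0" for x using that by blast
    have graph: "strip_zeros l0 l1 a b = {(x, y). x \<noteq> 0 \<and> poly a x \<noteq> 0 \<and> poly b x \<noteq> 0 \<and>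
      y = - (x powi l0 * poly a x) / (x powi l1 * poly b x)}"
      by (rule strip_graph[OF nr])
    show ?thesis unfolding Z graph
      by (intro exI[of _ fst]) (auto simp: rational_points_def inj_on_def)
  qed
  then show ?thesis using card_inj_on_le[OF _ _ fin] q by metis
qed

subsection \<open>Conics\<close>

definition ternary_form :: "'a::comm_ring_1 \<Rightarrow> 'a \<Rightarrow> 'a \<Rightarrow> 'a \<Rightarrow> 'a \<Rightarrow> 'a \<Rightarrow> 'a \<Rightarrow> 'a \<Rightarrow> 'a \<Rightarrow> 'a" where
  "ternary_form a b c d e g x y z = a * x * x + b * x * y + c * y * y + d * x * z + e * y * z + g * z * z"

text \<open>Squaring is at most two-to-one on the nonzero elements, and 0 is one more
  square.\<close>

lemma card_squares:
  "CARD('k::{field,finite}) + 1 \<le> 2 * card (range (\<lambda>x :: 'k. x * x))"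
proof -
  let ?U = "UNIV - {0 :: 'k}" and ?sq = "\<lambda>x :: 'k. x * x"
  have U: "?U = (\<Union>y\<in>?sq ` ?U. {x \<in> ?U. x * x = y})" by auto
  have "card (\<Union>y\<in>?sq ` ?U. {x \<in> ?U. x * x = y}) \<le> (\<Sum>y\<in>?sq ` ?U. card {x \<in> ?U. x * x = y})"
    by (rule card_UN_le) simp
  then have "card ?U \<le> (\<Sum>y\<in>?sq ` ?U. card {x \<in> ?U. x * x = y})"
    by (simp only: U[symmetric])
  also have "\<dots> \<le> (\<Sum>y\<in>?sq ` ?U. 2)"
  proof (rule sum_mono)
    fix y assume "y \<in> ?sq ` ?U"
    then obtain r where "y = r * r" by blast
    then have "{x \<in> ?U. x * x = y} \<subseteq> {r, - r}" using square_eq_iff by blast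
    then have "card {x \<in> ?U. x * x = y} \<le> card {r, - r}" by (intro card_mono) auto
    also have "\<dots> \<le> 2" by (simp add: card_insert_if)
    finally show "card {x \<in> ?U. x * x = y} \<le> 2" .
  qed
  finally have 1: "CARD('k) - 1 \<le> 2 * card (?sq ` ?U)" by (simp add: mult.commute)
  have "range ?sq = insert 0 (?sq ` ?U)" by (auto simp: image_iff)
  moreover have "0 \<notin> ?sq ` ?U" by auto
  ultimately have "card (range ?sq) = card (?sq ` ?U) + 1" by simp
  moreover have "CARD('k) > 0" by simp
  ultimately show ?thesis using 1 by linarith
qed

text \<open>Pigeonhole: the squares and the elements \<open>k + a y^2\<close> each make up more than
  half of the field.\<close>

lemma sum_of_two_squares:
  fixes a k :: "'k::{field,finite}"
  assumes "a \<noteq> 0"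
  obtains x y where "x * x - a * (y * y) = k"
proof -
  let ?R = "range (\<lambda>x :: 'k. x * x)"
  let ?g = "\<lambda>t. k + a * t"
  have "inj ?g" using assms by (auto simp: inj_on_def)
  then have "card (?g ` ?R) = card ?R" by (intro card_image) (auto simp: inj_on_def)
  then have "CARD('k) < card ?R + card (?g ` ?R)" using card_squares[where 'k = 'k] by linarith
  then have "?R \<inter> ?g ` ?R \<noteq> {}"
    by (metis (no_types, lifting) card_Un_disjoint card_mono finite subset_UNIV linorder_not_le)
  then obtain x y where "x * x = k + a * (y * y)" by auto
  then show thesis using that[of x y] by simp
qed

text \<open>In characteristic 2 squaring is injective, hence surjective on a finite field.\<close>

lemma square_root_char_2:
  fixes a :: "'k::{field,finite}"
  assumes "(1 :: 'k) + 1 = 0"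
  obtains x where "x * x = a"
proof -
  have "inj (\<lambda>x :: 'k. x * x)"
  proof (rule injI)
    fix x y :: 'k assume "x * x = y * y"
    then have "(x - y) * (x + y) = 0" by (simp add: algebra_simps)
    moreover have "x + y = x - y"
    proof -
      have "y + y = y * (1 + 1)" by (simp only: distrib_left mult_1_right)
      then have "y + y = 0" by (simp only: assms mult_zero_right)
      then have "x - y = x - y + (y + y)" by simp
      then show ?thesis by simp
    qed
    ultimately show "x = y" by simp
  qed
  then have "surj (\<lambda>x :: 'k. x * x)" by (rule finite_UNIV_inj_surj[rotated]) simp
  then obtain x where "a = x * x" by (auto dest: surjD)
  then show thesis using that by simp
qed

text \<open>Characteristic not 2: complete the square twice. Characteristic 2: move from a point along
  the kernel vector \<open>(e, d, b)\<close> of the polar form, where the form changes by a square.\<close>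

lemma conic_rational_point:
  fixes a b c d e g :: "'k::{field,finite}"
  obtains x y z where "(x, y, z) \<noteq> (0, 0, 0)" "ternary_form a b c d e g x y z = 0"
proof (cases "(1 :: 'k) + 1 = 0")
  case True
  have two: "x + x = 0" for x :: 'k
  proof -
    have "x + x = x * (1 + 1)" by (simp only: distrib_left mult_1_right)
    then show ?thesis by (simp only: True mult_zero_right)
  qed
  have two': "2 * x = 0" for x :: 'k by (simp only: mult_2 two)
  define Qn where "Qn = ternary_form a b c d e g e d b"
  \<comment> \<open>If the polar form vanishes, the form is a combination of squares. Otherwise the
    cases ask whether the kernel vector is itself a zero, and if not, which coordinate point can be
    moved along it without reaching the zero vector.\<close>
  consider (z) "e = 0" "d = 0" "b = 0" | (q) "Qn = 0" "(e, d, b) \<noteq> (0, 0, 0)"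
    | (e) "Qn \<noteq> 0" "e \<noteq> 0" | (db) "Qn \<noteq> 0" "d \<noteq> 0 \<or> b \<noteq> 0" by auto
  then show thesis
  proof cases
    case z
    show thesis
    proof (cases "a = 0")
      case True
      then show thesis using that[of 1 0 0] by (simp add: ternary_form_def z)
    next
      case False
      obtain x where x: "x * x = c / a" by (rule square_root_char_2[OF True])
      have "a * x * x = c" using x False by (simp add: mult.assoc)
      then show thesis using that[of x 1 0] two[of c] by (simp add: ternary_form_def z)
    qed
  next
    case q
    then show thesis using that[of e d b] by (simp add: Qn_def)
  next
    case e
    \<comment> \<open>At \<open>(0, 1, 0)\<close> the form has the value \<open>c\<close>; moving by
      \<open>t\<close> times the kernel vector adds \<open>t * t * Qn = c\<close>, and
      \<open>c + c = 0\<close>.\<close>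
    obtain t where t: "t * t = c / Qn" by (rule square_root_char_2[OF True])
    have "ternary_form a b c d e g (t * e) (1 + t * d) (t * b) =
        t * t * Qn + c + 2 * (b * t * e + c * t * d)"
      by (simp add: ternary_form_def Qn_def algebra_simps)
    also have "\<dots> = c + c" using e(1) by (simp add: t two')
    finally have "ternary_form a b c d e g (t * e) (1 + t * d) (t * b) = 0" by (simp add: two)
    moreover have "(t * e, 1 + t * d, t * b) \<noteq> (0, 0, 0)" using e(2) by auto
    ultimately show thesis using that by blast
  next
    case db
    obtain t where t: "t * t = a / Qn" by (rule square_root_char_2[OF True])
    have "ternary_form a b c d e g (1 + t * e) (t * d) (t * b) =
        t * t * Qn + a + 2 * (b * t * d + a * t * e)"
      by (simp add: ternary_form_def Qn_def algebra_simps)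
    also have "\<dots> = a + a" using db(1) by (simp add: t two')
    finally have "ternary_form a b c d e g (1 + t * e) (t * d) (t * b) = 0" by (simp add: two)
    moreover have "(1 + t * e, t * d, t * b) \<noteq> (0, 0, 0)" using db(2) by auto
    ultimately show thesis using that by blast
  qed
next
  case False
  then have two: "(2 :: 'k) \<noteq> 0" by simp
  have "(4 :: 'k) = 2 * 2" by simp
  then have four: "(4 :: 'k) \<noteq> 0" using two by (simp only: mult_eq_0_iff) simp
  show thesis
  proof (cases "a = 0")
    case True
    then show thesis using that[of 1 0 0] by (simp add: ternary_form_def)
  next
    case a: False
    \<comment> \<open>\<open>A\<close>, \<open>2 B\<close>, \<open>G\<close> are the coefficients of
      the discriminant of the form as a quadratic polynomial in \<open>x\<close>, a binary form in
      \<open>y\<close> and \<open>z\<close> that remains after completing the square.\<close>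
    define A B G where "A = b * b - 4 * a * c" and "B = b * d - 2 * a * e" and "G = d * d - 4 * a * g"
    have square: "4 * a * ternary_form a b c d e g x y z =
        (2 * a * x + b * y + d * z) * (2 * a * x + b * y + d * z) - (A * y * y + 2 * B * y * z + G * z * z)"
      for x y z by (simp add: ternary_form_def A_def B_def G_def algebra_simps)
    show thesis
    proof (cases "A = 0")
      case True
      define x where "x = - b / (2 * a)"
      have "2 * a * x + b * 1 + d * 0 = 0" using a two by (simp add: x_def)
      then have "4 * a * ternary_form a b c d e g x 1 0 = 0" unfolding square using True by simp
      then show thesis using that[of x 1 0] a four by simp
    next
      case A: False
      \<comment> \<open>With \<open>u = A y + B\<close> the equation
        \<open>w * w = A y^2 + 2 B y + G\<close>, multiplied by \<open>A\<close>, becomes this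
        one.\<close>
      obtain u w where uw: "u * u - A * (w * w) = B * B - A * G" using sum_of_two_squares[OF A] by metis
      define y where "y = (u - B) / A"
      have u: "u = A * y + B" using A by (simp add: y_def)
      have "A * (w * w) = A * (A * y * y + 2 * B * y * 1 + G * 1 * 1)"
        using uw unfolding u by (simp add: algebra_simps)
      then have w: "w * w = A * y * y + 2 * B * y * 1 + G * 1 * 1" using A by (metis mult_cancel_left)
      define x where "x = (w - b * y - d) / (2 * a)"
      have "2 * a * x + b * y + d * 1 = w" using a two by (simp add: x_def)
      then have "4 * a * ternary_form a b c d e g x y 1 = 0" unfolding square using w by simp
      then show thesis using that[of x y 1] a four by simp
    qed
  qed
qed

section \<open>Parametrisation of conics with a rational point\<close>

text \<open>A rational parametrisation \<open>t \<mapsto> (X t : Y t : Z t)\<close> of a projective plane curve by quadratic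
  polynomials, where \<open>t = \<infinity>\<close> corresponds to the coefficients of \<open>t\<^sup>2\<close>; it is inverted by
  \<open>\<tau> / \<beta>\<close>.\<close>

definition chart_onto :: "('a::field \<times> 'a \<times> 'a) set \<Rightarrow> 'a poly \<Rightarrow> 'a poly \<Rightarrow> 'a poly \<Rightarrow>
    ('a \<Rightarrow> 'a \<Rightarrow> 'a \<Rightarrow> 'a) \<Rightarrow> ('a \<Rightarrow> 'a \<Rightarrow> 'a \<Rightarrow> 'a) \<Rightarrow> bool" where
  "chart_onto C P1 P2 P3 \<beta> \<tau> \<longleftrightarrow>
     (\<forall>x y z. (x, y, z) \<in> C \<longrightarrow>
       (\<beta> x y z \<noteq> 0 \<and> x = \<beta> x y z * poly P1 (\<tau> x y z / \<beta> x y z) \<and>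
         y = \<beta> x y z * poly P2 (\<tau> x y z / \<beta> x y z) \<and> z = \<beta> x y z * poly P3 (\<tau> x y z / \<beta> x y z)) \<or>
       (\<exists>c. x = c * coeff P1 2 \<and> y = c * coeff P2 2 \<and> z = c * coeff P3 2))"

text \<open>\<open>C\<close> is meant as a cone of homogeneous triples. The function
  \<open>\<beta>\<close> is 1 on the finite part of the parametrisation and 0 at infinity, so it
  separates the two, and its homogeneity together with that of \<open>\<tau>\<close> makes the
  parameter independent of scaling. The clauses with \<open>q\<close>-th powers say that the
  parametrisation and its inverse respect rationality.\<close>

definition conic_chart :: "nat \<Rightarrow> ('a::field \<times> 'a \<times> 'a) set \<Rightarrow> 'a poly \<Rightarrow> 'a poly \<Rightarrow> 'a poly \<Rightarrow>
    ('a \<Rightarrow> 'a \<Rightarrow> 'a \<Rightarrow> 'a) \<Rightarrow> ('a \<Rightarrow> 'a \<Rightarrow> 'a \<Rightarrow> 'a) \<Rightarrow> bool" where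
  "conic_chart q C P1 P2 P3 \<beta> \<tau> \<longleftrightarrow>
     degree P1 \<le> 2 \<and> degree P2 \<le> 2 \<and> degree P3 \<le> 2 \<and>
     (\<forall>t. t ^ q = t \<longrightarrow> poly P1 t ^ q = poly P1 t \<and> poly P2 t ^ q = poly P2 t \<and> poly P3 t ^ q = poly P3 t) \<and>
     coeff P1 2 ^ q = coeff P1 2 \<and> coeff P2 2 ^ q = coeff P2 2 \<and> coeff P3 2 ^ q = coeff P3 2 \<and>
     (\<forall>t. (poly P1 t, poly P2 t, poly P3 t) \<in> C) \<and> (coeff P1 2, coeff P2 2, coeff P3 2) \<in> C \<and>
     (\<forall>c x y z. \<beta> (c * x) (c * y) (c * z) = c * \<beta> x y z \<and> \<tau> (c * x) (c * y) (c * z) = c * \<tau> x y z) \<and>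
     (\<forall>x y z. x ^ q = x \<longrightarrow> y ^ q = y \<longrightarrow> z ^ q = z \<longrightarrow> \<beta> x y z ^ q = \<beta> x y z \<and> \<tau> x y z ^ q = \<tau> x y z) \<and>
     (\<forall>t. \<beta> (poly P1 t) (poly P2 t) (poly P3 t) = 1 \<and> \<tau> (poly P1 t) (poly P2 t) (poly P3 t) = t) \<and>
     \<beta> (coeff P1 2) (coeff P2 2) (coeff P3 2) = 0 \<and>
     chart_onto C P1 P2 P3 \<beta> \<tau>"

text \<open>The two linear forms may coincide or vanish, and their coefficients need not be
  rational.\<close>

definition splits :: "('a::field \<times> 'a \<times> 'a) set \<Rightarrow> bool" where
  "splits C \<longleftrightarrow> (\<exists>l1 l2 l3 n1 n2 n3. C =
     {(x, y, z). (l1 * x + l2 * y + l3 * z) * (n1 * x + n2 * y + n3 * z) = 0})"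

definition split_or_chart :: "nat \<Rightarrow> ('a::field \<times> 'a \<times> 'a) set \<Rightarrow> bool" where
  "split_or_chart q C \<longleftrightarrow> splits C \<or> (\<exists>P1 P2 P3 \<beta> \<tau>. conic_chart q C P1 P2 P3 \<beta> \<tau>)"

text \<open>Permuting the coordinates reduces the construction of a chart to a rational point with
  last coordinate 1 at which the derivative with respect to \<open>x\<close> does not
  vanish.\<close>

lemma split_or_chart_swap:
  assumes "split_or_chart q {(x, y, z). (y, x, z) \<in> C}"
  shows "split_or_chart q C"
  using assms unfolding split_or_chart_def
proof (elim disjE exE)
  assume "splits {(x, y, z). (y, x, z) \<in> C}"
  then obtain l1 l2 l3 n1 n2 n3 where *: "{(x, y, z). (y, x, z) \<in> C} =
     {(x, y, z). (l1 * x + l2 * y + l3 * z) * (n1 * x + n2 * y + n3 * z) = 0}"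
    unfolding splits_def by blast
  have "(x, y, z) \<in> C \<longleftrightarrow> (l2 * x + l1 * y + l3 * z) * (n2 * x + n1 * y + n3 * z) = 0" for x y z
  proof -
    have "(x, y, z) \<in> C \<longleftrightarrow> (y, x, z) \<in> {(x, y, z). (y, x, z) \<in> C}" by simp
    then show ?thesis unfolding * by (simp add: add.commute)
  qed
  then have "C = {(x, y, z). (l2 * x + l1 * y + l3 * z) * (n2 * x + n1 * y + n3 * z) = 0}" by auto
  then show "splits C \<or> (\<exists>P1 P2 P3 \<beta> \<tau>. conic_chart q C P1 P2 P3 \<beta> \<tau>)" unfolding splits_def by blast
next
  fix P1 P2 P3 \<beta> \<tau> assume *: "conic_chart q {(x, y, z). (y, x, z) \<in> C} P1 P2 P3 \<beta> \<tau>"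
  have "chart_onto {(x, y, z). (y, x, z) \<in> C} P1 P2 P3 \<beta> \<tau>" using * by (simp only: conic_chart_def)
  then have onto: "chart_onto C P2 P1 P3 (\<lambda>x y z. \<beta> y x z) (\<lambda>x y z. \<tau> y x z)"
    unfolding chart_onto_def mem_Collect_eq prod.case by blast
  have "conic_chart q C P2 P1 P3 (\<lambda>x y z. \<beta> y x z) (\<lambda>x y z. \<tau> y x z)"
    using * onto unfolding conic_chart_def mem_Collect_eq prod.case
    by (elim conjE) (intro conjI allI impI; simp)
  then show "splits C \<or> (\<exists>P1 P2 P3 \<beta> \<tau>. conic_chart q C P1 P2 P3 \<beta> \<tau>)" by blast
qed

lemma split_or_chart_rotate:
  assumes "split_or_chart q {(x, y, z). (y, z, x) \<in> C}"
  shows "split_or_chart q C"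
  using assms unfolding split_or_chart_def
proof (elim disjE exE)
  assume "splits {(x, y, z). (y, z, x) \<in> C}"
  then obtain l1 l2 l3 n1 n2 n3 where *: "{(x, y, z). (y, z, x) \<in> C} =
     {(x, y, z). (l1 * x + l2 * y + l3 * z) * (n1 * x + n2 * y + n3 * z) = 0}"
    unfolding splits_def by blast
  have "(x, y, z) \<in> C \<longleftrightarrow> (l2 * x + l3 * y + l1 * z) * (n2 * x + n3 * y + n1 * z) = 0" for x y z
  proof -
    have "(x, y, z) \<in> C \<longleftrightarrow> (z, x, y) \<in> {(x, y, z). (y, z, x) \<in> C}" by simp
    then show ?thesis unfolding * by (simp add: add_ac)
  qed
  then have "C = {(x, y, z). (l2 * x + l3 * y + l1 * z) * (n2 * x + n3 * y + n1 * z) = 0}" by auto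
  then show "splits C \<or> (\<exists>P1 P2 P3 \<beta> \<tau>. conic_chart q C P1 P2 P3 \<beta> \<tau>)" unfolding splits_def by blast
next
  fix P1 P2 P3 \<beta> \<tau> assume *: "conic_chart q {(x, y, z). (y, z, x) \<in> C} P1 P2 P3 \<beta> \<tau>"
  have "chart_onto {(x, y, z). (y, z, x) \<in> C} P1 P2 P3 \<beta> \<tau>" using * by (simp only: conic_chart_def)
  then have onto: "chart_onto C P2 P3 P1 (\<lambda>x y z. \<beta> z x y) (\<lambda>x y z. \<tau> z x y)"
    unfolding chart_onto_def mem_Collect_eq prod.case by blast
  have "conic_chart q C P2 P3 P1 (\<lambda>x y z. \<beta> z x y) (\<lambda>x y z. \<tau> z x y)"
    using * onto unfolding conic_chart_def mem_Collect_eq prod.case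
    by (elim conjE) (intro conjI allI impI; simp)
  then show "splits C \<or> (\<exists>P1 P2 P3 \<beta> \<tau>. conic_chart q C P1 P2 P3 \<beta> \<tau>)" by blast
qed

text \<open>A root of the dehomogenised polynomial gives a linear factor; without the term in
  \<open>x^2\<close> the factor \<open>y\<close> is visible.\<close>

lemma binary_form_splits:
  fixes a b c :: "'a::alg_closed_field"
  obtains l m n r where "\<And>x y. a * x * x + b * x * y + c * y * y = (l * x + m * y) * (n * x + r * y)"
proof (cases "a = 0")
  case True
  then show thesis using that[of 0 1 b c] by (simp add: algebra_simps)
next
  case False
  then have "degree [:c, b, a:] > 0" by simp
  then obtain t where "poly [:c, b, a:] t = 0" using alg_closed_imp_poly_has_root by blast
  then have t0: "c + b * t + a * t * t = 0" by (simp add: algebra_simps)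
  have "c = (c + b * t + a * t * t) - b * t - a * t * t" by simp
  also have "\<dots> = - b * t - a * t * t" by (simp only: t0) simp
  finally have t: "c = - b * t - a * t * t" .
  have "a * x * x + b * x * y + c * y * y = (1 * x + (- t) * y) * (a * x + (b + a * t) * y)" for x y
    unfolding t by (simp add: algebra_simps)
  then show thesis using that by blast
qed

text \<open>The facts about the \<open>q\<close>-th power map on the algebraic closure of a field
  with \<open>q\<close> elements from which the counting proceeds. \<open>dummy\<close> carries the
  type.\<close>

locale frobenius_fixed =
  fixes q :: nat and dummy :: "'a::alg_closed_field itself"
  assumes frob_add: "(x + y) ^ q = x ^ q + (y :: 'a) ^ q"
    and card_fixed: "card {x :: 'a. x ^ q = x} = q"
    and q_pos: "q > 0"
begin

definition fixed :: "'a \<Rightarrow> bool" where "fixed x \<longleftrightarrow> x ^ q = x"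

lemma fixed_add [simp]: "fixed x \<Longrightarrow> fixed y \<Longrightarrow> fixed (x + y)"
  by (simp add: fixed_def frob_add)

lemma fixed_mult [simp]: "fixed x \<Longrightarrow> fixed y \<Longrightarrow> fixed (x * y)"
  by (simp add: fixed_def power_mult_distrib)

lemma fixed_0 [simp]: "fixed 0" and fixed_1 [simp]: "fixed 1"
  using q_pos by (simp_all add: fixed_def)

lemma frob_minus: "(- x) ^ q = - (x ^ q :: 'a)"
proof -
  have "x ^ q + (- x) ^ q = (x + - x) ^ q" by (simp only: frob_add)
  then show ?thesis using q_pos by (simp add: eq_neg_iff_add_eq_0 add.commute)
qed

lemma fixed_minus [simp]: "fixed x \<Longrightarrow> fixed (- x)"
  by (simp add: fixed_def frob_minus)

lemma fixed_diff [simp]: "fixed x \<Longrightarrow> fixed y \<Longrightarrow> fixed (x - y)"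
  using fixed_add[of x "- y"] by simp

lemma fixed_divide [simp]: "fixed x \<Longrightarrow> fixed y \<Longrightarrow> fixed (x / y)"
  by (simp add: fixed_def power_divide)

lemma fixed_2 [simp]: "fixed 2"
  using fixed_add[OF fixed_1 fixed_1] by simp

text \<open>With \<open>x = u z + \<sigma>\<close>, \<open>y = v z + \<tau>\<close> and \<open>\<beta> = b1 \<sigma> + b2 \<tau>\<close> the tangent form at the point
  \<open>(u, v, 1)\<close>, the form becomes \<open>\<alpha> \<beta> + c0 \<tau>\<^sup>2\<close>.\<close>

lemma conic_normal_form:
  assumes fixed: "fixed a" "fixed b" "fixed c" "fixed d" "fixed e" "fixed g" "fixed u" "fixed v"
    and p: "ternary_form a b c d e g u v 1 = 0"
    and b1: "2 * a * u + b * v + d \<noteq> 0"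
  shows "split_or_chart q {(x, y, z). ternary_form a b c d e g x y z = 0}"
proof -
  define b1 b2 where "b1 = 2 * a * u + b * v + d" and "b2 = b * u + 2 * c * v + e"
  have b1: "b1 \<noteq> 0" using b1 by (simp add: b1_def)
  have g: "g = - (a * u * u + b * u * v + c * v * v + d * u + e * v)"
    using p by (simp add: ternary_form_def add_eq_0_iff2 algebra_simps)
  \<comment> \<open>The numerator of \<open>c0\<close> is the value of the quadratic part at the
    direction \<open>(b2, - b1)\<close> of the tangent, so \<open>c0 = 0\<close> means that the
    tangent is contained in the conic.\<close>
  define c0 c1 c2 where "c0 = (a * b2 * b2 - b * b1 * b2 + c * b1 * b1) / (b1 * b1)"
    and "c1 = (b * b1 - 2 * a * b2) / (b1 * b1)" and "c2 = a / (b1 * b1)"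
  define \<beta> where "\<beta> x y z = b1 * (x - u * z) + b2 * (y - v * z)" for x y z :: 'a
  define \<tau> where "\<tau> x y z = y - v * z" for x y z :: 'a
  define \<alpha> where "\<alpha> x y z = z + c1 * \<tau> x y z + c2 * \<beta> x y z" for x y z :: 'a
  have nf: "ternary_form a b c d e g x y z = \<alpha> x y z * \<beta> x y z + c0 * \<tau> x y z * \<tau> x y z" for x y z
  proof -
    define s where "s = x - u * z"
    define t where "t = y - v * z"
    have x: "x = s + u * z" and y: "y = t + v * z" by (simp_all add: s_def t_def)
    have "ternary_form a b c d e g x y z = a * s * s + b * s * t + c * t * t + z * (b1 * s + b2 * t)"
      unfolding ternary_form_def x y g b1_def b2_def by (simp add: algebra_simps)
    also have "a * s * s + b * s * t + c * t * t =
        c0 * t * t + (b1 * s + b2 * t) * (c1 * t + c2 * (b1 * s + b2 * t))"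
    proof -
      have "(b1 * b1) * (c0 * t * t + (b1 * s + b2 * t) * (c1 * t + c2 * (b1 * s + b2 * t))) =
          (b1 * b1 * c0) * t * t + (b1 * s + b2 * t) * ((b1 * b1 * c1) * t + (b1 * b1 * c2) * (b1 * s + b2 * t))"
        by (simp add: algebra_simps)
      also have "b1 * b1 * c0 = a * b2 * b2 - b * b1 * b2 + c * b1 * b1" using b1 by (simp add: c0_def)
      also have "b1 * b1 * c1 = b * b1 - 2 * a * b2" using b1 by (simp add: c1_def)
      also have "b1 * b1 * c2 = a" using b1 by (simp add: c2_def)
      also have "(a * b2 * b2 - b * b1 * b2 + c * b1 * b1) * t * t +
          (b1 * s + b2 * t) * ((b * b1 - 2 * a * b2) * t + a * (b1 * s + b2 * t)) =
          (b1 * b1) * (a * s * s + b * s * t + c * t * t)"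
        by (simp add: algebra_simps)
      finally show ?thesis using b1 by (metis mult_cancel_left no_zero_divisors)
    qed
    also have "c0 * t * t + (b1 * s + b2 * t) * (c1 * t + c2 * (b1 * s + b2 * t)) + z * (b1 * s + b2 * t) =
        \<alpha> x y z * \<beta> x y z + c0 * \<tau> x y z * \<tau> x y z"
      unfolding \<alpha>_def \<beta>_def \<tau>_def by (simp add: algebra_simps flip: s_def t_def)
    finally show ?thesis .
  qed
  show ?thesis
  proof (cases "c0 = 0")
    case True
    have "{(x, y, z). ternary_form a b c d e g x y z = 0} = {(x, y, z).
      ((c2 * b1) * x + (c1 + c2 * b2) * y + (1 - c1 * v - c2 * b1 * u - c2 * b2 * v) * z) *
      (b1 * x + b2 * y + (- b1 * u - b2 * v) * z) = 0}"
      unfolding nf True \<alpha>_def \<beta>_def \<tau>_def by (simp add: algebra_simps)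
    then have "splits {(x, y, z). ternary_form a b c d e g x y z = 0}" unfolding splits_def by blast
    then show ?thesis by (simp add: split_or_chart_def)
  next
    case c0: False
    \<comment> \<open>\<open>X1\<close>, \<open>Y1\<close> and \<open>Z\<close> invert the linear
      change of coordinates from \<open>(x, y, z)\<close> to
      \<open>(\<alpha>, \<beta>, \<tau>)\<close>.\<close>
    define Z where "Z A B T = A - c1 * T - c2 * B" for A B T :: 'a
    define X1 where "X1 A B T = (B - b2 * T) / b1 + u * Z A B T" for A B T :: 'a
    define Y1 where "Y1 A B T = T + v * Z A B T" for A B T :: 'a
    have inv: "x = X1 (\<alpha> x y z) (\<beta> x y z) (\<tau> x y z) \<and>
      y = Y1 (\<alpha> x y z) (\<beta> x y z) (\<tau> x y z) \<and> z = Z (\<alpha> x y z) (\<beta> x y z) (\<tau> x y z)" for x y z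
    proof -
      have z: "Z (\<alpha> x y z) (\<beta> x y z) (\<tau> x y z) = z" by (simp add: Z_def \<alpha>_def)
      have "(\<beta> x y z - b2 * \<tau> x y z) / b1 = x - u * z" using b1 by (simp add: \<beta>_def \<tau>_def)
      then show ?thesis unfolding X1_def Y1_def z by (simp add: \<tau>_def)
    qed
    have bt: "\<tau> (X1 A B T) (Y1 A B T) (Z A B T) = T" "\<beta> (X1 A B T) (Y1 A B T) (Z A B T) = B" for A B T
      using b1 by (simp_all add: \<beta>_def \<tau>_def X1_def Y1_def)
    have al: "\<alpha> (X1 A B T) (Y1 A B T) (Z A B T) = A" for A B T
      unfolding \<alpha>_def bt by (simp add: Z_def)
    \<comment> \<open>On \<open>\<alpha> \<beta> + c0 \<tau>\<^sup>2 = 0\<close> the choice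
      \<open>\<beta> = 1\<close>, \<open>\<tau> = t\<close> gives
      \<open>\<alpha> = - c0 t\<^sup>2\<close>; the point at infinity is
      \<open>\<alpha> = - c0\<close>, \<open>\<beta> = \<tau> = 0\<close>.\<close>
    define P3 where "P3 = [:- c2, - c1, - c0:]"
    define P1 where "P1 = [:1 / b1, - b2 / b1, 0:] + smult u P3"
    define P2 where "P2 = [:0, 1, 0:] + smult v P3"
    have P: "poly P1 t = X1 (- c0 * t * t) 1 t" "poly P2 t = Y1 (- c0 * t * t) 1 t"
      "poly P3 t = Z (- c0 * t * t) 1 t" for t
      using b1 by (simp_all add: P1_def P2_def P3_def X1_def Y1_def Z_def field_simps)
    have co: "coeff P1 2 = X1 (- c0) 0 0" "coeff P2 2 = Y1 (- c0) 0 0" "coeff P3 2 = Z (- c0) 0 0"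
      by (simp_all add: P1_def P2_def P3_def X1_def Y1_def Z_def numeral_2_eq_2)
    have fx: "fixed b1" "fixed b2" using fixed by (simp_all add: b1_def b2_def)
    have fc: "fixed c0" "fixed c1" "fixed c2" using fixed fx by (simp_all add: c0_def c1_def c2_def)
    have fXYZ: "fixed (X1 A B T)" "fixed (Y1 A B T)" "fixed (Z A B T)" if "fixed A" "fixed B" "fixed T" for A B T
      using that fx fc fixed by (simp_all add: X1_def Y1_def Z_def)
    have scale: "X1 (k * A) (k * B) (k * T) = k * X1 A B T" "Y1 (k * A) (k * B) (k * T) = k * Y1 A B T"
      "Z (k * A) (k * B) (k * T) = k * Z A B T" for k A B T
      using b1 by (simp_all add: X1_def Y1_def Z_def field_simps)
    have "conic_chart q {(x, y, z). ternary_form a b c d e g x y z = 0} P1 P2 P3 \<beta> \<tau>"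
      unfolding conic_chart_def
    proof (intro conjI allI impI)
      show "degree P3 \<le> 2" by (simp add: P3_def)
      then show "degree P1 \<le> 2" "degree P2 \<le> 2"
        unfolding P1_def P2_def by (intro degree_add_le order_trans[OF degree_smult_le]; simp)+
      show "poly P1 t ^ q = poly P1 t" "poly P2 t ^ q = poly P2 t" "poly P3 t ^ q = poly P3 t" if "t ^ q = t" for t
        using fXYZ[of "- c0 * t * t" 1 t] fc that by (simp_all add: P fixed_def[symmetric])
      show "coeff P1 2 ^ q = coeff P1 2" "coeff P2 2 ^ q = coeff P2 2" "coeff P3 2 ^ q = coeff P3 2"
        using fXYZ[of "- c0" 0 0] fc by (simp_all add: co fixed_def[symmetric])
      show "(poly P1 t, poly P2 t, poly P3 t) \<in> {(x, y, z). ternary_form a b c d e g x y z = 0}" for t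
        by (simp add: nf P al bt)
      show "(coeff P1 2, coeff P2 2, coeff P3 2) \<in> {(x, y, z). ternary_form a b c d e g x y z = 0}"
        by (simp add: nf co al bt)
      show "\<beta> (k * x) (k * y) (k * z) = k * \<beta> x y z" "\<tau> (k * x) (k * y) (k * z) = k * \<tau> x y z" for k x y z
        by (simp_all add: \<beta>_def \<tau>_def algebra_simps)
      show "\<beta> x y z ^ q = \<beta> x y z" "\<tau> x y z ^ q = \<tau> x y z" if "x ^ q = x" "y ^ q = y" "z ^ q = z" for x y z
        using that fixed fx unfolding fixed_def[symmetric] by (simp_all add: \<beta>_def \<tau>_def)
      show "\<beta> (poly P1 t) (poly P2 t) (poly P3 t) = 1" "\<tau> (poly P1 t) (poly P2 t) (poly P3 t) = t" for t
        by (simp_all add: P bt)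
      show "\<beta> (coeff P1 2) (coeff P2 2) (coeff P3 2) = 0" by (simp add: co bt)
      show "chart_onto {(x, y, z). ternary_form a b c d e g x y z = 0} P1 P2 P3 \<beta> \<tau>"
        unfolding chart_onto_def
      proof (intro allI impI)
      fix x y z assume "(x, y, z) \<in> {(x, y, z). ternary_form a b c d e g x y z = 0}"
      then have C: "\<alpha> x y z * \<beta> x y z + c0 * \<tau> x y z * \<tau> x y z = 0" by (simp add: nf)
      let ?b = "\<beta> x y z" and ?t = "\<tau> x y z"
      show "(?b \<noteq> 0 \<and> x = ?b * poly P1 (?t / ?b) \<and> y = ?b * poly P2 (?t / ?b) \<and> z = ?b * poly P3 (?t / ?b)) \<or>
        (\<exists>k. x = k * coeff P1 2 \<and> y = k * coeff P2 2 \<and> z = k * coeff P3 2)"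
      proof (cases "?b = 0")
        case False
        have A: "?b * (- c0 * (?t / ?b) * (?t / ?b)) = \<alpha> x y z"
          using C False by (simp add: field_simps add_eq_0_iff)
        have T: "?b * (?t / ?b) = ?t" using False by simp
        show ?thesis
          using False inv[of x y z] by (simp only: P scale[symmetric] A T mult_1_right) simp
      next
        case True
        \<comment> \<open>Where \<open>\<beta>\<close> vanishes so does \<open>\<tau>\<close>, hence
          only multiples of the point at infinity are left.\<close>
        then have t0: "?t = 0" using C c0 by simp
        have A: "(- \<alpha> x y z / c0) * (- c0) = \<alpha> x y z" using c0 by simp
        show ?thesis
          using inv[of x y z] unfolding True t0
          by (intro disjI2 exI[of _ "- \<alpha> x y z / c0"]) (simp only: co scale[symmetric] A mult_zero_right)
      qed
      qed
    qed
    then show ?thesis unfolding split_or_chart_def by blast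
  qed
qed

text \<open>If the derivative with respect to \<open>x\<close> or to \<open>y\<close> is nonzero at
  the rational point, the normal form applies. If both vanish, the point is singular, the form
  depends only on \<open>x - u z\<close> and \<open>y - v z\<close>, and as a binary form it splits
  over the algebraically closed field.\<close>

lemma conic_split_or_chart_affine:
  assumes fixed: "fixed a" "fixed b" "fixed c" "fixed d" "fixed e" "fixed g" "fixed u" "fixed v"
    and p: "ternary_form a b c d e g u v 1 = 0"
  shows "split_or_chart q {(x, y, z). ternary_form a b c d e g x y z = 0}"
proof -
  have swap: "ternary_form a b c d e g x y z = ternary_form c b a e d g y x z" for x y z
    by (simp add: ternary_form_def algebra_simps)
  consider (1) "2 * a * u + b * v + d \<noteq> 0" | (2) "2 * c * v + b * u + e \<noteq> 0"
    | (3) "2 * a * u + b * v + d = 0" "2 * c * v + b * u + e = 0" by blast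
  then show ?thesis
  proof cases
    case 1
    then show ?thesis by (rule conic_normal_form[OF fixed p])
  next
    case 2
    have "split_or_chart q {(x, y, z). ternary_form c b a e d g x y z = 0}"
      by (rule conic_normal_form[OF fixed(3) fixed(2) fixed(1) fixed(5) fixed(4) fixed(6) fixed(8) fixed(7) _ 2])
        (use p in \<open>simp only: swap\<close>)
    then show ?thesis by - (rule split_or_chart_swap, simp add: swap)
  next
    case 3
    obtain l m n r where lm: "\<And>x y. a * x * x + b * x * y + c * y * y = (l * x + m * y) * (n * x + r * y)"
      using binary_form_splits by metis
    have g: "g = - (a * u * u + b * u * v + c * v * v + d * u + e * v)"
      using p by (simp add: ternary_form_def add_eq_0_iff2 algebra_simps)
    have d: "d = - (2 * a * u + b * v)" using 3(1) by (simp add: add_eq_0_iff2 add_eq_0_iff)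
    have e: "e = - (2 * c * v + b * u)" using 3(2) by (simp add: add_eq_0_iff2 add_eq_0_iff)
    have "ternary_form a b c d e g x y z = (l * x + m * y + (- l * u - m * v) * z) * (n * x + r * y + (- n * u - r * v) * z)"
      for x y z
    proof -
      have "ternary_form a b c d e g x y z = a * (x - u * z) * (x - u * z) + b * (x - u * z) * (y - v * z) +
          c * (y - v * z) * (y - v * z)"
        unfolding ternary_form_def g d e by (simp add: algebra_simps)
      also have "\<dots> = (l * (x - u * z) + m * (y - v * z)) * (n * (x - u * z) + r * (y - v * z))"
        by (rule lm)
      finally show ?thesis by (simp add: algebra_simps)
    qed
    then have "splits {(x, y, z). ternary_form a b c d e g x y z = 0}"
      unfolding splits_def
      by (intro exI[of _ l] exI[of _ m] exI[of _ "- l * u - m * v"] exI[of _ n] exI[of _ r]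
          exI[of _ "- n * u - r * v"]) (simp only:)
    then show ?thesis by (simp add: split_or_chart_def)
  qed
qed

lemma conic_scale: "ternary_form a b c d e g (k * x) (k * y) (k * z) = k * k * ternary_form a b c d e g x y z"
  by (simp add: ternary_form_def algebra_simps)

lemma conic_split_or_chart:
  assumes fixed: "fixed a" "fixed b" "fixed c" "fixed d" "fixed e" "fixed g" "fixed u" "fixed v" "fixed w"
    and p: "ternary_form a b c d e g u v w = 0" "(u, v, w) \<noteq> (0, 0, 0)"
  shows "split_or_chart q {(x, y, z). ternary_form a b c d e g x y z = 0}"
proof -
  have rot: "ternary_form a b c d e g x y z = ternary_form g d a e b c z x y" for x y z
    by (simp add: ternary_form_def algebra_simps)
  have rot2: "ternary_form a b c d e g x y z = ternary_form c e g b d a y z x" for x y z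
    by (simp add: ternary_form_def algebra_simps)
  consider "w \<noteq> 0" | "v \<noteq> 0" | "u \<noteq> 0" using p(2) by auto
  then show ?thesis
  proof cases
    case 1
    have "ternary_form a b c d e g (1 / w * u) (1 / w * v) (1 / w * w) = 0" by (simp only: conic_scale p) simp
    then show ?thesis using 1 fixed
      by (intro conic_split_or_chart_affine[of _ _ _ _ _ _ "u / w" "v / w"]) simp_all
  next
    case 2
    have "ternary_form a b c d e g (1 / v * u) (1 / v * v) (1 / v * w) = 0" by (simp only: conic_scale p) simp
    then have "ternary_form g d a e b c (w / v) (u / v) 1 = 0" using 2 by (simp add: rot)
    then have *: "split_or_chart q {(x, y, z). ternary_form g d a e b c x y z = 0}"
      using fixed by (intro conic_split_or_chart_affine[of _ _ _ _ _ _ "w / v" "u / v"]) simp_all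
    show ?thesis
      by (rule split_or_chart_rotate) (use * in \<open>simp add: rot\<close>)
  next
    case 3
    have "ternary_form a b c d e g (1 / u * u) (1 / u * v) (1 / u * w) = 0" by (simp only: conic_scale p) simp
    then have "ternary_form c e g b d a (v / u) (w / u) 1 = 0" using 3 by (simp add: rot2)
    then have *: "split_or_chart q {(x, y, z). ternary_form c e g b d a x y z = 0}"
      using fixed by (intro conic_split_or_chart_affine[of _ _ _ _ _ _ "v / u" "w / u"]) simp_all
    show ?thesis
      by (rule split_or_chart_rotate, rule split_or_chart_rotate) (use * in \<open>simp add: rot2\<close>)
  qed
qed

end

section \<open>Formal degrees and homogenisation\<close>

text \<open>Here \<open>m\<close> and \<open>n\<close> are formal degrees, upper bounds that need
  not be attained: the coefficient at the formal degree plays the part of the value at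
  \<open>t = \<infinity>\<close>.\<close>

lemma coeff_mult_top:
  fixes p r :: "'a::comm_ring_1 poly"
  assumes "degree p \<le> m" "degree r \<le> n"
  shows "coeff (p * r) (m + n) = coeff p m * coeff r n"
proof -
  have "coeff (p * r) (m + n) = (\<Sum>i\<le>m + n. coeff p i * coeff r (m + n - i))" by (rule coeff_mult)
  also have "\<dots> = (\<Sum>i\<le>m + n. if i = m then coeff p m * coeff r n else 0)"
  proof (rule sum.cong)
    fix i assume i: "i \<in> {..m + n}"
    consider "i = m" | "i < m" | "i > m" by linarith
    then show "coeff p i * coeff r (m + n - i) = (if i = m then coeff p m * coeff r n else 0)"
    proof cases
      case 2
      then have "coeff r (m + n - i) = 0" using assms(2) by (intro coeff_eq_0) auto
      then show ?thesis using 2 by simp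
    next
      case 3
      then have "coeff p i = 0" using assms(1) by (intro coeff_eq_0) auto
      then show ?thesis using 3 by simp
    qed simp
  qed simp
  also have "\<dots> = coeff p m * coeff r n" by simp
  finally show ?thesis .
qed

lemma degree_mult_top:
  fixes p r :: "'a::comm_ring_1 poly"
  assumes "degree p \<le> m" "degree r \<le> n"
  shows "degree (p * r) \<le> m + n"
  using degree_mult_le[of p r] assms by linarith

lemma power_top:
  fixes p :: "'a::comm_ring_1 poly"
  assumes "degree p \<le> m"
  shows "degree (p ^ n) \<le> m * n" "coeff (p ^ n) (m * n) = coeff p m ^ n"
proof (induction n)
  case (Suc n)
  case 1
  show ?case using degree_mult_top[OF assms Suc(1)] by simp
  case 2
  show ?case using coeff_mult_top[OF assms Suc(1)] Suc(2) by simp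
qed simp_all

text \<open>For exponents in the triangle \<open>u \<le> fst m\<close>,
  \<open>v \<le> snd m\<close>, \<open>fst m + snd m \<le> w\<close> this is \<open>f\<close>
  divided by \<open>x^u y^v\<close> and homogenised to degree \<open>w - u - v\<close>, which also
  makes sense where a coordinate vanishes.\<close>

definition homogenize :: "'a::field laurent \<Rightarrow> int \<Rightarrow> int \<Rightarrow> int \<Rightarrow> 'a \<Rightarrow> 'a \<Rightarrow> 'a \<Rightarrow> 'a" where
  "homogenize f u v w x y z = (\<Sum>m\<in>Poly_Mapping.keys f. Poly_Mapping.lookup f m *
     (x ^ nat (fst m - u) * y ^ nat (snd m - v) * z ^ nat (w - fst m - snd m)))"

lemma laurent_eval_homogenize:
  fixes f :: "'a::field laurent"
  assumes "\<And>m. m \<in> Poly_Mapping.keys f \<Longrightarrow> u \<le> fst m \<and> v \<le> snd m \<and> fst m + snd m \<le> w"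
    and nz: "x \<noteq> 0" "y \<noteq> 0" "z \<noteq> 0"
  shows "laurent_eval f (x / z, y / z) = x powi u * y powi v * z powi (- w) * homogenize f u v w x y z"
  unfolding laurent_eval_def homogenize_def sum_distrib_left
proof (rule sum.cong)
  fix m assume m: "m \<in> Poly_Mapping.keys f"
  have "x ^ nat (fst m - u) = x powi (fst m - u)" "y ^ nat (snd m - v) = y powi (snd m - v)"
    "z ^ nat (w - fst m - snd m) = z powi (w - fst m - snd m)"
    using assms(1)[OF m] by (auto simp: power_nat_eq)
  moreover have "torus_char (x / z, y / z) m =
      x powi u * y powi v * z powi (- w) * (x powi (fst m - u) * y powi (snd m - v) * z powi (w - fst m - snd m))"
  proof -
    have "x powi u * x powi (fst m - u) = x powi fst m" "y powi v * y powi (snd m - v) = y powi snd m"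
      "z powi (- w) * z powi (w - fst m - snd m) = z powi (- fst m - snd m)"
      using nz by (simp_all flip: power_int_add)
    moreover have "torus_char (x / z, y / z) m = x powi fst m * y powi snd m * z powi (- fst m - snd m)"
      using nz by (simp add: torus_char_def power_int_divide_distrib power_int_diff power_int_minus field_simps)
    moreover have "x powi u * y powi v * z powi (- w) * (x powi (fst m - u) * y powi (snd m - v) * z powi (w - fst m - snd m)) =
        (x powi u * x powi (fst m - u)) * (y powi v * y powi (snd m - v)) * (z powi (- w) * z powi (w - fst m - snd m))"
      by (simp only: mult_ac)
    ultimately show ?thesis by (simp only:)
  qed
  ultimately show "Poly_Mapping.lookup f m * torus_char (x / z, y / z) m = x powi u * y powi v * z powi (- w) *
      (Poly_Mapping.lookup f m * (x ^ nat (fst m - u) * y ^ nat (snd m - v) * z ^ nat (w - fst m - snd m)))"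
    by (simp add: mult_ac)
qed simp

lemma mem_zeros_homogenize:
  fixes f :: "'a::field laurent"
  assumes "\<And>m. m \<in> Poly_Mapping.keys f \<Longrightarrow> u \<le> fst m \<and> v \<le> snd m \<and> fst m + snd m \<le> w"
    and nz: "x \<noteq> 0" "y \<noteq> 0" "z \<noteq> 0"
  shows "(x / z, y / z) \<in> zeros f \<longleftrightarrow> homogenize f u v w x y z = 0"
  using laurent_eval_homogenize[OF assms] nz by (simp add: zeros_def)

definition homogenize_poly :: "'a::field laurent \<Rightarrow> int \<Rightarrow> int \<Rightarrow> int \<Rightarrow> 'a poly \<Rightarrow> 'a poly \<Rightarrow> 'a poly \<Rightarrow> 'a poly" where
  "homogenize_poly f u v w x y z = (\<Sum>m\<in>Poly_Mapping.keys f. smult (Poly_Mapping.lookup f m)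
     (x ^ nat (fst m - u) * y ^ nat (snd m - v) * z ^ nat (w - fst m - snd m)))"

lemma poly_homogenize_poly:
  "poly (homogenize_poly f u v w p1 p2 p3) t = homogenize f u v w (poly p1 t) (poly p2 t) (poly p3 t)"
  by (simp add: homogenize_poly_def homogenize_def poly_sum)

text \<open>The three exponents in each term add up to \<open>w - u - v\<close>, so all terms have
  the same formal degree and the top coefficient is the form evaluated at the point at
  infinity.\<close>

lemma homogenize_poly_top:
  fixes f :: "'a::field laurent"
  assumes bounds: "\<And>m. m \<in> Poly_Mapping.keys f \<Longrightarrow> u \<le> fst m \<and> v \<le> snd m \<and> fst m + snd m \<le> w"
    and deg: "degree p1 \<le> 2" "degree p2 \<le> 2" "degree p3 \<le> 2"
  shows "degree (homogenize_poly f u v w p1 p2 p3) \<le> 2 * nat (w - u - v)" (is ?A)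
    "coeff (homogenize_poly f u v w p1 p2 p3) (2 * nat (w - u - v)) =
      homogenize f u v w (coeff p1 2) (coeff p2 2) (coeff p3 2)" (is ?B)
proof -
  define P where "P m = p1 ^ nat (fst m - u) * p2 ^ nat (snd m - v) * p3 ^ nat (w - fst m - snd m)"
    for m :: "int \<times> int"
  have N: "2 * nat (fst m - u) + 2 * nat (snd m - v) + 2 * nat (w - fst m - snd m) = 2 * nat (w - u - v)"
    if "m \<in> Poly_Mapping.keys f" for m using bounds[OF that] by linarith
  note pw = power_top[OF deg(1)] power_top[OF deg(2)] power_top[OF deg(3)]
  have 1: "degree (P m) \<le> 2 * nat (w - u - v)" if "m \<in> Poly_Mapping.keys f" for m
    unfolding N[OF that, symmetric] P_def by (intro degree_mult_top pw)
  have 2: "coeff (P m) (2 * nat (w - u - v)) = coeff p1 2 ^ nat (fst m - u) * coeff p2 2 ^ nat (snd m - v) *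
      coeff p3 2 ^ nat (w - fst m - snd m)" if "m \<in> Poly_Mapping.keys f" for m
    unfolding N[OF that, symmetric] P_def
    by (subst coeff_mult_top coeff_mult_top; (intro degree_mult_top pw)?)+ (simp add: pw)
  show ?A unfolding homogenize_poly_def P_def[symmetric]
    using 1 by (intro degree_sum_le order_trans[OF degree_smult_le]) auto
  show ?B unfolding homogenize_poly_def homogenize_def P_def[symmetric] coeff_sum
    by (intro sum.cong refl) (simp add: 2)
qed

context frobenius_fixed begin

text \<open>A rational point has a rational parameter \<open>\<tau> / \<beta>\<close>, for which
  there are \<open>q\<close> values, or is the point at infinity.\<close>

lemma conic_upper:
  fixes s :: "'a laurent"
  assumes chart: "conic_chart q C P1 P2 P3 \<beta> \<tau>"
    and s: "\<And>x y. (x, y) \<in> zeros s \<Longrightarrow> (x, y, 1) \<in> C"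
  shows "card (rational_points q (zeros s)) \<le> q + 1"
proof -
  let ?F = "{x :: 'a. x ^ q = x}" and ?pt = "\<lambda>t. (poly P1 t / poly P3 t, poly P2 t / poly P3 t)"
  have fin: "finite ?F" using card_nonzero_fixed(2)[OF card_fixed q_pos] .
  have onto: "chart_onto C P1 P2 P3 \<beta> \<tau>" using chart by (simp only: conic_chart_def)
  have fx: "\<forall>x y z. x ^ q = x \<longrightarrow> y ^ q = y \<longrightarrow> z ^ q = z \<longrightarrow> \<beta> x y z ^ q = \<beta> x y z \<and> \<tau> x y z ^ q = \<tau> x y z"
    using chart unfolding conic_chart_def by - (elim conjE, assumption)
  have "rational_points q (zeros s) \<subseteq> insert (coeff P1 2 / coeff P3 2, coeff P2 2 / coeff P3 2) (?pt ` ?F)"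
  proof
    fix p assume "p \<in> rational_points q (zeros s)"
    then obtain x y where xy: "p = (x, y)" "(x, y) \<in> zeros s" "x ^ q = x" "y ^ q = y"
      by (auto simp: rational_points_def)
    let ?b = "\<beta> x y 1" and ?t = "\<tau> x y 1"
    have "(?b \<noteq> 0 \<and> x = ?b * poly P1 (?t / ?b) \<and> y = ?b * poly P2 (?t / ?b) \<and> 1 = ?b * poly P3 (?t / ?b)) \<or>
        (\<exists>k. x = k * coeff P1 2 \<and> y = k * coeff P2 2 \<and> 1 = k * coeff P3 2)"
      using onto s[OF xy(2)] unfolding chart_onto_def by blast
    then show "p \<in> insert (coeff P1 2 / coeff P3 2, coeff P2 2 / coeff P3 2) (?pt ` ?F)"
    proof (elim disjE conjE exE)
      assume b: "?b \<noteq> 0" "x = ?b * poly P1 (?t / ?b)" "y = ?b * poly P2 (?t / ?b)" "1 = ?b * poly P3 (?t / ?b)"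
      have "?b ^ q = ?b" "?t ^ q = ?t" using fx xy by auto
      then have "?t / ?b \<in> ?F" by (simp add: power_divide)
      moreover have "poly P3 (?t / ?b) = 1 / ?b" using b(1,4) by (metis nonzero_eq_divide_eq mult.commute)
      then have "p = ?pt (?t / ?b)" using b(1-3) xy(1) by (simp add: mult.commute)
      ultimately show ?thesis by blast
    next
      fix k assume k: "x = k * coeff P1 2" "y = k * coeff P2 2" "1 = k * coeff P3 2"
      then have "k \<noteq> 0" by auto
      then have "coeff P3 2 = 1 / k" using k(3) by (metis nonzero_eq_divide_eq mult.commute)
      then show ?thesis using k \<open>k \<noteq> 0\<close> xy(1) by (simp add: mult.commute)
    qed
  qed
  then have "card (rational_points q (zeros s)) \<le> card (insert (coeff P1 2 / coeff P3 2, coeff P2 2 / coeff P3 2) (?pt ` ?F))"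
    using fin by (intro card_mono) auto
  also have "\<dots> \<le> Suc (card (?pt ` ?F))" using fin by (intro card_insert_le_m1) auto
  also have "card (?pt ` ?F) \<le> card ?F" using fin by (rule card_image_le)
  finally show ?thesis using card_fixed by simp
qed

text \<open>The point at infinity of the parameter line is counted exactly if the coefficient of top formal
  degree does not vanish.\<close>

lemma conic_lower:
  fixes s f :: "'a laurent"
  assumes chart: "conic_chart q C P1 P2 P3 \<beta> \<tau>"
    and scale: "\<And>c x y z. (x, y, z) \<in> C \<Longrightarrow> (c * x, c * y, c * z) \<in> C"
    and s: "\<And>x y. (x, y) \<in> zeros s \<longleftrightarrow> x \<noteq> 0 \<and> y \<noteq> 0 \<and> (x, y, 1) \<in> C" "zeros s \<noteq> {}"
    and f: "\<not> zeros s \<subseteq> zeros f"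
    and bounds: "\<And>m. m \<in> Poly_Mapping.keys f \<Longrightarrow> u \<le> fst m \<and> v \<le> snd m \<and> fst m + snd m \<le> w"
    and uvw: "u + v \<le> w"
  shows "int q \<le> int (card (rational_points q (zeros s - zeros f))) + 2 * (w - u - v) + 5"
proof -
  let ?F = "{x :: 'a. x ^ q = x}" and ?pt = "\<lambda>t. (poly P1 t / poly P3 t, poly P2 t / poly P3 t)"
  have fin: "finite ?F" using card_nonzero_fixed(2)[OF card_fixed q_pos] .
  have onto: "chart_onto C P1 P2 P3 \<beta> \<tau>" using chart by (simp only: conic_chart_def)
  have deg: "degree P1 \<le> 2" "degree P2 \<le> 2" "degree P3 \<le> 2"
    using chart unfolding conic_chart_def by - (elim conjE, assumption)+
  have fixP: "\<forall>t. t ^ q = t \<longrightarrow> poly P1 t ^ q = poly P1 t \<and> poly P2 t ^ q = poly P2 t \<and> poly P3 t ^ q = poly P3 t"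
    and fixc: "coeff P1 2 ^ q = coeff P1 2" "coeff P2 2 ^ q = coeff P2 2" "coeff P3 2 ^ q = coeff P3 2"
    and CP: "\<forall>t. (poly P1 t, poly P2 t, poly P3 t) \<in> C" and Cc: "(coeff P1 2, coeff P2 2, coeff P3 2) \<in> C"
    and lin: "\<forall>c x y z. \<beta> (c * x) (c * y) (c * z) = c * \<beta> x y z \<and> \<tau> (c * x) (c * y) (c * z) = c * \<tau> x y z"
    and bt: "\<forall>t. \<beta> (poly P1 t) (poly P2 t) (poly P3 t) = 1 \<and> \<tau> (poly P1 t) (poly P2 t) (poly P3 t) = t"
    and b0: "\<beta> (coeff P1 2) (coeff P2 2) (coeff P3 2) = 0"
    using chart unfolding conic_chart_def by - (elim conjE, assumption)+
  define H where "H = homogenize_poly f u v w P1 P2 P3"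
  define n where "n = 2 * nat (w - u - v)"
  have H: "degree H \<le> n" "coeff H n = homogenize f u v w (coeff P1 2) (coeff P2 2) (coeff P3 2)"
    unfolding H_def n_def by (rule homogenize_poly_top[OF bounds deg]; assumption)+
  have Ht: "poly H t = homogenize f u v w (poly P1 t) (poly P2 t) (poly P3 t)" for t
    by (simp add: H_def poly_homogenize_poly)
  \<comment> \<open>The factors \<open>P1 * P2 * P3\<close> detect parameters of points outside the
    torus, and \<open>H\<close> those of common points with \<open>f\<close>. The formal degree
    \<open>6 + n\<close> is set against \<open>q + 1\<close> parameters including infinity.\<close>
  define R where "R = P1 * P2 * P3 * H"
  define N where "N = 2 + 2 + 2 + n"
  have degR: "degree R \<le> N" unfolding R_def N_def by (intro degree_mult_top deg H)
  have topR: "coeff R N = coeff P1 2 * coeff P2 2 * coeff P3 2 * coeff H n"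
    unfolding R_def N_def by (subst coeff_mult_top, (intro degree_mult_top deg H)+)+ simp
  have pts: "(\<exists>t. poly P1 t \<noteq> 0 \<and> poly P2 t \<noteq> 0 \<and> poly P3 t \<noteq> 0 \<and> (x, y) = ?pt t) \<or>
      (coeff P1 2 \<noteq> 0 \<and> coeff P2 2 \<noteq> 0 \<and> coeff P3 2 \<noteq> 0 \<and> (x, y) = (coeff P1 2 / coeff P3 2, coeff P2 2 / coeff P3 2))"
    if "(x, y) \<in> zeros s" for x y
  proof -
    have xy: "x \<noteq> 0" "y \<noteq> 0" "(x, y, 1) \<in> C" using that s(1) by auto
    let ?b = "\<beta> x y 1" and ?t = "\<tau> x y 1"
    have "(?b \<noteq> 0 \<and> x = ?b * poly P1 (?t / ?b) \<and> y = ?b * poly P2 (?t / ?b) \<and> 1 = ?b * poly P3 (?t / ?b)) \<or>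
        (\<exists>k. x = k * coeff P1 2 \<and> y = k * coeff P2 2 \<and> 1 = k * coeff P3 2)"
      using onto xy(3) unfolding chart_onto_def by blast
    then show ?thesis
    proof (elim disjE conjE exE)
      assume b: "?b \<noteq> 0" "x = ?b * poly P1 (?t / ?b)" "y = ?b * poly P2 (?t / ?b)" "1 = ?b * poly P3 (?t / ?b)"
      have "poly P3 (?t / ?b) = 1 / ?b" using b(1,4) by (metis nonzero_eq_divide_eq mult.commute)
      then have "(x, y) = ?pt (?t / ?b)" "poly P3 (?t / ?b) \<noteq> 0" using b(1-3) by (simp_all add: mult.commute)
      moreover have "poly P1 (?t / ?b) \<noteq> 0" "poly P2 (?t / ?b) \<noteq> 0" using b(2,3) xy by (metis mult_zero_right)+
      ultimately show ?thesis by blast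
    next
      fix k assume k: "x = k * coeff P1 2" "y = k * coeff P2 2" "1 = k * coeff P3 2"
      then have "k \<noteq> 0" by auto
      then have "coeff P3 2 = 1 / k" using k(3) by (metis nonzero_eq_divide_eq mult.commute)
      then show ?thesis using k \<open>k \<noteq> 0\<close> xy by (auto simp: mult.commute)
    qed
  qed
  have R0: "R \<noteq> 0"
  proof -
    obtain x y where "(x, y) \<in> zeros s" using s(2) by auto
    from pts[OF this] have "P1 \<noteq> 0 \<and> P2 \<noteq> 0 \<and> P3 \<noteq> 0" by (metis coeff_0 poly_0)
    moreover have "H \<noteq> 0"
    proof
      assume H0: "H = 0"
      have "(x, y) \<in> zeros f" if "(x, y) \<in> zeros s" for x y
        using pts[OF that]
      proof (elim disjE exE conjE)
        fix t assume nz: "poly P1 t \<noteq> 0" "poly P2 t \<noteq> 0" "poly P3 t \<noteq> 0" and xy: "(x, y) = ?pt t"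
        have "homogenize f u v w (poly P1 t) (poly P2 t) (poly P3 t) = 0" using Ht[of t] H0 by simp
        then show ?thesis unfolding xy using mem_zeros_homogenize[OF bounds nz] by blast
      next
        assume nz: "coeff P1 2 \<noteq> 0" "coeff P2 2 \<noteq> 0" "coeff P3 2 \<noteq> 0"
          and xy: "(x, y) = (coeff P1 2 / coeff P3 2, coeff P2 2 / coeff P3 2)"
        have "homogenize f u v w (coeff P1 2) (coeff P2 2) (coeff P3 2) = 0" using H(2) H0 by simp
        then show ?thesis unfolding xy using mem_zeros_homogenize[OF bounds nz] by blast
      qed
      then show False using f by auto
    qed
    ultimately show ?thesis by (simp add: R_def)
  qed
  let ?S = "rational_points q (zeros s - zeros f)"
  let ?G = "{t \<in> ?F. poly R t \<noteq> 0}"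
  have finS: "finite ?S" using finite_rational_points[OF card_fixed q_pos] .
  have in_S: "(x / z, y / z) \<in> ?S"
    if "x ^ q = x" "y ^ q = y" "z ^ q = z" "x \<noteq> 0" "y \<noteq> 0" "z \<noteq> 0" "(x, y, z) \<in> C" "homogenize f u v w x y z \<noteq> 0"
    for x y z
  proof -
    have "(1 / z * x, 1 / z * y, 1 / z * z) \<in> C" using scale that(7) by blast
    then have "(x / z, y / z, 1) \<in> C" using that(6) by simp
    then have "(x / z, y / z) \<in> zeros s" using that s(1) by simp
    moreover have "(x / z, y / z) \<notin> zeros f" using mem_zeros_homogenize[OF bounds that(4-6)] that(8) by blast
    ultimately show ?thesis using that by (simp add: rational_points_def power_divide)
  qed
  have sub: "?pt ` ?G \<subseteq> ?S"
  proof
    fix p assume "p \<in> ?pt ` ?G"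
    then obtain t where t: "p = ?pt t" "t ^ q = t" "poly R t \<noteq> 0" by blast
    have nz: "poly P1 t \<noteq> 0" "poly P2 t \<noteq> 0" "poly P3 t \<noteq> 0" "homogenize f u v w (poly P1 t) (poly P2 t) (poly P3 t) \<noteq> 0"
      using t(3) Ht[of t] by (auto simp: R_def)
    show "p \<in> ?S" unfolding t(1) using fixP t(2) CP nz by (intro in_S) auto
  qed
  have bpt: "\<beta> (poly P1 t / poly P3 t) (poly P2 t / poly P3 t) 1 = 1 / poly P3 t \<and>
      \<tau> (poly P1 t / poly P3 t) (poly P2 t / poly P3 t) 1 = t / poly P3 t" if "poly P3 t \<noteq> 0" for t
  proof -
    have "\<beta> (1 / poly P3 t * poly P1 t) (1 / poly P3 t * poly P2 t) (1 / poly P3 t * poly P3 t) = 1 / poly P3 t * 1"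
      "\<tau> (1 / poly P3 t * poly P1 t) (1 / poly P3 t * poly P2 t) (1 / poly P3 t * poly P3 t) = 1 / poly P3 t * t"
      by (simp_all only: lin bt)
    then show ?thesis using that by simp
  qed
  have inj: "inj_on ?pt ?G"
  proof (rule inj_onI)
    fix t t' assume tt: "t \<in> ?G" "t' \<in> ?G" "?pt t = ?pt t'"
    then have nz: "poly P3 t \<noteq> 0" "poly P3 t' \<noteq> 0" by (auto simp: R_def)
    have "1 / poly P3 t = 1 / poly P3 t'" "t / poly P3 t = t' / poly P3 t'"
      using bpt[OF nz(1)] bpt[OF nz(2)] tt(3) by auto
    then show "t = t'" using nz by simp
  qed
  have cardF: "card ?F \<le> card ?G + degree R" by (rule card_nonroots[OF R0 fin])
  show ?thesis
  proof (cases "coeff R N = 0")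
    case True
    have "card (?pt ` ?G) \<le> card ?S" using finS sub by (rule card_mono)
    moreover have "card (?pt ` ?G) = card ?G" using inj by (rule card_image)
    moreover have "degree R < N"
    proof -
      have "degree R \<noteq> N" using True R0 by auto
      then show ?thesis using degR by simp
    qed
    ultimately show ?thesis using cardF card_fixed uvw by (simp add: N_def n_def)
  next
    case False
    let ?i = "(coeff P1 2 / coeff P3 2, coeff P2 2 / coeff P3 2)"
    have nz: "coeff P1 2 \<noteq> 0" "coeff P2 2 \<noteq> 0" "coeff P3 2 \<noteq> 0"
      "homogenize f u v w (coeff P1 2) (coeff P2 2) (coeff P3 2) \<noteq> 0"
      using False unfolding topR H(2) by auto
    have "?i \<in> ?S" using fixc Cc nz by (intro in_S) auto
    \<comment> \<open>At the point at infinity \<open>\<beta>\<close> is 0, at the finite ones it is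
      not, so no point is counted twice.\<close>
    moreover have "?i \<notin> ?pt ` ?G"
    proof
      assume "?i \<in> ?pt ` ?G"
      then obtain t where t: "?i = ?pt t" "poly P3 t \<noteq> 0" by (auto simp: R_def)
      have "\<beta> (1 / coeff P3 2 * coeff P1 2) (1 / coeff P3 2 * coeff P2 2) (1 / coeff P3 2 * coeff P3 2) = 1 / coeff P3 2 * 0"
        by (simp only: lin b0)
      then have "\<beta> (coeff P1 2 / coeff P3 2) (coeff P2 2 / coeff P3 2) 1 = 0" using nz by simp
      then show False using bpt[OF t(2)] t by auto
    qed
    moreover have "finite (?pt ` ?G)" using fin by simp
    ultimately have "card (insert ?i (?pt ` ?G)) \<le> card ?S" using sub finS by (intro card_mono) auto
    moreover have "card (insert ?i (?pt ` ?G)) = card ?G + 1"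
      using \<open>?i \<notin> ?pt ` ?G\<close> \<open>finite (?pt ` ?G)\<close> card_image[OF inj] by simp
    ultimately show ?thesis using cardF degR card_fixed uvw by (simp add: N_def n_def)
  qed
qed

end

section \<open>Sums with the double triangle\<close>

definition unit_triangle :: "(real \<times> real) set" where
  "unit_triangle = convex hull (lat ` {(0, 0), (1, 0), (0, 1)})"

lemma lattice_polygon_unit_triangle: "lattice_polygon unit_triangle"
  unfolding lattice_polygon_def unit_triangle_def
  by (intro exI[of _ "{(0, 0), (1, 0), (0, 1)}"]) simp

lemma unit_triangle_corners:
  "(0, 0) \<in> lattice_points unit_triangle" "(1, 0) \<in> lattice_points unit_triangle"
  "(0, 1) \<in> lattice_points unit_triangle"
  unfolding lattice_points_def unit_triangle_def by (auto intro: hull_inc)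

lemma unit_triangle_bounds:
  assumes "(x, y) \<in> unit_triangle"
  shows "0 \<le> x" "0 \<le> y" "x + y \<le> 1"
proof -
  have "unit_triangle \<subseteq> {p. (-1, 0) \<bullet> p \<le> 0} \<inter> {p. (0, -1) \<bullet> p \<le> 0} \<inter> {p. (1, 1) \<bullet> p \<le> 1}"
    unfolding unit_triangle_def
    by (intro hull_minimal convex_Int convex_halfspace_le) (auto simp: lat_def)
  then show "0 \<le> x" "0 \<le> y" "x + y \<le> 1" using assms by auto
qed

lemma lattice_points_unit_triangle: "lattice_points unit_triangle = {(0, 0), (1, 0), (0, 1)}"
proof
  show "lattice_points unit_triangle \<subseteq> {(0, 0), (1, 0), (0, 1)}"
  proof
    fix m assume "m \<in> lattice_points unit_triangle"
    then have "(real_of_int (fst m), real_of_int (snd m)) \<in> unit_triangle"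
      by (simp add: lattice_points_def lat_def)
    from unit_triangle_bounds[OF this] have "0 \<le> fst m" "0 \<le> snd m" "fst m + snd m \<le> 1" by linarith+
    then have "fst m = 0 \<and> snd m = 0 \<or> fst m = 1 \<and> snd m = 0 \<or> fst m = 0 \<and> snd m = 1" by linarith
    then show "m \<in> {(0, 0), (1, 0), (0, 1)}" by (cases m) auto
  qed
qed (use unit_triangle_corners in auto)

text \<open>The sum \<open>x + y\<close> is the midpoint of \<open>2 x\<close> and
  \<open>2 y\<close>, and \<open>x\<close> is the midpoint of \<open>2 x\<close> and the
  origin.\<close>

lemma double_triangle_supset:
  assumes T: "lattice_polygon T" and "double_triangle (lattice_points T)"
  shows "unit_triangle + unit_triangle \<subseteq> T" "unit_triangle \<subseteq> T"
proof -
  have conv: "convex T" using lattice_polygon_convex[OF T] .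
  have c: "(0, 0) \<in> T" "(2, 0) \<in> T" "(0, 2) \<in> T"
    using assms(2) by (auto simp: double_triangle_def lattice_points_def lat_def)
  have "convex hull {(0, 0), (2, 0), (0, 2)} \<subseteq> T" using c conv by (intro hull_minimal) auto
  moreover have "(*\<^sub>R) 2 ` unit_triangle = convex hull {(0, 0), (2, 0), (0, 2)}"
    unfolding unit_triangle_def by (subst convex_hull_scaling[symmetric]) (simp add: lat_def)
  ultimately have double: "2 *\<^sub>R x \<in> T" if "x \<in> unit_triangle" for x using that by blast
  have half: "(1 / 2) *\<^sub>R x + (1 / 2) *\<^sub>R y \<in> T" if "x \<in> T" "y \<in> T" for x y
    using convexD[OF conv that, of "1 / 2" "1 / 2"] by simp
  show "unit_triangle + unit_triangle \<subseteq> T"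
  proof
    fix z assume "z \<in> unit_triangle + unit_triangle"
    then obtain x y where xy: "x \<in> unit_triangle" "y \<in> unit_triangle" "z = x + y" by (elim set_plus_elim) blast
    then show "z \<in> T" using half[OF double[OF xy(1)] double[OF xy(2)]] by simp
  qed
  show "unit_triangle \<subseteq> T"
  proof
    fix x assume "x \<in> unit_triangle"
    then have "(1 / 2) *\<^sub>R (2 *\<^sub>R x) + (1 / 2) *\<^sub>R (0, 0) \<in> T" using half double c(1) by blast
    then show "x \<in> T" by (simp flip: zero_prod_def)
  qed
qed

lemma card_lattice_points_mono:
  assumes "lattice_polygon Q" "P \<subseteq> Q"
  shows "card (lattice_points P) \<le> card (lattice_points Q)"
  using lattice_polygon_finite[OF assms(1)] assms(2)
  by (intro card_mono) (auto simp: lattice_points_def)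

text \<open>The unit triangle is a strip with row ends \<open>0, 1\<close> below and the single
  point \<open>(0, 1)\<close> above. For extreme \<open>p\<close>, \<open>m\<close> and
  \<open>k\<close> the main term is the size of the smallest homothetic copy of the unit triangle
  around \<open>Q\<close>.\<close>

lemma card_lattice_points_plus_unit_triangle:
  assumes Q: "lattice_polygon Q"
    and p: "p \<in> lattice_points Q" "\<And>m. m \<in> lattice_points Q \<Longrightarrow> snd p \<le> snd m"
    and m: "m \<in> lattice_points Q" and k: "k \<in> lattice_points Q"
  shows "int (card (lattice_points Q)) + (fst m + snd m) - snd p - fst k + 2
    \<le> int (card (lattice_points (Q + unit_triangle)))"
proof -
  obtain p1 where p1: "p1 \<in> lattice_points Q" "\<And>n. n \<in> lattice_points Q \<Longrightarrow> snd n \<le> snd p1"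
    using finite_attains_max[OF lattice_polygon_finite[OF Q] lattice_polygon_nonempty[OF Q], where w = snd] by blast
  have e: "(fst p, snd p) \<in> lattice_points Q" "(fst p1, snd p1) \<in> lattice_points Q"
    "(fst m, snd m) \<in> lattice_points Q" "(fst k, snd k) \<in> lattice_points Q"
    using p p1 m k by simp_all
  have rows: "snd p \<le> y \<and> y \<le> snd p1" if "(x, y) \<in> lattice_points Q" for x y
    using p(2)[OF that] p1(2)[OF that] by simp
  have "int (card (lattice_points Q)) + (fst m + (snd m - snd p) * 1 + (snd p1 - snd m) * 0) -
      (fst k + (snd k - snd p) * 0 + (snd p1 - snd k) * 0) + (1 - 0) + (0 - 0) + 1
    \<le> int (card (lattice_points (Q + unit_triangle)))"
    by (rule card_lattice_points_plus_strip[OF Q lattice_polygon_unit_triangle unit_triangle_corners(1,2,3,3) _ e(1,2,3,4)])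
      (rule rows)
  then show ?thesis by simp
qed

text \<open>The unit triangle is added twice. With \<open>D = fst m + snd m - snd p - fst k\<close>
  the first sum gains \<open>D + 2\<close>, the second \<open>D + 3\<close>, since
  \<open>m + (1, 0)\<close> increases the size by 1. The total \<open>2 D + 5\<close> is the error
  term of the estimate for conics.\<close>

lemma card_lattice_points_plus_double_triangle:
  assumes Q: "lattice_polygon Q" and T: "lattice_polygon T" "double_triangle (lattice_points T)"
    and p: "p \<in> lattice_points Q" "\<And>m. m \<in> lattice_points Q \<Longrightarrow> snd p \<le> snd m"
    and m: "m \<in> lattice_points Q" and k: "k \<in> lattice_points Q"
  shows "int (card (lattice_points Q)) + 2 * (fst m + snd m - snd p - fst k) + 5
    \<le> int (card (lattice_points (Q + T)))"
proof -
  let ?Q = "Q + unit_triangle"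
  have Q': "lattice_polygon ?Q" by (intro lattice_polygon_plus Q lattice_polygon_unit_triangle)
  have 0: "n \<in> lattice_points ?Q" if "n \<in> lattice_points Q" for n
    using lattice_points_plus[OF that unit_triangle_corners(1)] by (simp flip: zero_prod_def)
  have 1: "m + (1, 0) \<in> lattice_points ?Q" using lattice_points_plus[OF m unit_triangle_corners(2)] .
  \<comment> \<open>The lowest row of \<open>Q\<close> remains the lowest one, as the unit triangle
    has no point below the first axis.\<close>
  have low: "snd p \<le> snd n" if "n \<in> lattice_points ?Q" for n
  proof -
    have "lat n \<in> ?Q" using that by (simp add: lattice_points_def)
    then obtain x y where xy: "x \<in> Q" "y \<in> unit_triangle" "lat n = x + y" by (elim set_plus_elim) blast
    have "(0, -1) \<bullet> x \<le> - real_of_int (snd p)"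
      by (rule lattice_polygon_bound[OF Q xy(1)]) (use p(2) in \<open>simp add: lat_def\<close>)
    moreover have "0 \<le> snd y" using unit_triangle_bounds(2)[of "fst y" "snd y"] xy(2) by simp
    moreover have "real_of_int (snd n) = snd x + snd y" using arg_cong[OF xy(3), of snd] by (simp add: lat_def)
    moreover have "(0, -1) \<bullet> x = - snd x" by (cases x) simp
    ultimately show ?thesis by linarith
  qed
  have "int (card (lattice_points ?Q)) + (fst (m + (1, 0)) + snd (m + (1, 0))) - snd p - fst k + 2
      \<le> int (card (lattice_points (?Q + unit_triangle)))"
    by (rule card_lattice_points_plus_unit_triangle[OF Q' 0[OF p(1)] low 1 0[OF k]])
  moreover have "int (card (lattice_points Q)) + (fst m + snd m) - snd p - fst k + 2 \<le> int (card (lattice_points ?Q))"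
    by (rule card_lattice_points_plus_unit_triangle[OF Q p m k])
  moreover have "card (lattice_points (?Q + unit_triangle)) \<le> card (lattice_points (Q + T))"
  proof (rule card_lattice_points_mono[OF lattice_polygon_plus[OF Q T(1)]])
    have "?Q + unit_triangle = Q + (unit_triangle + unit_triangle)" by (simp add: add.assoc)
    then show "?Q + unit_triangle \<subseteq> Q + T" using double_triangle_supset(1)[OF T] by (metis order_refl set_plus_mono2)
  qed
  ultimately show ?thesis by simp
qed

definition line_laurent :: "'a::field \<Rightarrow> 'a \<Rightarrow> 'a \<Rightarrow> 'a laurent" where
  "line_laurent a b c = Poly_Mapping.single (1, 0) a + Poly_Mapping.single (0, 1) b + Poly_Mapping.single (0, 0) c"

lemma laurent_eval_line: "laurent_eval (line_laurent a b c) (x, y) = a * x + b * y + c"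
  by (simp add: line_laurent_def laurent_eval_add torus_char_def)

lemma keys_line_laurent: "Poly_Mapping.keys (line_laurent a b c) \<subseteq> {(0, 0), (1, 0), (0, 1)}"
proof -
  have "Poly_Mapping.keys (line_laurent a b c) \<subseteq>
      (Poly_Mapping.keys (Poly_Mapping.single (1, 0) a) \<union> Poly_Mapping.keys (Poly_Mapping.single (0, 1) b)) \<union>
      Poly_Mapping.keys (Poly_Mapping.single (0, 0) c)"
    unfolding line_laurent_def using keys_add by (meson order_refl subset_trans Un_mono)
  then show ?thesis by (auto split: if_splits)
qed

lemma double_triangle_subset:
  assumes "double_triangle S"
  shows "S \<subseteq> {(2, 0), (1, 1), (0, 2), (1, 0), (0, 1), (0, 0)}"
proof
  fix m assume "m \<in> S"
  then have "0 \<le> fst m" "0 \<le> snd m" "fst m + snd m \<le> 2" using assms by (auto simp: double_triangle_def)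
  moreover from this have "fst m = 0 \<or> fst m = 1 \<or> fst m = 2" "snd m = 0 \<or> snd m = 1 \<or> snd m = 2"
    by linarith+
  ultimately show "m \<in> {(2, 0), (1, 1), (0, 2), (1, 0), (0, 1), (0, 0)}" by (cases m) auto
qed

lemma laurent_eval_double_triangle:
  assumes "Poly_Mapping.keys s \<subseteq> S" "double_triangle S"
  shows "laurent_eval s (x, y) = ternary_form (Poly_Mapping.lookup s (2, 0)) (Poly_Mapping.lookup s (1, 1))
    (Poly_Mapping.lookup s (0, 2)) (Poly_Mapping.lookup s (1, 0)) (Poly_Mapping.lookup s (0, 1))
    (Poly_Mapping.lookup s (0, 0)) x y 1"
proof -
  let ?S = "{(2, 0), (1, 1), (0, 2), (1, 0), (0, 1), (0, 0)} :: (int \<times> int) set"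
  have "Poly_Mapping.keys s \<subseteq> ?S" using assms double_triangle_subset by blast
  then have "laurent_eval s (x, y) = (\<Sum>m\<in>?S. Poly_Mapping.lookup s m * torus_char (x, y) m)"
    by (intro laurent_eval_superset) auto
  then show ?thesis by (simp add: torus_char_def ternary_form_def power2_eq_square algebra_simps)
qed

context frobenius_fixed begin

lemma frob_sum: "(\<Sum>i\<in>I. h i :: 'a) ^ q = (\<Sum>i\<in>I. h i ^ q)"
  by (induction I rule: infinite_finite_induct) (use q_pos in \<open>auto simp: frob_add\<close>)

lemma torus_char_frob: "torus_char (x ^ q, y ^ q) m = torus_char (x, y :: 'a) m ^ q"
  by (simp add: torus_char_def power_mult_distrib power_int_power power_int_power' mult.commute)

lemma frobenius_stable_zeros:
  assumes "\<And>m. fixed (Poly_Mapping.lookup s m)"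
  shows "frobenius_stable q (zeros s)"
proof -
  have "laurent_eval s (x ^ q, y ^ q) = laurent_eval s (x, y) ^ q" for x y
    unfolding laurent_eval_def frob_sum torus_char_frob
    using assms by (simp add: power_mult_distrib fixed_def)
  then show ?thesis using q_pos by (auto simp: frobenius_stable_def zeros_def)
qed

text \<open>The growth estimate for one component \<open>Z\<close> with polygon \<open>T\<close>,
  uniform in the data \<open>Q\<close> and \<open>f\<close> of the earlier components. It is written
  without subtraction because it concerns natural numbers.\<close>

definition step_bound :: "(real \<times> real) set \<Rightarrow> ('a \<times> 'a) set \<Rightarrow> bool" where
  "step_bound T Z \<longleftrightarrow> (\<forall>Q f. lattice_polygon Q \<longrightarrow> Poly_Mapping.keys f \<subseteq> lattice_points Q \<longrightarrow>
     \<not> Z \<subseteq> zeros f \<longrightarrow>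
     q + card (lattice_points Q) \<le> card (rational_points q (Z - zeros f)) + card (lattice_points (Q + T)))"

lemma strip_bounds:
  assumes T: "lattice_polygon T" "unit_strip (lattice_points T)"
    and s: "Poly_Mapping.keys s \<subseteq> lattice_points T" "s \<noteq> 0"
    and irr: "irreducible_zeros (zeros s)" and frob: "frobenius_stable q (zeros s)"
  shows "step_bound T (zeros s)" "card (rational_points q (zeros s)) \<le> q"
  using strip_step[OF T s irr frob card_fixed q_pos]
    strip_upper[OF lattice_polygon_finite[OF T(1)] T(2) s irr card_fixed q_pos]
  by (auto simp: step_bound_def)

text \<open>If the conic splits, irreducibility makes the curve one of two lines, and a line has its
  polygon in the unit triangle, which is a strip contained in \<open>T\<close>. Otherwise the
  parametrisation applies, with the smallest triangle around \<open>Q\<close> providing the degree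
  of the homogenisation.\<close>

lemma conic_bounds:
  assumes T: "lattice_polygon T" "double_triangle (lattice_points T)"
    and s: "Poly_Mapping.keys s \<subseteq> lattice_points T" "s \<noteq> 0"
    and irr: "irreducible_zeros (zeros s)" and fixed: "\<And>m. fixed (Poly_Mapping.lookup s m)"
    and point: "\<And>a b c d e g. fixed a \<Longrightarrow> fixed b \<Longrightarrow> fixed c \<Longrightarrow> fixed d \<Longrightarrow> fixed e \<Longrightarrow> fixed g \<Longrightarrow>
      \<exists>u v w. fixed u \<and> fixed v \<and> fixed w \<and> (u, v, w) \<noteq> (0, 0, 0) \<and> ternary_form a b c d e g u v w = 0"
  shows "step_bound T (zeros s)" "card (rational_points q (zeros s)) \<le> q + 1"
proof -
  define a b c d e g where coeffs: "a = Poly_Mapping.lookup s (2, 0)" "b = Poly_Mapping.lookup s (1, 1)"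
    "c = Poly_Mapping.lookup s (0, 2)" "d = Poly_Mapping.lookup s (1, 0)" "e = Poly_Mapping.lookup s (0, 1)"
    "g = Poly_Mapping.lookup s (0, 0)"
  have fx: "fixed a" "fixed b" "fixed c" "fixed d" "fixed e" "fixed g" using fixed by (simp_all add: coeffs)
  define C where "C = {(x, y, z). ternary_form a b c d e g x y z = 0}"
  have eval: "laurent_eval s (x, y) = ternary_form a b c d e g x y 1" for x y
    using laurent_eval_double_triangle[OF s(1) T(2)] by (simp add: coeffs)
  have zs: "(x, y) \<in> zeros s \<longleftrightarrow> x \<noteq> 0 \<and> y \<noteq> 0 \<and> (x, y, 1) \<in> C" for x y
    by (auto simp: zeros_def eval C_def)
  have frob: "frobenius_stable q (zeros s)" using frobenius_stable_zeros fixed by blast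
  obtain u v w where uvw: "fixed u" "fixed v" "fixed w" "(u, v, w) \<noteq> (0, 0, 0)" "ternary_form a b c d e g u v w = 0"
    using point[OF fx] by blast
  have "split_or_chart q C"
    unfolding C_def by (rule conic_split_or_chart[OF fx uvw(1-3) uvw(5,4)])
  then consider "splits C" | "\<exists>P1 P2 P3 \<beta> \<tau>. conic_chart q C P1 P2 P3 \<beta> \<tau>"
    unfolding split_or_chart_def by blast
  then have "step_bound T (zeros s) \<and> card (rational_points q (zeros s)) \<le> q + 1"
  proof cases
    case 1
    then obtain l1 l2 l3 n1 n2 n3 where ln: "C =
        {(x, y, z). (l1 * x + l2 * y + l3 * z) * (n1 * x + n2 * y + n3 * z) = 0}"
      unfolding splits_def by blast
    have zs2: "zeros s = zeros (line_laurent l1 l2 l3) \<union> zeros (line_laurent n1 n2 n3)"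
    proof -
      have "(x, y) \<in> zeros s \<longleftrightarrow> (x, y) \<in> zeros (line_laurent l1 l2 l3) \<union> zeros (line_laurent n1 n2 n3)" for x y
      proof -
        have "(x, y, 1) \<in> C \<longleftrightarrow> l1 * x + l2 * y + l3 = 0 \<or> n1 * x + n2 * y + n3 = 0" by (simp add: ln)
        then show ?thesis unfolding zs by (auto simp: zeros_def laurent_eval_line)
      qed
      then show ?thesis by auto
    qed
    \<comment> \<open>The alternative \<open>C = UNIV\<close> covers a vanishing linear form: it
      makes the whole ternary form vanish, and its values at six points then force
      \<open>s = 0\<close>.\<close>
    have main: ?thesis if eq: "zeros s = zeros (line_laurent k1 k2 k3)"
      and k: "C = UNIV \<or> (k1, k2, k3) \<noteq> (0, 0, 0)" for k1 k2 k3
    proof -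
      have ne: "line_laurent k1 k2 k3 \<noteq> 0"
      proof
        assume 0: "line_laurent k1 k2 k3 = 0"
        have "C = UNIV"
        proof (rule ccontr)
          assume "C \<noteq> UNIV"
          then have "(k1, k2, k3) \<noteq> (0, 0, 0)" using k by blast
          moreover have "k1 = Poly_Mapping.lookup (line_laurent k1 k2 k3) (1, 0)"
            "k2 = Poly_Mapping.lookup (line_laurent k1 k2 k3) (0, 1)"
            "k3 = Poly_Mapping.lookup (line_laurent k1 k2 k3) (0, 0)"
            by (simp_all add: line_laurent_def lookup_add lookup_single)
          ultimately show False unfolding 0 by simp
        qed
        then have C: "ternary_form a b c d e g x y z = 0" for x y z
        proof -
          have "(x, y, z) \<in> C" using \<open>C = UNIV\<close> by simp
          then show ?thesis by (simp only: C_def mem_Collect_eq prod.case)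
        qed
        have "a = 0" "c = 0" "g = 0" using C[of 1 0 0] C[of 0 1 0] C[of 0 0 1] by (simp_all add: ternary_form_def)
        moreover have "b = 0" "d = 0" "e = 0"
          using C[of 1 1 0] C[of 1 0 1] C[of 0 1 1] calculation by (simp_all add: ternary_form_def)
        ultimately have z: "Poly_Mapping.lookup s m = 0" if "m \<in> {(2, 0), (1, 1), (0, 2), (1, 0), (0, 1), (0, 0)}" for m
          using that by (auto simp: coeffs)
        have "s = 0"
        proof (rule poly_mapping_eqI)
          fix m
          show "Poly_Mapping.lookup s m = Poly_Mapping.lookup 0 m"
          proof (cases "m \<in> Poly_Mapping.keys s")
            case True
            then have "m \<in> {(2, 0), (1, 1), (0, 2), (1, 0), (0, 1), (0, 0)}"
              using s(1) double_triangle_subset[OF T(2)] by blast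
            then show ?thesis using z by simp
          qed (simp add: in_keys_iff)
        qed
        then show False using s(2) by simp
      qed
      have keys: "Poly_Mapping.keys (line_laurent k1 k2 k3) \<subseteq> lattice_points unit_triangle"
        using keys_line_laurent by (simp add: lattice_points_unit_triangle)
      have strip: "unit_strip (lattice_points unit_triangle)"
        by (simp add: lattice_points_unit_triangle unit_strip_def)
      \<comment> \<open>The coefficients of the line need not be rational; the strip case asks for
        Frobenius stability of the zero set, and that set is \<open>zeros s\<close>.\<close>
      note b = strip_bounds[OF lattice_polygon_unit_triangle strip keys ne, folded eq, OF irr frob]
      have "step_bound T (zeros s)"
        unfolding step_bound_def
      proof (intro allI impI)
        fix Q and f :: "'a laurent"
        assume Q: "lattice_polygon Q" "Poly_Mapping.keys f \<subseteq> lattice_points Q" "\<not> zeros s \<subseteq> zeros f"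
        have "Q + unit_triangle \<subseteq> Q + T" using double_triangle_supset(2)[OF T] by (intro set_plus_mono2) auto
        then have "card (lattice_points (Q + unit_triangle)) \<le> card (lattice_points (Q + T))"
          by (rule card_lattice_points_mono[OF lattice_polygon_plus[OF Q(1) T(1)]])
        then show "q + card (lattice_points Q) \<le> card (rational_points q (zeros s - zeros f)) + card (lattice_points (Q + T))"
          using b(1) Q unfolding step_bound_def by (meson add_le_mono dual_order.trans le_refl)
      qed
      then show ?thesis using b(2) by simp
    qed
    have nz: "C = UNIV \<or> (l1, l2, l3) \<noteq> (0, 0, 0)" "C = UNIV \<or> (n1, n2, n3) \<noteq> (0, 0, 0)" by (auto simp: ln)
    have "zeros s \<subseteq> zeros (line_laurent l1 l2 l3) \<or> zeros s \<subseteq> zeros (line_laurent n1 n2 n3)"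
      using irreducible_zerosD[OF irr] zs2 by blast
    then have "zeros s = zeros (line_laurent l1 l2 l3) \<or> zeros s = zeros (line_laurent n1 n2 n3)" using zs2 by blast
    then show ?thesis using main nz by blast
  next
    case 2
    then obtain P1 P2 P3 \<beta> \<tau> where chart: "conic_chart q C P1 P2 P3 \<beta> \<tau>" by blast
    have "step_bound T (zeros s)"
      unfolding step_bound_def
    proof (intro allI impI)
      fix Q and f :: "'a laurent"
      assume Q: "lattice_polygon Q" "Poly_Mapping.keys f \<subseteq> lattice_points Q" "\<not> zeros s \<subseteq> zeros f"
      note finQ = lattice_polygon_finite[OF Q(1)] lattice_polygon_nonempty[OF Q(1)]
      obtain p where p: "p \<in> lattice_points Q" "\<And>n. n \<in> lattice_points Q \<Longrightarrow> - snd n \<le> - snd p"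
        using finite_attains_max[OF finQ, where w = "\<lambda>n. - snd n"] by blast
      obtain k where k: "k \<in> lattice_points Q" "\<And>n. n \<in> lattice_points Q \<Longrightarrow> - fst n \<le> - fst k"
        using finite_attains_max[OF finQ, where w = "\<lambda>n. - fst n"] by blast
      obtain m where m: "m \<in> lattice_points Q" "\<And>n. n \<in> lattice_points Q \<Longrightarrow> fst n + snd n \<le> fst m + snd m"
        using finite_attains_max[OF finQ, where w = "\<lambda>n. fst n + snd n"] by blast
      have bounds: "fst k \<le> fst n \<and> snd p \<le> snd n \<and> fst n + snd n \<le> fst m + snd m"
        if "n \<in> lattice_points Q" for n using p(2)[OF that] k(2)[OF that] m(2)[OF that] by simp
      have "int q \<le> int (card (rational_points q (zeros s - zeros f))) + 2 * (fst m + snd m - fst k - snd p) + 5"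
      proof (rule conic_lower[OF chart _ zs _ Q(3)])
        show "(k * x, k * y, k * z) \<in> C" if "(x, y, z) \<in> C" for k x y z
          using that by (simp add: C_def conic_scale)
        show "zeros s \<noteq> {}" using irr by (auto simp: irreducible_zeros_def)
        show "fst k \<le> fst n \<and> snd p \<le> snd n \<and> fst n + snd n \<le> fst m + snd m" if "n \<in> Poly_Mapping.keys f" for n
          using bounds that Q(2) by blast
        show "fst k + snd p \<le> fst m + snd m" using bounds[OF m(1)] by linarith
      qed
      moreover have "int (card (lattice_points Q)) + 2 * (fst m + snd m - snd p - fst k) + 5
          \<le> int (card (lattice_points (Q + T)))"
        by (rule card_lattice_points_plus_double_triangle[OF Q(1) T p(1) _ m(1) k(1)]) (use p(2) in auto)
      ultimately have "int (q + card (lattice_points Q)) \<le>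
          int (card (rational_points q (zeros s - zeros f)) + card (lattice_points (Q + T)))" by simp
      then show "q + card (lattice_points Q) \<le>
          card (rational_points q (zeros s - zeros f)) + card (lattice_points (Q + T))" by (simp only: of_nat_le_iff)
    qed
    moreover have "card (rational_points q (zeros s)) \<le> q + 1"
      by (rule conic_upper[OF chart]) (simp add: zs)
    ultimately show ?thesis by blast
  qed
  then show "step_bound T (zeros s)" "card (rational_points q (zeros s)) \<le> q + 1" by simp_all
qed

end

subsection \<open>Unimodular transformations\<close>

definition real_ext :: "(int \<times> int \<Rightarrow> int \<times> int) \<Rightarrow> real \<times> real \<Rightarrow> real \<times> real" where
  "real_ext g p = fst p *\<^sub>R lat (g (1, 0)) + snd p *\<^sub>R lat (g (0, 1))"

lemma linear_real_ext: "linear (real_ext g)"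
  by (intro linearI) (simp_all add: real_ext_def algebra_simps)

lemma real_ext_lat:
  assumes "unimodular g"
  shows "real_ext g (lat m) = lat (g m)"
  using assms by (auto simp: unimodular_def real_ext_def lat_def algebra_simps)

lemma real_ext_compose:
  assumes "unimodular g" "unimodular h"
  shows "real_ext g (real_ext h p) = real_ext (\<lambda>m. g (h m)) p"
proof -
  have "real_ext g (real_ext h p) = fst p *\<^sub>R real_ext g (lat (h (1, 0))) + snd p *\<^sub>R real_ext g (lat (h (0, 1)))"
    unfolding real_ext_def[of h] by (simp only: linear_add[OF linear_real_ext] linear_scale[OF linear_real_ext])
  also have "\<dots> = real_ext (\<lambda>m. g (h m)) p"
    unfolding real_ext_lat[OF assms(1)] by (simp only: real_ext_def)
  finally show ?thesis .
qed

lemma real_ext_id: "real_ext (\<lambda>m. m) p = p"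
  by (cases p) (simp add: real_ext_def lat_def)

lemma real_ext_inverse:
  assumes "unimodular g" "unimodular h" "\<And>m. g (h m) = m"
  shows "real_ext g (real_ext h p) = p"
  using assms by (simp add: real_ext_compose real_ext_id)

lemma lattice_points_real_ext:
  assumes "unimodular g" "unimodular h" "\<And>m. g (h m) = m" "\<And>m. h (g m) = m"
  shows "lattice_points (real_ext g ` P) = g ` lattice_points P"
proof
  show "g ` lattice_points P \<subseteq> lattice_points (real_ext g ` P)"
    by (auto simp: lattice_points_def simp flip: real_ext_lat[OF assms(1)])
  show "lattice_points (real_ext g ` P) \<subseteq> g ` lattice_points P"
  proof
    fix m assume "m \<in> lattice_points (real_ext g ` P)"
    then obtain p where p: "p \<in> P" "lat m = real_ext g p" by (auto simp: lattice_points_def)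
    have "lat (h m) = p"
      unfolding real_ext_lat[OF assms(2), symmetric] p(2) by (rule real_ext_inverse[OF assms(2,1,4)])
    then have "h m \<in> lattice_points P" using p(1) by (simp add: lattice_points_def)
    then show "m \<in> g ` lattice_points P" using assms(3) by (metis image_eqI)
  qed
qed

lemma lattice_polygon_real_ext:
  assumes "unimodular g" "lattice_polygon P"
  shows "lattice_polygon (real_ext g ` P)"
proof -
  obtain S where S: "finite S" "S \<noteq> {}" "P = convex hull (lat ` S)" using assms(2) by (auto simp: lattice_polygon_def)
  have "real_ext g ` P = convex hull (lat ` (g ` S))"
    unfolding S(3) by (simp add: convex_hull_linear_image[OF linear_real_ext] image_image real_ext_lat[OF assms(1)])
  then show ?thesis using S unfolding lattice_polygon_def by (metis finite_imageI image_is_empty)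
qed

lemma real_ext_plus: "real_ext g ` (P + Q) = real_ext g ` P + real_ext g ` Q"
proof (intro equalityI subsetI)
  fix x assume "x \<in> real_ext g ` (P + Q)"
  then show "x \<in> real_ext g ` P + real_ext g ` Q"
    by (auto simp: linear_add[OF linear_real_ext] elim!: set_plus_elim intro!: set_plus_intro imageI simp del: add_Pair)
next
  fix x assume "x \<in> real_ext g ` P + real_ext g ` Q"
  then obtain y z where "y \<in> P" "z \<in> Q" "x = real_ext g (y + z)"
    by (auto simp: linear_add[OF linear_real_ext] elim!: set_plus_elim simp del: add_Pair)
  then show "x \<in> real_ext g ` (P + Q)" by blast
qed

lemma lattice_points_translate:
  "lattice_points ((+) (lat v) ` P) = (\<lambda>m. m + v) ` lattice_points P"
proof
  show "(\<lambda>m. m + v) ` lattice_points P \<subseteq> lattice_points ((+) (lat v) ` P)"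
    by (auto simp: lattice_points_def lat_add add.commute simp del: add_Pair)
  show "lattice_points ((+) (lat v) ` P) \<subseteq> (\<lambda>m. m + v) ` lattice_points P"
  proof
    fix m assume "m \<in> lattice_points ((+) (lat v) ` P)"
    then obtain p where p: "p \<in> P" "lat m = lat v + p" by (auto simp: lattice_points_def)
    have "lat (m - v) = p" using p(2) by (simp add: lat_def prod_eq_iff)
    then have "m - v \<in> lattice_points P" using p(1) by (simp add: lattice_points_def)
    then show "m \<in> (\<lambda>m. m + v) ` lattice_points P" by (metis diff_add_cancel image_eqI)
  qed
qed

lemma lattice_polygon_translate:
  assumes "lattice_polygon P"
  shows "lattice_polygon ((+) (lat v) ` P)"
proof -
  obtain S where S: "finite S" "S \<noteq> {}" "P = convex hull (lat ` S)" using assms by (auto simp: lattice_polygon_def)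
  have "(+) (lat v) ` P = convex hull (lat ` ((+) v ` S))"
    unfolding S(3) by (simp add: convex_hull_translation[symmetric] image_image lat_add)
  then show ?thesis using S unfolding lattice_polygon_def by (metis finite_imageI image_is_empty)
qed

text \<open>For unimodular \<open>g\<close> the monomial automorphism of the torus along which the
  character \<open>m\<close> is pulled back to the character \<open>g m\<close>.\<close>

definition torus_map :: "(int \<times> int \<Rightarrow> int \<times> int) \<Rightarrow> 'a::field \<times> 'a \<Rightarrow> 'a \<times> 'a" where
  "torus_map g p = (torus_char p (g (1, 0)), torus_char p (g (0, 1)))"

lemma torus_map_in_torus: "p \<in> torus \<Longrightarrow> torus_map g p \<in> torus"
  by (simp add: torus_map_def torus_char_nonzero)

lemma torus_char_torus_map:
  assumes "unimodular g" "p \<in> torus"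
  shows "torus_char (torus_map g p) m = torus_char p (g m)"
proof -
  obtain a b c d where g: "g = (\<lambda>m. (a * fst m + b * snd m, c * fst m + d * snd m))"
    using assms(1) unfolding unimodular_def by blast
  have nz: "fst p \<noteq> 0" "snd p \<noteq> 0" using assms(2) by (auto simp: torus_def)
  show ?thesis
    using nz by (simp add: torus_char_def torus_map_def g power_int_mult_distrib power_int_add
        power_int_mult[symmetric] mult_ac)
qed

lemma torus_map_inverse:
  assumes "unimodular g" "unimodular h" "\<And>m. h (g m) = m" "p \<in> torus"
  shows "torus_map g (torus_map h p) = p"
  using assms
  by (simp add: torus_map_def[of g] torus_char_torus_map[OF assms(2,4)]) (simp add: torus_char_def)

text \<open>For unimodular \<open>g\<close> this is the pullback of \<open>f\<close> along
  \<open>torus_map g\<close>; for a translation \<open>g\<close> it is the product of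
  \<open>f\<close> with a monomial.\<close>

definition transform :: "(int \<times> int \<Rightarrow> int \<times> int) \<Rightarrow> 'a::field laurent \<Rightarrow> 'a laurent" where
  "transform g f = (\<Sum>m\<in>Poly_Mapping.keys f. Poly_Mapping.single (g m) (Poly_Mapping.lookup f m))"

lemma keys_transform: "Poly_Mapping.keys (transform g f) \<subseteq> g ` Poly_Mapping.keys f"
proof -
  have "Poly_Mapping.keys (\<Sum>m\<in>S. Poly_Mapping.single (g m) (Poly_Mapping.lookup f m)) \<subseteq> g ` S"
    if "finite S" for S
    using that
  proof (induction S)
    case (insert m S)
    then show ?case
      using keys_add[of "Poly_Mapping.single (g m) (Poly_Mapping.lookup f m)"] by (fastforce split: if_splits)
  qed simp
  then show ?thesis by (simp add: transform_def)
qed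

lemma laurent_eval_transform:
  assumes "unimodular g" "p \<in> torus"
  shows "laurent_eval (transform g f) p = laurent_eval f (torus_map g p)"
proof -
  have "laurent_eval (transform g f) p = (\<Sum>m\<in>Poly_Mapping.keys f. Poly_Mapping.lookup f m * torus_char p (g m))"
    by (simp add: transform_def laurent_eval_sum)
  then show ?thesis by (simp add: laurent_eval_def torus_char_torus_map[OF assms])
qed

lemma zeros_transform:
  assumes "unimodular g"
  shows "zeros (transform g f) = {p \<in> torus. torus_map g p \<in> zeros f}"
proof -
  have "p \<in> zeros (transform g f) \<longleftrightarrow> p \<in> torus \<and> torus_map g p \<in> zeros f" for p
    unfolding zeros_def mem_Collect_eq using laurent_eval_transform[OF assms] torus_map_in_torus by metis
  then show ?thesis by blast
qed

lemma torus_map_preimage: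
  assumes "unimodular g" "unimodular h" "\<And>m. h (g m) = m" "Z \<subseteq> torus" "p \<in> Z"
  shows "torus_map h p \<in> {p \<in> torus. torus_map g p \<in> Z}"
proof -
  have p: "p \<in> torus" using assms(4,5) by blast
  have "torus_map g (torus_map h p) = p" by (rule torus_map_inverse[OF assms(1-3) p])
  then show ?thesis using torus_map_in_torus[OF p] assms(5) by simp
qed

lemma lookup_transform:
  assumes "\<And>m. h (g m) = m" "\<And>m. g (h m) = m"
  shows "Poly_Mapping.lookup (transform g f) m = Poly_Mapping.lookup f (h m)"
proof -
  have "Poly_Mapping.lookup (transform g f) m =
      (\<Sum>n\<in>Poly_Mapping.keys f. Poly_Mapping.lookup (Poly_Mapping.single (g n) (Poly_Mapping.lookup f n)) m)"
    by (simp add: transform_def lookup_sum)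
  also have "\<dots> = (\<Sum>n\<in>Poly_Mapping.keys f. if n = h m then Poly_Mapping.lookup f n else 0)"
    using assms by (intro sum.cong) (auto simp: lookup_single when_def)
  also have "\<dots> = Poly_Mapping.lookup f (h m)" by (simp add: in_keys_iff)
  finally show ?thesis .
qed

lemma lookup_times_single:
  "Poly_Mapping.lookup (f * Poly_Mapping.single v 1) (m + v) = Poly_Mapping.lookup (f :: 'a::field laurent) m"
  by (induction f rule: laurent_induct)
    (simp_all add: mult_single lookup_single distrib_right lookup_add when_def)

lemma irreducible_zeros_transform:
  fixes Z :: "('a::field \<times> 'a) set"
  assumes g: "unimodular g" "unimodular h" "\<And>m. g (h m) = m" "\<And>m. h (g m) = m"
    and Z: "irreducible_zeros Z" "Z \<subseteq> torus"
  shows "irreducible_zeros {p \<in> torus. torus_map g p \<in> Z}" (is "irreducible_zeros ?Z")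
  unfolding irreducible_zeros_def
proof (intro conjI allI impI)
  have mem: "torus_map h p \<in> ?Z" if "p \<in> Z" for p
    by (rule torus_map_preimage[OF g(1,2,4) Z(2) that])
  show "?Z \<noteq> {}" using mem Z(1) unfolding irreducible_zeros_def by blast
  fix f1 f2 assume sub: "?Z \<subseteq> zeros f1 \<union> zeros f2"
  have "Z \<subseteq> zeros (transform h f1) \<union> zeros (transform h f2)"
    using mem sub Z(2) by (auto simp: zeros_transform[OF g(2)])
  then have "Z \<subseteq> zeros (transform h f1) \<or> Z \<subseteq> zeros (transform h f2)" by (rule irreducible_zerosD[OF Z(1)])
  moreover have "?Z \<subseteq> zeros f" if "Z \<subseteq> zeros (transform h f)" for f
  proof
    fix p assume "p \<in> ?Z"
    then have "torus_map h (torus_map g p) \<in> zeros f" "p \<in> torus" using that by (auto simp: zeros_transform[OF g(2)])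
    then show "p \<in> zeros f" by (simp add: torus_map_inverse[OF g(2,1,3)])
  qed
  ultimately show "?Z \<subseteq> zeros f1 \<or> ?Z \<subseteq> zeros f2" by blast
qed

context frobenius_fixed begin

lemma torus_map_frob:
  "torus_map g (x ^ q, y ^ q) = (fst (torus_map g (x, y :: 'a)) ^ q, snd (torus_map g (x, y)) ^ q)"
  by (simp add: torus_map_def torus_char_frob)

text \<open>Monomial maps commute with the Frobenius map, so the automorphism and its inverse both
  preserve rationality.\<close>

lemma bij_rational_points_transform:
  fixes Z :: "('a \<times> 'a) set"
  assumes g: "unimodular g" "unimodular h" "\<And>m. g (h m) = m" "\<And>m. h (g m) = m" and Z: "Z \<subseteq> torus"
  shows "card (rational_points q {p \<in> torus. torus_map g p \<in> Z}) = card (rational_points q Z)"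
proof (rule bij_betw_same_card)
  have fx: "torus_map g' p \<in> {(x, y). x ^ q = x \<and> y ^ q = y}" if "p \<in> {(x, y). x ^ q = x \<and> y ^ q = y}"
    for p :: "'a \<times> 'a" and g'
  proof -
    obtain x y where p: "p = (x, y)" by fastforce
    then have "x ^ q = x" "y ^ q = y" using that by auto
    then have "torus_map g' p = (fst (torus_map g' p) ^ q, snd (torus_map g' p) ^ q)"
      using torus_map_frob[of g' x y] p by simp
    then show ?thesis by (metis (mono_tags, lifting) case_prodI fst_conv mem_Collect_eq prod.collapse snd_conv)
  qed
  have R: "rational_points q Y = Y \<inter> {(x, y). x ^ q = x \<and> y ^ q = y}" for Y :: "('a \<times> 'a) set"
    by (auto simp: rational_points_def)
  show "bij_betw (torus_map g) (rational_points q {p \<in> torus. torus_map g p \<in> Z}) (rational_points q Z)"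
  proof (rule bij_betw_byWitness[where f' = "torus_map h"])
    show "\<forall>p\<in>rational_points q {p \<in> torus. torus_map g p \<in> Z}. torus_map h (torus_map g p) = p"
    proof
      fix p assume "p \<in> rational_points q {p \<in> torus. torus_map g p \<in> Z}"
      then have "p \<in> torus" unfolding R by blast
      then show "torus_map h (torus_map g p) = p" by (rule torus_map_inverse[OF g(2,1,3)])
    qed
    show "\<forall>p\<in>rational_points q Z. torus_map g (torus_map h p) = p"
    proof
      fix p assume "p \<in> rational_points q Z"
      then have "p \<in> torus" unfolding R using Z by blast
      then show "torus_map g (torus_map h p) = p" by (rule torus_map_inverse[OF g(1,2,4)])
    qed
    show "torus_map g ` rational_points q {p \<in> torus. torus_map g p \<in> Z} \<subseteq> rational_points q Z"
    proof
      fix y assume "y \<in> torus_map g ` rational_points q {p \<in> torus. torus_map g p \<in> Z}"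
      then obtain p where p: "y = torus_map g p" "p \<in> rational_points q {p \<in> torus. torus_map g p \<in> Z}" by (rule imageE)
      from p(2) have "torus_map g p \<in> Z" "p \<in> {(x, y). x ^ q = x \<and> y ^ q = y}" unfolding R by simp_all
      then show "y \<in> rational_points q Z" unfolding p(1) R using fx[of p g] by (intro IntI)
    qed
    show "torus_map h ` rational_points q Z \<subseteq> rational_points q {p \<in> torus. torus_map g p \<in> Z}"
    proof
      fix y assume "y \<in> torus_map h ` rational_points q Z"
      then obtain p where p: "y = torus_map h p" "p \<in> rational_points q Z" by (rule imageE)
      from p(2) have "p \<in> Z" "p \<in> {(x, y). x ^ q = x \<and> y ^ q = y}" unfolding R by simp_all
      then show "y \<in> rational_points q {p \<in> torus. torus_map g p \<in> Z}"
        unfolding p(1) R using fx[of p h] torus_map_preimage[OF g(1,2,4) Z] by (intro IntI)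
    qed
  qed
qed

text \<open>Nothing that is counted changes when \<open>Q\<close> is replaced by its image and
  \<open>f\<close> by its pullback; the translation by \<open>lat v\<close> moves the Minkowski sum
  as a whole.\<close>

lemma step_bound_transform:
  assumes g: "unimodular g" "unimodular h" "\<And>m. g (h m) = m" "\<And>m. h (g m) = m"
    and T: "lattice_polygon T" and Z: "Z \<subseteq> torus"
    and bound: "step_bound ((+) (lat v) ` real_ext g ` T) {p \<in> torus. torus_map g p \<in> Z}"
  shows "step_bound T Z"
  unfolding step_bound_def
proof (intro allI impI)
  fix Q and f :: "'a laurent"
  assume Q: "lattice_polygon Q" "Poly_Mapping.keys f \<subseteq> lattice_points Q" "\<not> Z \<subseteq> zeros f"
  let ?Z = "{p \<in> torus. torus_map g p \<in> Z}" and ?T = "(+) (lat v) ` real_ext g ` T" and ?Q = "real_ext g ` Q"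
  have lpg: "lattice_points (real_ext g ` P) = g ` lattice_points P" for P
    by (rule lattice_points_real_ext[OF g])
  have injg: "inj_on g S" for S using g(4) by (metis inj_on_def)
  have 1: "lattice_polygon ?Q" by (rule lattice_polygon_real_ext[OF g(1) Q(1)])
  have 2: "Poly_Mapping.keys (transform g f) \<subseteq> lattice_points ?Q"
    unfolding lpg using keys_transform Q(2) by blast
  have 3: "\<not> ?Z \<subseteq> zeros (transform g f)"
  proof
    assume sub: "?Z \<subseteq> zeros (transform g f)"
    have "p \<in> zeros f" if "p \<in> Z" for p
    proof -
      have "p \<in> torus" using that Z by blast
      have "torus_map h p \<in> ?Z" by (rule torus_map_preimage[OF g(1,2,4) Z that])
      then have "torus_map g (torus_map h p) \<in> zeros f" using sub zeros_transform[OF g(1)] by blast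
      then show ?thesis using torus_map_inverse[OF g(1,2,4) \<open>p \<in> torus\<close>] by simp
    qed
    then show False using Q(3) by blast
  qed
  have "q + card (lattice_points ?Q) \<le> card (rational_points q (?Z - zeros (transform g f))) + card (lattice_points (?Q + ?T))"
    using bound 1 2 3 unfolding step_bound_def by blast
  moreover have "card (lattice_points ?Q) = card (lattice_points Q)"
    unfolding lpg by (rule card_image[OF injg])
  moreover have "?Q + ?T = (+) (lat v) ` real_ext g ` (Q + T)"
  proof -
    have "A + (+) c ` B = (+) c ` (A + B)" for A B :: "(real \<times> real) set" and c
      by (auto simp: set_plus_def image_iff add.left_commute simp del: add_Pair) (metis add.left_commute)+
    then show ?thesis by (simp add: real_ext_plus)
  qed
  then have "card (lattice_points (?Q + ?T)) = card (lattice_points (Q + T))"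
  proof -
    have "card ((\<lambda>m. m + v) ` S) = card S" for S by (rule card_image) (simp add: inj_on_def)
    then show ?thesis
      by (simp only: \<open>?Q + ?T = _\<close> lattice_points_translate lpg card_image[OF injg])
  qed
  moreover have "?Z - zeros (transform g f) = {p \<in> torus. torus_map g p \<in> Z - zeros f}"
    using zeros_transform[OF g(1)] by blast
  then have "card (rational_points q (?Z - zeros (transform g f))) = card (rational_points q (Z - zeros f))"
    using bij_rational_points_transform[OF g, of "Z - zeros f"] Z by auto
  ultimately show "q + card (lattice_points Q) \<le> card (rational_points q (Z - zeros f)) + card (lattice_points (Q + T))"
    by simp
qed

text \<open>The classification supplies affine coordinates in which the polygon is a strip or a
  double triangle. The translation by \<open>v\<close> multiplies the section by a monomial, which
  has no zeros in the torus.\<close>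

lemma hollow_bounds:
  assumes T: "lattice_polygon T" "hollow (lattice_points T)" "m1 \<in> lattice_points T" "m2 \<in> lattice_points T" "m1 \<noteq> m2"
    and s: "Poly_Mapping.keys s \<subseteq> lattice_points T" "s \<noteq> 0"
    and irr: "irreducible_zeros (zeros s)" and fixed: "\<And>m. fixed (Poly_Mapping.lookup s m)"
    and point: "\<And>a b c d e g. fixed a \<Longrightarrow> fixed b \<Longrightarrow> fixed c \<Longrightarrow> fixed d \<Longrightarrow> fixed e \<Longrightarrow> fixed g \<Longrightarrow>
      \<exists>u v w. fixed u \<and> fixed v \<and> fixed w \<and> (u, v, w) \<noteq> (0, 0, 0) \<and> ternary_form a b c d e g u v w = 0"
  shows "step_bound T (zeros s)" "card (rational_points q (zeros s)) \<le> q + 1"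
proof -
  obtain g v where g: "unimodular g" and
    S': "unit_strip ((\<lambda>m. g m + v) ` lattice_points T) \<or> double_triangle ((\<lambda>m. g m + v) ` lattice_points T)"
    using hollow_classification[OF T(2-5)] unfolding lattice_equiv_def by blast
  obtain h where h: "unimodular h" "\<And>m. g (h m) = m" "\<And>m. h (g m) = m"
    by (rule unimodular_inverse[OF g]) blast
  let ?T = "(+) (lat v) ` real_ext g ` T" and ?s = "transform g s * Poly_Mapping.single v 1"
  have T': "lattice_polygon ?T" by (intro lattice_polygon_translate lattice_polygon_real_ext g T)
  have lpT: "lattice_points ?T = (\<lambda>m. g m + v) ` lattice_points T"
    unfolding lattice_points_translate lattice_points_real_ext[OF g h] by (simp add: image_image)
  have zt: "zeros s \<subseteq> torus" by (auto simp: zeros_def)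
  have zs: "zeros ?s = {p \<in> torus. torus_map g p \<in> zeros s}"
    using zeros_single_mult[of 1 "transform g s" v] zeros_transform[OF g] by simp
  have lookup: "Poly_Mapping.lookup ?s (m + v) = Poly_Mapping.lookup s (h m)" for m
    by (simp add: lookup_times_single lookup_transform[OF h(3,2)])
  have keys: "Poly_Mapping.keys ?s \<subseteq> lattice_points ?T"
  proof
    fix n assume "n \<in> Poly_Mapping.keys ?s"
    moreover have "n = n - v + v" by simp
    ultimately have "h (n - v) \<in> Poly_Mapping.keys s" using lookup[of "n - v"] by (simp add: in_keys_iff)
    then have "g (h (n - v)) + v \<in> lattice_points ?T" unfolding lpT using s(1) by blast
    then show "n \<in> lattice_points ?T" by (simp add: h)
  qed
  have s0: "?s \<noteq> 0"
  proof
    assume "?s = 0"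
    then have "Poly_Mapping.lookup s (h m) = 0" for m using lookup[of m] by simp
    then have "Poly_Mapping.lookup s m = 0" for m using h(3) by metis
    then have "s = 0" by (intro poly_mapping_eqI) simp
    then show False using s(2) by simp
  qed
  have irr': "irreducible_zeros (zeros ?s)"
    unfolding zs by (rule irreducible_zeros_transform[OF g h irr zt])
  have fixed': "fixed (Poly_Mapping.lookup ?s m)" for m
    using lookup[of "m - v"] fixed by simp
  have "step_bound ?T (zeros ?s) \<and> card (rational_points q (zeros ?s)) \<le> q + 1"
    using S'
  proof
    assume "unit_strip ((\<lambda>m. g m + v) ` lattice_points T)"
    then have us: "unit_strip (lattice_points ?T)" by (simp add: lpT)
    have fs: "frobenius_stable q (zeros ?s)" using frobenius_stable_zeros fixed' by blast
    show ?thesis using strip_bounds[OF T' us keys s0 irr' fs] by simp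
  next
    assume "double_triangle ((\<lambda>m. g m + v) ` lattice_points T)"
    then have dt: "double_triangle (lattice_points ?T)" by (simp add: lpT)
    show ?thesis using conic_bounds[OF T' dt keys s0 irr' fixed' point] by blast
  qed
  then have b: "step_bound ?T {p \<in> torus. torus_map g p \<in> zeros s}"
    "card (rational_points q {p \<in> torus. torus_map g p \<in> zeros s}) \<le> q + 1" by (simp_all add: zs)
  show "step_bound T (zeros s)" by (rule step_bound_transform[OF g h T(1) zt b(1)])
  show "card (rational_points q (zeros s)) \<le> q + 1"
    using b(2) bij_rational_points_transform[OF g h zt] by simp
qed

end

section \<open>Polygons without interior lattice points are hollow\<close>

text \<open>If the interior is nonempty, \<open>r\<close> is separated from it, and its closure
  contains \<open>T\<close>. If it is empty, \<open>T\<close> lies in a hyperplane, whose normal is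
  taken with the sign that suits \<open>r\<close>.\<close>

lemma supporting_functional:
  fixes T :: "'a::euclidean_space set"
  assumes "convex T" "r \<notin> interior T"
  obtains w where "w \<noteq> 0" "\<And>x. x \<in> T \<Longrightarrow> w \<bullet> x \<le> w \<bullet> r"
proof (cases "interior T = {}")
  case True
  then obtain a b where ab: "a \<noteq> 0" "T \<subseteq> {x. a \<bullet> x = b}"
    using empty_interior_subset_hyperplane[OF assms(1)] by blast
  show thesis
  proof (cases "b \<le> a \<bullet> r")
    case True
    then show thesis using that[of a] ab by auto
  next
    case False
    show thesis
    proof (rule that[of "- a"])
      show "- a \<bullet> x \<le> - a \<bullet> r" if "x \<in> T" for x using that ab(2) False by auto
    qed (use ab in simp)
  qed
next
  case False
  obtain a b where ab: "a \<noteq> 0" "\<forall>x\<in>interior T. a \<bullet> x \<le> b" "\<forall>x\<in>{r}. a \<bullet> x \<ge> b"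
    using separating_hyperplane_sets[of "interior T" "{r}"] False assms by auto
  have "closure (interior T) \<subseteq> {x. a \<bullet> x \<le> b}"
    using ab(2) by (intro closure_minimal closed_halfspace_le) auto
  moreover have "T \<subseteq> closure (interior T)"
    using convex_closure_interior[OF assms(1) False] closure_subset by blast
  ultimately show thesis using that[of a] ab by force
qed

lemma hollow_lattice_points:
  assumes T: "lattice_polygon T" and I: "num_interior_points T = 0"
  shows "hollow (lattice_points T)"
proof -
  have conv: "convex T" using lattice_polygon_convex[OF T] .
  \<comment> \<open>Boundedness rules out that the cardinality is 0 merely because the set is
    infinite.\<close>
  have "bounded (interior T)"
    using lattice_polygon_compact[OF T] by (meson bounded_subset compact_imp_bounded interior_subset)
  then have empty: "lattice_points (interior T) = {}"
    using I finite_lattice_points by (simp add: num_interior_points_def)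
  show ?thesis
    unfolding hollow_def
  proof (intro conjI allI ballI impI)
    fix r :: "int \<times> int"
    have "lat r \<notin> interior T" using empty by (metis empty_iff lattice_points_def mem_Collect_eq)
    then obtain w where w: "w \<noteq> 0" "\<And>x. x \<in> T \<Longrightarrow> w \<bullet> x \<le> w \<bullet> lat r"
      using supporting_functional[OF conv] by metis
    show "\<exists>(u :: real) (v :: real). (u \<noteq> 0 \<or> v \<noteq> 0) \<and> (\<forall>m\<in>lattice_points T.
        u * of_int (fst m) + v * of_int (snd m) \<le> u * of_int (fst r) + v * of_int (snd r))"
    proof (intro exI conjI ballI)
      show "fst w \<noteq> 0 \<or> snd w \<noteq> 0" using w(1) by (simp add: prod_eq_iff)
      fix m assume "m \<in> lattice_points T"
      then have "w \<bullet> lat m \<le> w \<bullet> lat r" using w(2) by (simp add: lattice_points_def)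
      then show "fst w * of_int (fst m) + snd w * of_int (snd m) \<le> fst w * of_int (fst r) + snd w * of_int (snd r)"
        by (simp add: lat_def inner_prod_def)
    qed
  next
    fix a b c r :: "int \<times> int" and i j k :: int
    assume abc: "a \<in> lattice_points T" "b \<in> lattice_points T" "c \<in> lattice_points T"
      and ijk: "0 \<le> i" "0 \<le> j" "0 \<le> k" "0 < i + j + k"
      and r: "(i + j + k) * fst r = i * fst a + j * fst b + k * fst c"
        "(i + j + k) * snd r = i * snd a + j * snd b + k * snd c"
    let ?N = "real_of_int (i + j + k)"
    have N: "?N > 0" using ijk(4) by (simp only: of_int_0_less_iff)
    have "lat ` {a, b, c} \<subseteq> T" using abc by (auto simp: lattice_points_def)
    have "(of_int i / ?N) *\<^sub>R lat a + (of_int j / ?N) *\<^sub>R lat b + (of_int k / ?N) *\<^sub>R lat c \<in> T"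
    proof -
      have "(of_int i / ?N) *\<^sub>R lat a + (of_int j / ?N) *\<^sub>R lat b + (of_int k / ?N) *\<^sub>R lat c
          \<in> convex hull {lat a, lat b, lat c}"
        unfolding convex_hull_3 using ijk N
        by (intro CollectI exI[of _ "of_int i / ?N"] exI[of _ "of_int j / ?N"] exI[of _ "of_int k / ?N"])
          (simp add: add_divide_distrib[symmetric])
      moreover have "convex hull {lat a, lat b, lat c} \<subseteq> T"
        using abc conv by (intro hull_minimal) (auto simp: lattice_points_def)
      ultimately show ?thesis by blast
    qed
    moreover have "lat r = (of_int i / ?N) *\<^sub>R lat a + (of_int j / ?N) *\<^sub>R lat b + (of_int k / ?N) *\<^sub>R lat c"
    proof -
      have comb: "z = of_int i / ?N * x1 + of_int j / ?N * x2 + of_int k / ?N * x3"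
        if "?N * z = of_int i * x1 + of_int j * x2 + of_int k * x3" for z x1 x2 x3 :: real
      proof -
        have "z = (?N * z) / ?N" using N by simp
        then show ?thesis unfolding that by (simp add: add_divide_distrib)
      qed
      have "?N * of_int (fst r) = of_int i * of_int (fst a) + of_int j * of_int (fst b) + of_int k * of_int (fst c)"
        "?N * of_int (snd r) = of_int i * of_int (snd a) + of_int j * of_int (snd b) + of_int k * of_int (snd c)"
        using r by (metis of_int_add of_int_mult)+
      from comb[OF this(1)] comb[OF this(2)] show ?thesis by (simp add: lat_def)
    qed
    ultimately show "r \<in> lattice_points T" by (simp add: lattice_points_def)
  qed
qed

subsection \<open>Closed subsets of the toric surface\<close>

lemma int_hom_powi:
  fixes f :: "int \<Rightarrow> 'a::field"
  assumes "\<And>i j. f (i + j) = f i * f j" "\<And>i. f i \<noteq> 0"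
  shows "f i = f 1 powi i"
proof -
  have "f 0 * f 0 = f 0" using assms(1)[of 0 0] by simp
  then have f0: "f 0 = 1" using assms(2)[of 0] by simp
  show ?thesis
  proof (induction i rule: int_induct[where k = 0])
    case base
    then show ?case by (simp add: f0)
  next
    case (step1 i)
    then show ?case using assms by (simp add: power_int_add)
  next
    case (step2 i)
    have "f (i - 1) * f 1 = f i" using assms(1)[of "i - 1" 1] by simp
    then have "f (i - 1) = f i / f 1" using assms(2) by (simp add: nonzero_eq_divide_eq)
    then show ?case using step2 assms by (simp add: power_int_diff)
  qed
qed

lemma toric_surface_nonzero_iff:
  "(\<tau>, x) \<in> toric_surface \<Sigma> \<Longrightarrow> x m \<noteq> 0 \<longleftrightarrow> m \<in> invertible_chars \<tau>"
  unfolding toric_surface_def by blast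

lemma toric_surface_mult:
  "(\<tau>, x) \<in> toric_surface \<Sigma> \<Longrightarrow> m \<in> invertible_chars \<tau> \<Longrightarrow> n \<in> invertible_chars \<tau> \<Longrightarrow>
    x (m + n) = x m * x n"
  unfolding toric_surface_def by blast

text \<open>Over the zero cone every character is invertible, so a point is a homomorphism from the
  whole lattice to the units and is given by its values at the two basis vectors.\<close>

lemma torus_cone_point:
  assumes "({}, x) \<in> toric_surface \<Sigma>"
  obtains a b where "a \<noteq> 0" "b \<noteq> 0" "({}, x) = torus_point a b"
proof -
  have inv: "m \<in> invertible_chars {}" for m by (simp add: invertible_chars_def)
  have nz: "x m \<noteq> 0" for m using toric_surface_nonzero_iff[OF assms] inv by simp
  have hom: "x (m + n) = x m * x n" for m n using toric_surface_mult[OF assms inv inv] .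
  have hom1: "x (i + j, 0) = x (i, 0) * x (j, 0)" for i j using hom[of "(i, 0)" "(j, 0)"] by simp
  have hom2: "x (0, i + j) = x (0, i) * x (0, j)" for i j using hom[of "(0, i)" "(0, j)"] by simp
  have "x m = x (1, 0) powi fst m * x (0, 1) powi snd m" for m
  proof -
    have "x (i, 0) = x (1, 0) powi i" for i
      by (rule int_hom_powi[of "\<lambda>i. x (i, 0)"]) (use nz hom1 in blast)+
    then have a: "x (fst m, 0) = x (1, 0) powi fst m" by blast
    have "x (0, i) = x (0, 1) powi i" for i
      by (rule int_hom_powi[of "\<lambda>i. x (0, i)"]) (use nz hom2 in blast)+
    then have b: "x (0, snd m) = x (0, 1) powi snd m" by blast
    have "x m = x (fst m, 0) * x (0, snd m)" using hom[of "(fst m, 0)" "(0, snd m)"] by simp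
    then show ?thesis by (simp only: a b)
  qed
  then have "({}, x) = torus_point (x (1, 0)) (x (0, 1))" unfolding torus_point_def by blast
  then show thesis by (rule that[OF nz nz])
qed

lemma regular_value_torus_point: "regular_value h (torus_point a b) = laurent_eval h (a, b)"
  by (simp add: regular_value_def torus_point_def laurent_eval_def torus_char_def)

lemma torus_point_in_surface:
  "{} \<in> \<Sigma> \<Longrightarrow> a \<noteq> 0 \<Longrightarrow> b \<noteq> 0 \<Longrightarrow> torus_point a b \<in> toric_surface \<Sigma>"
  by (auto simp: torus_point_def toric_surface_def invertible_chars_def power_int_add)

lemma zero_cone_in_fan:
  assumes "smooth_complete_fan \<Sigma>"
  shows "{} \<in> \<Sigma>"
proof -
  have "\<Sigma> \<noteq> {}" using assms unfolding smooth_complete_fan_def by auto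
  then show ?thesis using assms unfolding smooth_complete_fan_def by (metis all_not_in_conv empty_subsetI)
qed

lemma torus_point_in_zero_locus:
  assumes "{} \<in> \<Sigma>" "lattice_points Q \<noteq> {}" "a \<noteq> 0" "b \<noteq> 0"
  shows "torus_point a b \<in> zero_locus \<Sigma> Q s \<longleftrightarrow> (a, b) \<in> zeros s"
  using torus_zeros_eq_zero_locus[OF assms(1,2), of s] assms(3,4) by (auto simp: torus_zeros_eq)

text \<open>The closed set cut out by \<open>h\<close> in the torus, together with the whole boundary: multiplying \<open>h\<close>
  by a character that is sufficiently negative on a cone makes it vanish on the boundary of the chart.\<close>

definition closed_with_boundary :: "lattice_cone set \<Rightarrow> 'k::field laurent \<Rightarrow> 'k toric_point set" where
  "closed_with_boundary \<Sigma> h = {p \<in> toric_surface \<Sigma>. fst p \<noteq> {} \<or> regular_value h p = 0}"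

lemma smooth_cone_negative_char:
  assumes "smooth_complete_fan \<Sigma>" "\<sigma> \<in> \<Sigma>"
  obtains w where "\<And>u. u \<in> \<sigma> \<Longrightarrow> pairing w u = - 1"
proof -
  obtain u v where uv: "\<sigma> \<subseteq> {u, v}" "\<bar>fst u * snd v - snd u * fst v\<bar> = 1"
  proof -
    have "\<forall>\<sigma>\<in>\<Sigma>. \<exists>u v. \<sigma> \<subseteq> {u, v} \<and> \<bar>fst u * snd v - snd u * fst v\<bar> = 1"
      using assms(1) unfolding smooth_complete_fan_def by - (elim conjE, assumption)
    from bspec[OF this assms(2)] show thesis using that by (elim exE conjE)
  qed
  define D where "D = fst u * snd v - snd u * fst v"
  have D: "D * D = 1" using uv(2) by (auto simp: D_def[symmetric] abs_if split: if_splits)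
  \<comment> \<open>Cramer's rule for \<open>pairing w u = pairing w v = - 1\<close>; the
    determinant \<open>D\<close> is its own inverse.\<close>
  define w where "w = (D * (snd u - snd v), D * (fst v - fst u))"
  have "pairing w u = - (D * D)" "pairing w v = - (D * D)"
    by (simp_all add: pairing_def w_def D_def algebra_simps)
  then have "pairing w z = - 1" if "z \<in> \<sigma>" for z using that uv(1) D by auto
  then show thesis by (rule that)
qed

lemma finite_cone: "smooth_complete_fan \<Sigma> \<Longrightarrow> \<sigma> \<in> \<Sigma> \<Longrightarrow> finite \<sigma>"
  unfolding smooth_complete_fan_def by (meson finite.emptyI finite.insertI finite_subset)

lemma pairing_add: "pairing (m + n) u = pairing m u + pairing n u"
  by (simp add: pairing_def algebra_simps)

lemma zariski_closed_with_boundary: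
  fixes h :: "'k::field laurent"
  assumes fan: "smooth_complete_fan \<Sigma>"
  shows "zariski_closed \<Sigma> (closed_with_boundary \<Sigma> h)"
  unfolding zariski_closed_def
proof (intro conjI ballI)
  show "closed_with_boundary \<Sigma> h \<subseteq> toric_surface \<Sigma>" by (auto simp: closed_with_boundary_def)
  fix \<sigma> assume \<sigma>: "\<sigma> \<in> \<Sigma>"
  obtain w where w: "\<And>u. u \<in> \<sigma> \<Longrightarrow> pairing w u = - 1" using smooth_cone_negative_char[OF fan \<sigma>] by blast
  \<comment> \<open>The 0 avoids a maximum over the empty set. The bound is strict, so that after
    the shift by \<open>v\<close> every exponent is negative, and not only nonpositive, on each ray
    of \<open>\<sigma>\<close>.\<close>
  define N where "N = Max (insert 0 ((\<lambda>(m, u). pairing m u + 1) ` (Poly_Mapping.keys h \<times> \<sigma>)))"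
  have N: "pairing m u < N" if "m \<in> Poly_Mapping.keys h" "u \<in> \<sigma>" for m u
  proof -
    have "pairing m u + 1 \<le> N" unfolding N_def
      using that finite_cone[OF fan \<sigma>] by (intro Max_ge) (auto intro!: image_eqI[of _ _ "(m, u)"])
    then show ?thesis by simp
  qed
  define v where "v = (N * fst w, N * snd w)"
  have v: "pairing v u = - N" if "u \<in> \<sigma>" for u
  proof -
    have "pairing v u = N * pairing w u" by (simp add: v_def pairing_def algebra_simps)
    then show ?thesis using w[OF that] by simp
  qed
  define f where "f = h * Poly_Mapping.single v 1"
  have neg: "pairing n u < 0" if n: "n \<in> Poly_Mapping.keys f" and u: "u \<in> \<sigma>" for n u
  proof -
    have "Poly_Mapping.keys f \<subseteq> {m + k | m k. m \<in> Poly_Mapping.keys h \<and> k \<in> Poly_Mapping.keys (Poly_Mapping.single v (1 :: 'k))}"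
      unfolding f_def by (rule keys_mult)
    then obtain m k where "m \<in> Poly_Mapping.keys h" "k \<in> Poly_Mapping.keys (Poly_Mapping.single v (1 :: 'k))" "n = m + k"
      using n by blast
    then have "m \<in> Poly_Mapping.keys h" "n = m + v" by simp_all
    then show ?thesis using N[OF _ u] v[OF u] by (simp add: pairing_add)
  qed
  show "\<exists>F. (\<forall>f\<in>F. Poly_Mapping.keys f \<subseteq> regular_chars \<sigma>) \<and>
      closed_with_boundary \<Sigma> h \<inter> affine_chart \<Sigma> \<sigma> = {p \<in> affine_chart \<Sigma> \<sigma>. \<forall>f\<in>F. regular_value f p = 0}"
  proof (intro exI[of _ "{f}"] conjI)
    show "\<forall>f\<in>{f}. Poly_Mapping.keys f \<subseteq> regular_chars \<sigma>"
      using neg by (auto simp: regular_chars_def intro: less_imp_le)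
    have "p \<in> closed_with_boundary \<Sigma> h \<longleftrightarrow> regular_value f p = 0" if p: "p \<in> affine_chart \<Sigma> \<sigma>" for p
    proof -
      obtain \<tau> x where \<tau>: "p = (\<tau>, x)" by fastforce
      have surf: "(\<tau>, x) \<in> toric_surface \<Sigma>" and sub: "\<tau> \<subseteq> \<sigma>" using p by (auto simp: affine_chart_def \<tau>)
      show ?thesis
      proof (cases "\<tau> = {}")
        case True
        then obtain a b where ab: "a \<noteq> 0" "b \<noteq> 0" "p = torus_point a b"
          using torus_cone_point surf \<tau> by metis
        have "regular_value f p = regular_value h p * torus_char (a, b) v"
          unfolding ab(3) regular_value_torus_point f_def using ab by (simp add: laurent_eval_mult)
        moreover have "torus_char (a, b) v \<noteq> 0" using ab by (simp add: torus_char_nonzero)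
        ultimately show ?thesis using surf True by (auto simp: closed_with_boundary_def \<tau>)
      next
        case False
        then obtain u where u: "u \<in> \<tau>" by blast
        have "x m = 0" if "m \<in> Poly_Mapping.keys f" for m
        proof -
          have "pairing m u \<noteq> 0" using neg[OF that, of u] u sub by auto
          then have "m \<notin> invertible_chars \<tau>" using u unfolding invertible_chars_def by blast
          then show ?thesis using toric_surface_nonzero_iff[OF surf] by blast
        qed
        then have "regular_value f p = 0" by (simp add: regular_value_def \<tau>)
        then show ?thesis using surf False by (simp add: closed_with_boundary_def \<tau>)
      qed
    qed
    then show "closed_with_boundary \<Sigma> h \<inter> affine_chart \<Sigma> \<sigma> =
        {p \<in> affine_chart \<Sigma> \<sigma>. \<forall>f\<in>{f}. regular_value f p = 0}" by auto
  qed
qed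

lemma torus_point_in_closed_with_boundary:
  assumes "{} \<in> \<Sigma>" "a \<noteq> 0" "b \<noteq> 0"
  shows "torus_point a b \<in> closed_with_boundary \<Sigma> h \<longleftrightarrow> (a, b) \<in> zeros h"
proof -
  have "fst (torus_point a b) = {}" by (simp add: torus_point_def)
  then show ?thesis
    using torus_point_in_surface[OF assms] assms
    by (simp add: closed_with_boundary_def regular_value_torus_point zeros_def)
qed

lemma zero_locus_subset_surface: "zero_locus \<Sigma> Q s \<subseteq> toric_surface \<Sigma>"
  by (auto simp: zero_locus_def)

lemma zero_locus_subset_closed_with_boundary:
  assumes "{} \<in> \<Sigma>" "lattice_points Q \<noteq> {}" "zeros s \<subseteq> zeros h \<union> zeros k"
  shows "zero_locus \<Sigma> Q s \<subseteq> closed_with_boundary \<Sigma> h \<union> closed_with_boundary \<Sigma> k"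
proof
  fix p assume p: "p \<in> zero_locus \<Sigma> Q s"
  obtain \<tau> x where \<tau>: "p = (\<tau>, x)" by fastforce
  have surf: "(\<tau>, x) \<in> toric_surface \<Sigma>" using p zero_locus_subset_surface \<tau> by blast
  show "p \<in> closed_with_boundary \<Sigma> h \<union> closed_with_boundary \<Sigma> k"
  proof (cases "\<tau> = {}")
    case True
    then obtain a b where ab: "a \<noteq> 0" "b \<noteq> 0" "p = torus_point a b" using torus_cone_point surf \<tau> by metis
    then have "(a, b) \<in> zeros s" using p torus_point_in_zero_locus[OF assms(1,2)] by blast
    then show ?thesis using assms(3) ab torus_point_in_closed_with_boundary[OF assms(1)] by blast
  next
    case False
    then show ?thesis using surf by (simp add: closed_with_boundary_def \<tau>)
  qed
qed

text \<open>A covering of the torus part by two hypersurfaces becomes, with the boundary added to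
  each, a covering of the whole curve by two closed sets.\<close>

lemma irreducible_zeros_of_zariski:
  assumes fan: "smooth_complete_fan \<Sigma>" and Q: "lattice_points Q \<noteq> {}"
    and irr: "zariski_irreducible \<Sigma> (zero_locus \<Sigma> Q s)" and ne: "zeros s \<noteq> {}"
  shows "irreducible_zeros (zeros s)"
  unfolding irreducible_zeros_def
proof (intro conjI allI impI ne)
  note e = zero_cone_in_fan[OF fan]
  fix h k assume sub: "zeros s \<subseteq> zeros h \<union> zeros k"
  have "zero_locus \<Sigma> Q s \<subseteq> closed_with_boundary \<Sigma> h \<or> zero_locus \<Sigma> Q s \<subseteq> closed_with_boundary \<Sigma> k"
    using irr zariski_closed_with_boundary[OF fan] zero_locus_subset_closed_with_boundary[OF e Q sub]
    unfolding zariski_irreducible_def by blast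
  moreover have "zeros s \<subseteq> zeros f" if "zero_locus \<Sigma> Q s \<subseteq> closed_with_boundary \<Sigma> f" for f
  proof
    fix p assume p: "p \<in> zeros s"
    obtain a b where ab: "p = (a, b)" by fastforce
    have nz: "a \<noteq> 0" "b \<noteq> 0" using p ab by (auto simp: zeros_def)
    have "torus_point a b \<in> closed_with_boundary \<Sigma> f"
      using torus_point_in_zero_locus[OF e Q nz] p ab that by blast
    then show "p \<in> zeros f" using torus_point_in_closed_with_boundary[OF e nz] ab by simp
  qed
  ultimately show "zeros s \<subseteq> zeros h \<or> zeros s \<subseteq> zeros k" by blast
qed

section \<open>Zero loci are closed and determined by their torus parts\<close>

lemma pairing_commute: "pairing m u = pairing u m"
  by (simp add: pairing_def mult.commute)

lemma inner_lat: "lat m \<bullet> lat u = of_int (pairing m u)"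
  by (simp add: lat_def pairing_def inner_prod_def)

text \<open>If the vertex of \<open>Q\<close> that is lexicographically maximal for \<open>u, v\<close> were not maximal for \<open>v\<close>, then
  some normal of an edge at it would lie in the interior of the cone of \<open>u, v\<close>.\<close>

lemma cone_common_maximum:
  assumes Q: "lattice_polygon Q" and fan: "smooth_complete_fan \<Sigma>"
    and normals: "outer_edge_normals Q \<subseteq> fan_rays \<Sigma>" and \<sigma>: "{u, v} \<in> \<Sigma>"
    and det: "fst u * snd v - snd u * fst v \<noteq> 0"
  obtains x where "x \<in> lattice_points Q"
    "\<And>m. m \<in> lattice_points Q \<Longrightarrow> pairing m u \<le> pairing x u"
    "\<And>m. m \<in> lattice_points Q \<Longrightarrow> pairing m v \<le> pairing x v"
proof -
  let ?L = "lattice_points Q"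
  note finQ = lattice_polygon_finite[OF Q] lattice_polygon_nonempty[OF Q]
  obtain x0 where x0: "x0 \<in> ?L" "\<And>m. m \<in> ?L \<Longrightarrow> pairing m u \<le> pairing x0 u"
    using finite_attains_max[OF finQ, where w = "\<lambda>m. pairing m u"] by blast
  have "finite {m \<in> ?L. pairing m u = pairing x0 u}" "{m \<in> ?L. pairing m u = pairing x0 u} \<noteq> {}"
    using finQ x0(1) by (simp, blast)
  then obtain x where x: "x \<in> {m \<in> ?L. pairing m u = pairing x0 u}"
    "\<And>m. m \<in> {m \<in> ?L. pairing m u = pairing x0 u} \<Longrightarrow> pairing m v \<le> pairing x v"
    using finite_attains_max[where w = "\<lambda>m. pairing m v"] by blast
  have xL: "x \<in> ?L" using x(1) by blast
  have xu: "pairing m u \<le> pairing x u" if "m \<in> ?L" for m using x(1) x0(2)[OF that] by auto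
  have xv: "pairing m v \<le> pairing x v" if "m \<in> ?L" "pairing m u = pairing x u" for m
    using x that by auto
  have "\<forall>m\<in>?L. pairing m v \<le> pairing x v"
  proof (rule ccontr)
    assume neg: "\<not> (\<forall>m\<in>?L. pairing m v \<le> pairing x v)"
    \<comment> \<open>The points that exceed \<open>x\<close> in direction \<open>v\<close>. Among
      them \<open>y\<close> will minimise the ratio of the loss \<open>a\<close> in direction
      \<open>u\<close> to the gain \<open>b\<close> in direction \<open>v\<close>.\<close>
    define Y where "Y = {y \<in> ?L. pairing x v < pairing y v}"
    have "finite Y" "Y \<noteq> {}" using finQ(1) neg by (simp add: Y_def, force simp: Y_def)
    define a where "a y = pairing x u - pairing y u" for y
    define b where "b y = pairing y v - pairing x v" for y
    have ab: "a y > 0" "b y > 0" if "y \<in> Y" for y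
      using that xu[of y] xv[of y] by (auto simp: Y_def a_def b_def intro: le_neq_trans)
    let ?r = "\<lambda>y. real_of_int (a y) / of_int (b y)"
    have "Min (?r ` Y) \<in> ?r ` Y" using \<open>finite Y\<close> \<open>Y \<noteq> {}\<close> by simp
    then obtain y where y: "y \<in> Y" "Min (?r ` Y) = ?r y" by auto
    have ratio: "a y * b z \<le> a z * b y" if "z \<in> Y" for z
    proof -
      have "?r y \<le> ?r z" unfolding y(2)[symmetric] using \<open>finite Y\<close> that by (intro Min_le) auto
      then have "real_of_int (a y * b z) \<le> real_of_int (a z * b y)"
        using ab(2)[OF y(1)] ab(2)[OF that] by (simp add: divide_simps)
      then show ?thesis by (simp only: of_int_le_iff)
    qed
    define A B where "A = a y" and "B = b y"
    have AB: "A > 0" "B > 0" using ab[OF y(1)] by (simp_all add: A_def B_def)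
    \<comment> \<open>The positive combination of \<open>u\<close> and \<open>v\<close> with the
      same value at \<open>x\<close> and \<open>y\<close>; minimality of the ratio makes this value
      the maximum over \<open>Q\<close>.\<close>
    define n where "n = (B * fst u + A * fst v, B * snd u + A * snd v)"
    have pn: "pairing m n = B * pairing m u + A * pairing m v" for m
      by (simp add: n_def pairing_def algebra_simps)
    have n0: "n \<noteq> (0, 0)"
    proof
      assume "n = (0, 0)"
      then have "B * fst u + A * fst v = 0" "B * snd u + A * snd v = 0" by (simp_all add: n_def)
      then have "(B * fst u + A * fst v) * snd v - (B * snd u + A * snd v) * fst v = 0" by simp
      then have "B * (fst u * snd v - snd u * fst v) = 0" by (simp add: algebra_simps)
      then show False using AB det by simp
    qed
    have xy: "pairing y n = pairing x n"
      unfolding pn A_def B_def a_def b_def by (simp add: algebra_simps)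
    have xmax: "pairing z n \<le> pairing x n" if "z \<in> ?L" for z
    proof (cases "z \<in> Y")
      case True
      then show ?thesis using ratio[OF True] unfolding pn A_def[symmetric] B_def[symmetric]
        by (simp add: a_def[of z] b_def[of z] algebra_simps)
    next
      case False
      then have "pairing z v \<le> pairing x v" using that by (auto simp: Y_def)
      then show ?thesis unfolding pn using xu[OF that] AB by (intro add_mono mult_left_mono) auto
    qed
    define g where "g = gcd (fst n) (snd n)"
    have "fst n \<noteq> 0 \<or> snd n \<noteq> 0" using n0 by (auto simp: prod_eq_iff)
    then have g: "g > 0" by (auto simp: g_def)
    define n' where "n' = (fst n div g, snd n div g)"
    have n: "n = (g * fst n', g * snd n')" by (simp add: n'_def g_def)
    have cop: "coprime (fst n') (snd n')"
      unfolding n'_def g_def using \<open>fst n \<noteq> 0 \<or> snd n \<noteq> 0\<close> by (simp add: div_gcd_coprime)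
    have gn: "pairing m n = g * pairing m n'" for m
      by (subst n) (simp add: pairing_def algebra_simps)
    have lmax: "pairing z n' \<le> pairing x n'" if "z \<in> ?L" for z using xmax[OF that] g by (simp add: gn)
    have lxy: "pairing y n' = pairing x n'" using xy g by (simp add: gn)
    have max: "z \<bullet> lat n' \<le> lat x \<bullet> lat n'" if "z \<in> Q" for z
    proof -
      have "lat n' \<bullet> z \<le> of_int (pairing x n')"
        by (rule lattice_polygon_bound[OF Q that]) (use lmax in \<open>simp add: inner_lat pairing_commute[of n']\<close>)
      then show ?thesis by (simp add: inner_commute[of z] inner_lat)
    qed
    have "n' \<in> outer_edge_normals Q"
    proof -
      have "lat x \<in> Q" "lat y \<in> Q" using xL y(1) unfolding lattice_points_def Y_def by blast+
      moreover have "x \<noteq> y" using y(1) unfolding Y_def by blast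
      then have "lat x \<noteq> lat y" by (simp add: lat_def prod_eq_iff)
      moreover have "z \<bullet> lat n' \<le> lat y \<bullet> lat n'" if "z \<in> Q" for z
        using max[OF that] by (simp add: inner_lat lxy)
      ultimately show ?thesis using cop max unfolding outer_edge_normals_def by blast
    qed
    then have ray: "{n'} \<in> \<Sigma>" using normals by (auto simp: fan_rays_def)
    have "n' \<notin> {u, v}"
    proof
      assume "n' \<in> {u, v}"
      then have "fst n * snd u - snd n * fst u = 0 \<or> fst n * snd v - snd n * fst v = 0"
      proof -
        have fn: "fst n = g * fst n'" "snd n = g * snd n'" by (subst n, simp)+
        show ?thesis using \<open>n' \<in> {u, v}\<close> unfolding fn by auto
      qed
      moreover have "fst n * snd u - snd n * fst u = - A * (fst u * snd v - snd u * fst v)"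
        "fst n * snd v - snd n * fst v = B * (fst u * snd v - snd u * fst v)"
        by (simp_all add: n_def algebra_simps)
      ultimately show False using AB det by auto
    qed
    \<comment> \<open>The ray of \<open>n'\<close> belongs to the fan and is neither of the two rays
      of the cone, so the cones meet only in 0; yet \<open>n'\<close> is a positive combination of
      \<open>u\<close> and \<open>v\<close>.\<close>
    then have "real_cone {n'} \<inter> real_cone {u, v} = real_cone {}"
      using fan ray \<sigma> unfolding smooth_complete_fan_def by (metis Int_insert_left_if0 inf_bot_left)
    then have zero: "real_cone {n'} \<inter> real_cone {u, v} = {0}" by (simp add: real_cone_def)
    have "lat n' \<in> real_cone {n'}" by (simp add: real_cone_def hull_inc)
    moreover have "lat n' \<in> real_cone {u, v}"
    proof -
      have cc: "convex_cone (real_cone {u, v})" by (simp add: real_cone_def convex_cone_convex_cone_hull)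
      have "lat u \<in> real_cone {u, v}" "lat v \<in> real_cone {u, v}" by (simp_all add: real_cone_def hull_inc)
      then have "(of_int B / of_int g) *\<^sub>R lat u \<in> real_cone {u, v}" "(of_int A / of_int g) *\<^sub>R lat v \<in> real_cone {u, v}"
        using AB g by (intro convex_cone_scaleR[OF cc]; simp)+
      then have "(of_int B / of_int g) *\<^sub>R lat u + (of_int A / of_int g) *\<^sub>R lat v \<in> real_cone {u, v}"
        by (intro convex_cone_add[OF cc])
      moreover have "lat n' = (of_int B / of_int g) *\<^sub>R lat u + (of_int A / of_int g) *\<^sub>R lat v"
      proof -
        have "g * fst n' = B * fst u + A * fst v" "g * snd n' = B * snd u + A * snd v"
          using n by (simp_all add: n_def)
        then have "real_of_int g * of_int (fst n') = of_int B * of_int (fst u) + of_int A * of_int (fst v)"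
          "real_of_int g * of_int (snd n') = of_int B * of_int (snd u) + of_int A * of_int (snd v)"
          by (metis of_int_add of_int_mult)+
        then show ?thesis using g by (simp add: lat_def field_simps)
      qed
      ultimately show ?thesis by simp
    qed
    ultimately have "lat n' = 0" using zero by blast
    then have "n' = (0, 0)" by (simp add: lat_def prod_eq_iff)
    then show False using n n0 by simp
  qed
  then show thesis using that xL xu x0(1) by blast
qed

text \<open>One monomial generates the line bundle of \<open>Q\<close> on the whole chart of
  \<open>\<sigma>\<close>. For cones with at most one ray a maximum in a single direction
  suffices.\<close>

lemma cone_local_generator:
  assumes Q: "lattice_polygon Q" and fan: "smooth_complete_fan \<Sigma>"
    and normals: "outer_edge_normals Q \<subseteq> fan_rays \<Sigma>" and \<sigma>: "\<sigma> \<in> \<Sigma>"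
  obtains x where "x \<in> lattice_points Q" "\<And>m. m \<in> lattice_points Q \<Longrightarrow> m - x \<in> regular_chars \<sigma>"
proof -
  note goal = that
  note finQ = lattice_polygon_finite[OF Q] lattice_polygon_nonempty[OF Q]
  have *: "\<forall>\<sigma>\<in>\<Sigma>. \<exists>u v. \<sigma> \<subseteq> {u, v} \<and> \<bar>fst u * snd v - snd u * fst v\<bar> = 1"
    using fan unfolding smooth_complete_fan_def by - (elim conjE, assumption)
  obtain u v where uv: "\<sigma> \<subseteq> {u, v}" "\<bar>fst u * snd v - snd u * fst v\<bar> = 1"
    using bspec[OF * \<sigma>] by (elim exE conjE)
  have diff: "pairing (m - x) w = pairing m w - pairing x w" for m x w
    by (simp add: pairing_def algebra_simps)
  have single: thesis if "\<sigma> \<subseteq> {w}" for w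
  proof -
    obtain x where "x \<in> lattice_points Q" "\<And>m. m \<in> lattice_points Q \<Longrightarrow> pairing m w \<le> pairing x w"
      using finite_attains_max[OF finQ, where w = "\<lambda>m. pairing m w"] by blast
    then show thesis using \<open>\<sigma> \<subseteq> {w}\<close> by (intro goal[of x]) (auto simp: regular_chars_def diff)
  qed
  show thesis
  proof (cases "\<sigma> = {u, v}")
    case True
    have det: "fst u * snd v - snd u * fst v \<noteq> 0" using uv(2) by auto
    obtain x where "x \<in> lattice_points Q"
      "\<And>m. m \<in> lattice_points Q \<Longrightarrow> pairing m u \<le> pairing x u"
      "\<And>m. m \<in> lattice_points Q \<Longrightarrow> pairing m v \<le> pairing x v"
      by (rule cone_common_maximum[OF Q fan normals \<sigma>[unfolded True] det]) blast
    then show thesis by (intro that[of x]) (auto simp: regular_chars_def diff True)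
  next
    case False
    then have "\<sigma> \<subseteq> {u} \<or> \<sigma> \<subseteq> {v}" using uv(1) by blast
    then show thesis using single by blast
  qed
qed

text \<open>Dividing \<open>s\<close> by a generator that works on the whole chart gives one regular
  equation there, whereas \<open>zero_locus\<close> allows a different \<open>m0\<close> at each
  point; the two conditions have to be compared.\<close>

lemma zariski_closed_zero_locus:
  fixes s :: "'k::field laurent"
  assumes Q: "lattice_polygon Q" and fan: "smooth_complete_fan \<Sigma>"
    and normals: "outer_edge_normals Q \<subseteq> fan_rays \<Sigma>" and s: "s \<in> sections_of Q"
  shows "zariski_closed \<Sigma> (zero_locus \<Sigma> Q s)"
  unfolding zariski_closed_def
proof (intro conjI ballI zero_locus_subset_surface)
  fix \<sigma> assume \<sigma>: "\<sigma> \<in> \<Sigma>"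
  obtain x0 where x0: "x0 \<in> lattice_points Q" "\<And>m. m \<in> lattice_points Q \<Longrightarrow> m - x0 \<in> regular_chars \<sigma>"
    using cone_local_generator[OF Q fan normals \<sigma>] by blast
  have keys: "Poly_Mapping.keys s \<subseteq> lattice_points Q" using s by (simp add: sections_of_def)
  define f where "f = transform (\<lambda>m. m - x0) s"
  have kf: "Poly_Mapping.keys f \<subseteq> (\<lambda>m. m - x0) ` Poly_Mapping.keys s" unfolding f_def by (rule keys_transform)
  have val: "regular_value f (\<tau>, x) = (\<Sum>m\<in>Poly_Mapping.keys s. Poly_Mapping.lookup s m * x (m - x0))" for \<tau> x
  proof -
    have "regular_value f (\<tau>, x) = (\<Sum>n\<in>(\<lambda>m. m - x0) ` Poly_Mapping.keys s. Poly_Mapping.lookup f n * x n)"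
      unfolding regular_value_def using kf by (intro sum.mono_neutral_cong_left) (auto simp: in_keys_iff)
    also have "\<dots> = (\<Sum>m\<in>Poly_Mapping.keys s. Poly_Mapping.lookup f (m - x0) * x (m - x0))"
      by (subst sum.reindex) (auto simp: inj_on_def)
    also have "\<dots> = (\<Sum>m\<in>Poly_Mapping.keys s. Poly_Mapping.lookup s m * x (m - x0))"
    proof -
      have "Poly_Mapping.lookup f (m - x0) = Poly_Mapping.lookup s m" for m
        unfolding f_def by (subst lookup_transform[where h = "\<lambda>m. m + x0"]) auto
      then show ?thesis by simp
    qed
    finally show ?thesis .
  qed
  show "\<exists>F. (\<forall>f\<in>F. Poly_Mapping.keys f \<subseteq> regular_chars \<sigma>) \<and>
      zero_locus \<Sigma> Q s \<inter> affine_chart \<Sigma> \<sigma> = {p \<in> affine_chart \<Sigma> \<sigma>. \<forall>f\<in>F. regular_value f p = 0}"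
  proof (intro exI[of _ "{f}"] conjI)
    show "\<forall>f\<in>{f}. Poly_Mapping.keys f \<subseteq> regular_chars \<sigma>" using kf keys x0(2) by blast
    have "p \<in> zero_locus \<Sigma> Q s \<longleftrightarrow> regular_value f p = 0" if p: "p \<in> affine_chart \<Sigma> \<sigma>" for p
    proof -
      obtain \<tau> x where \<tau>: "p = (\<tau>, x)" by fastforce
      have surf: "(\<tau>, x) \<in> toric_surface \<Sigma>" and sub: "\<tau> \<subseteq> \<sigma>" using p by (auto simp: affine_chart_def \<tau>)
      have reg: "m - x0 \<in> regular_chars \<tau>" if "m \<in> lattice_points Q" for m
        using x0(2)[OF that] sub unfolding regular_chars_def by blast
      text \<open>Two local generators at a point differ by a unit.\<close>
      have change: "(\<Sum>m\<in>Poly_Mapping.keys s. Poly_Mapping.lookup s m * x (m - y)) = 0 \<longleftrightarrow>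
          (\<Sum>m\<in>Poly_Mapping.keys s. Poly_Mapping.lookup s m * x (m - x0)) = 0"
        if y: "y \<in> lattice_points Q" "\<forall>m\<in>lattice_points Q. m - y \<in> regular_chars \<tau>" for y
      proof -
        have diff: "pairing (m - n) w = pairing m w - pairing n w" for m n w
          by (simp add: pairing_def algebra_simps)
        have eq: "pairing x0 w = pairing y w" if "w \<in> \<tau>" for w
        proof -
          have "pairing (x0 - y) w \<le> 0" "pairing (y - x0) w \<le> 0"
            using y(2) x0(1) reg[OF y(1)] that unfolding regular_chars_def by blast+
          then show ?thesis by (simp add: diff)
        qed
        have inv: "x0 - y \<in> invertible_chars \<tau>" unfolding invertible_chars_def using eq by (simp add: diff)
        then have unit: "x (x0 - y) \<noteq> 0" using toric_surface_nonzero_iff[OF surf] by blast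
        have "x (m - y) = x (m - x0) * x (x0 - y)" for m
        proof (cases "m - x0 \<in> invertible_chars \<tau>")
          case True
          have "x ((m - x0) + (x0 - y)) = x (m - x0) * x (x0 - y)" by (rule toric_surface_mult[OF surf True inv])
          then show ?thesis by simp
        next
          case False
          then have "m - y \<notin> invertible_chars \<tau>" unfolding invertible_chars_def using eq by (simp add: diff)
          then have "x (m - y) = 0" "x (m - x0) = 0" using False toric_surface_nonzero_iff[OF surf] by blast+
          then show ?thesis by simp
        qed
        then have "Poly_Mapping.lookup s m * x (m - y) = Poly_Mapping.lookup s m * x (m - x0) * x (x0 - y)" for m
          by (metis mult.assoc)
        then have "(\<Sum>m\<in>Poly_Mapping.keys s. Poly_Mapping.lookup s m * x (m - y)) =
            (\<Sum>m\<in>Poly_Mapping.keys s. Poly_Mapping.lookup s m * x (m - x0)) * x (x0 - y)"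
          unfolding sum_distrib_right by (intro sum.cong refl)
        then show ?thesis using unit by simp
      qed
      show ?thesis
      proof
        assume "p \<in> zero_locus \<Sigma> Q s"
        then obtain y where "y \<in> lattice_points Q" "\<forall>m\<in>lattice_points Q. m - y \<in> regular_chars \<tau>"
          "(\<Sum>m\<in>Poly_Mapping.keys s. Poly_Mapping.lookup s m * x (m - y)) = 0"
          unfolding zero_locus_def \<tau> by blast
        then show "regular_value f p = 0" using change by (simp add: \<tau> val)
      next
        assume "regular_value f p = 0"
        then have "(\<Sum>m\<in>Poly_Mapping.keys s. Poly_Mapping.lookup s m * x (m - x0)) = 0" by (simp add: \<tau> val)
        then show "p \<in> zero_locus \<Sigma> Q s" unfolding zero_locus_def \<tau> using surf x0(1) reg by blast
      qed
    qed
    then show "zero_locus \<Sigma> Q s \<inter> affine_chart \<Sigma> \<sigma> = {p \<in> affine_chart \<Sigma> \<sigma>. \<forall>f\<in>{f}. regular_value f p = 0}"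
      by auto
  qed
qed

text \<open>An irreducible curve that meets the torus is the closure of its part in the torus.\<close>

lemma zero_locus_determined_by_torus:
  assumes fan: "smooth_complete_fan \<Sigma>"
    and Q: "lattice_points Q \<noteq> {}" and irr: "zariski_irreducible \<Sigma> (zero_locus \<Sigma> Q s)" and ne: "zeros s \<noteq> {}"
    and R: "lattice_polygon R" "outer_edge_normals R \<subseteq> fan_rays \<Sigma>" "t \<in> sections_of R"
    and sub: "zeros s \<subseteq> zeros t"
  shows "zero_locus \<Sigma> Q s \<subseteq> zero_locus \<Sigma> R t"
proof -
  note e = zero_cone_in_fan[OF fan]
  \<comment> \<open>\<open>closed_with_boundary \<Sigma> 1\<close> is exactly the boundary, as 1 has
    no zeros in the torus.\<close>
  have "zero_locus \<Sigma> Q s \<subseteq> zero_locus \<Sigma> R t \<union> closed_with_boundary \<Sigma> 1"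
  proof
    fix p assume p: "p \<in> zero_locus \<Sigma> Q s"
    obtain \<tau> x where \<tau>: "p = (\<tau>, x)" by fastforce
    have surf: "(\<tau>, x) \<in> toric_surface \<Sigma>" using p zero_locus_subset_surface \<tau> by blast
    show "p \<in> zero_locus \<Sigma> R t \<union> closed_with_boundary \<Sigma> 1"
    proof (cases "\<tau> = {}")
      case True
      then obtain a b where ab: "a \<noteq> 0" "b \<noteq> 0" "p = torus_point a b" using torus_cone_point surf \<tau> by metis
      then have "(a, b) \<in> zeros t" using p sub torus_point_in_zero_locus[OF e Q] by blast
      then show ?thesis using torus_point_in_zero_locus[OF e lattice_polygon_nonempty[OF R(1)]] ab by blast
    next
      case False
      then show ?thesis using surf by (simp add: closed_with_boundary_def \<tau>)
    qed
  qed
  then have "zero_locus \<Sigma> Q s \<subseteq> zero_locus \<Sigma> R t \<or> zero_locus \<Sigma> Q s \<subseteq> closed_with_boundary \<Sigma> 1"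
    using irr zariski_closed_with_boundary[OF fan] zariski_closed_zero_locus[OF R(1) fan R(2,3)]
    unfolding zariski_irreducible_def by blast
  moreover have "\<not> zero_locus \<Sigma> Q s \<subseteq> closed_with_boundary \<Sigma> 1"
  proof
    assume bd: "zero_locus \<Sigma> Q s \<subseteq> closed_with_boundary \<Sigma> 1"
    obtain a b where ab: "(a, b) \<in> zeros s" using ne by auto
    then have nz: "a \<noteq> 0" "b \<noteq> 0" by (auto simp: zeros_def)
    then have "torus_point a b \<in> closed_with_boundary \<Sigma> 1" using bd torus_point_in_zero_locus[OF e Q] ab by blast
    then show False using torus_point_in_closed_with_boundary[OF e nz] by simp
  qed
  ultimately show ?thesis by blast
qed

lemma zeros_nonempty_if_meets_torus:
  assumes fan: "smooth_complete_fan \<Sigma>" and Q: "lattice_points Q \<noteq> {}"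
    and ne: "zero_locus \<Sigma> Q s \<inter> open_torus \<Sigma> \<noteq> {}"
  shows "zeros s \<noteq> {}"
proof -
  obtain p where p: "p \<in> zero_locus \<Sigma> Q s" "p \<in> open_torus \<Sigma>" using ne by blast
  obtain \<tau> x where \<tau>: "p = (\<tau>, x)" by fastforce
  have "\<tau> = {}" "(\<tau>, x) \<in> toric_surface \<Sigma>" using p(2) by (auto simp: open_torus_def affine_chart_def \<tau>)
  then obtain a b where ab: "a \<noteq> 0" "b \<noteq> 0" "p = torus_point a b" using torus_cone_point \<tau> by metis
  then have "(a, b) \<in> zeros s" using p(1) torus_point_in_zero_locus[OF zero_cone_in_fan[OF fan] Q] by blast
  then show ?thesis by blast
qed

section \<open>The Frobenius map on the algebraic closure\<close>

text \<open>The map \<open>x \<mapsto> x\<^sup>q\<close> is additive on the algebraic closure since the binomial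
  coefficients vanish: \<open>(X + 1)\<^sup>q - X\<^sup>q - 1\<close> has degree less than \<open>q\<close> and \<open>q\<close> zeros.\<close>

lemma power_card_pow: "(x :: 'k::{field,finite}) ^ CARD('k) = x"
proof (cases "x = 0")
  case False
  have "(\<Prod>y\<in>UNIV - {0}. x * y) = (\<Prod>y\<in>UNIV - {0}. y)"
    by (rule prod.reindex_bij_witness[of _ "\<lambda>y. y / x" "\<lambda>y. x * y"]) (use False in auto)
  then have "x ^ (CARD('k) - 1) * (\<Prod>y\<in>UNIV - {0 :: 'k}. y) = 1 * (\<Prod>y\<in>UNIV - {0 :: 'k}. y)"
    by (simp add: prod.distrib)
  moreover have "(\<Prod>y\<in>UNIV - {0 :: 'k}. y) \<noteq> 0" by simp
  ultimately have "x ^ (CARD('k) - 1) = 1" by (metis mult_cancel_right)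
  then have "x * x ^ (CARD('k) - 1) = x" by simp
  moreover have "CARD('k) = Suc (CARD('k) - 1)" by simp
  ultimately show ?thesis by (metis power_Suc)
qed simp

lemma of_nat_binomial_card:
  assumes "0 < i" "i < CARD('k::{field,finite})"
  shows "(of_nat (CARD('k) choose i) :: 'k) = 0"
proof -
  let ?q = "CARD('k)"
  define p where "p = (\<Sum>i = 1..<?q. monom (of_nat (?q choose i) :: 'k) i)"
  have "poly p x = 0" for x
  proof -
    have "x + 1 = (x + 1) ^ ?q" by (simp add: power_card_pow)
    also have "\<dots> = (\<Sum>i\<le>?q. of_nat (?q choose i) * x ^ i)" by (simp add: binomial_ring)
    also have "{..?q} = insert 0 (insert ?q {1..<?q})" by auto
    also have "(\<Sum>i\<in>insert 0 (insert ?q {1..<?q}). of_nat (?q choose i) * x ^ i) =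
        1 + (x ^ ?q + (\<Sum>i = 1..<?q. of_nat (?q choose i) * x ^ i))"
      by (subst sum.insert; simp)
    also have "x ^ ?q = x" by (rule power_card_pow)
    finally show ?thesis by (simp add: p_def poly_sum poly_monom)
  qed
  then have "{x. poly p x = 0} = UNIV" by blast
  have "p = 0"
  proof (rule ccontr)
    assume "p \<noteq> 0"
    then have "card {x. poly p x = 0} \<le> degree p" by (rule card_poly_roots_bound)
    moreover have "degree p < ?q"
    proof -
      have "degree p \<le> ?q - 1" unfolding p_def
        by (rule degree_sum_le) (auto intro: order_trans[OF degree_monom_le])
      then show ?thesis using assms by linarith
    qed
    ultimately show False using \<open>{x. poly p x = 0} = UNIV\<close> by simp
  qed
  then have "coeff p i = 0" by simp
  moreover have "coeff p i = (of_nat (?q choose i) :: 'k)" using assms by (simp add: p_def coeff_sum)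
  ultimately show ?thesis by simp
qed

lemma power_card_add:
  "(x + y :: 'k::{field,finite} alg_closure) ^ CARD('k) = x ^ CARD('k) + y ^ CARD('k)"
proof -
  let ?q = "CARD('k)"
  have q: "?q > 0" by simp
  have "(x + y) ^ ?q = (\<Sum>i\<le>?q. of_nat (?q choose i) * x ^ i * y ^ (?q - i))" by (rule binomial_ring)
  also have "{..?q} = insert 0 (insert ?q {1..<?q})" by auto
  also have "(\<Sum>i\<in>insert 0 (insert ?q {1..<?q}). of_nat (?q choose i) * x ^ i * y ^ (?q - i)) =
      y ^ ?q + (x ^ ?q + (\<Sum>i = 1..<?q. of_nat (?q choose i) * x ^ i * y ^ (?q - i)))"
    using q by (subst sum.insert; simp)
  also have "(\<Sum>i = 1..<?q. of_nat (?q choose i) * x ^ i * y ^ (?q - i)) = 0"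
  proof (rule sum.neutral, rule ballI)
    fix i assume "i \<in> {1..<?q}"
    then have "to_ac (of_nat (?q choose i) :: 'k) = 0" using of_nat_binomial_card[of i, where 'k = 'k] by simp
    then show "of_nat (?q choose i) * x ^ i * y ^ (?q - i) = 0" by simp
  qed
  finally show ?thesis by (simp add: add.commute)
qed

text \<open>The image of the finite field consists of \<open>q\<close> fixed points, and
  \<open>X^q - X\<close> has at most \<open>q\<close> roots.\<close>

lemma fixed_points_alg_closure:
  "{x :: 'k::{field,finite} alg_closure. x ^ CARD('k) = x} = range to_ac" (is "?F = ?R")
proof -
  let ?q = "CARD('k)"
  have "?R \<subseteq> ?F" by (auto simp: power_card_pow simp flip: to_ac_power)
  moreover have "card ?R = ?q" by (rule card_image[OF inj_to_ac])
  moreover have "finite ?F \<and> card ?F \<le> ?q"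
  proof -
    have "CARD('k) \<ge> 2"
    proof -
      have "card {0, 1 :: 'k} \<le> CARD('k)" by (rule card_mono) auto
      then show ?thesis by simp
    qed
    define p :: "'k alg_closure poly" where "p = monom 1 ?q + [:0, - 1:]"
    have deg: "degree p = ?q"
      unfolding p_def using \<open>?q \<ge> 2\<close> by (subst degree_add_eq_left) (auto simp: degree_monom_eq)
    then have "p \<noteq> 0" using \<open>?q \<ge> 2\<close> by auto
    then have "card {x. poly p x = 0} \<le> ?q" "finite {x. poly p x = 0}"
      using card_poly_roots_bound[of p] poly_roots_finite[of p] deg by auto
    moreover have "{x. poly p x = 0} = ?F" by (auto simp: p_def poly_monom)
    ultimately show ?thesis by simp
  qed
  ultimately show ?thesis by (metis card_subset_eq card_mono le_antisym)
qed

lemma lookup_map_to_ac: "Poly_Mapping.lookup (Poly_Mapping.map to_ac s) m = to_ac (Poly_Mapping.lookup s m)"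
  by (simp add: map.rep_eq when_def)

lemma keys_map_to_ac: "Poly_Mapping.keys (Poly_Mapping.map to_ac s) = Poly_Mapping.keys s"
  by (simp add: set_eq_iff in_keys_iff lookup_map_to_ac)

lemma keys_eq_empty_laurent: "Poly_Mapping.keys (f :: 'k::field laurent) = {} \<longleftrightarrow> f = 0"
  by (auto simp: in_keys_iff set_eq_iff intro!: poly_mapping_eqI)

lemma to_ac_power_int: "to_ac (x powi n) = to_ac x powi n"
  by (simp add: power_int_def)

lemma laurent_eval_map_to_ac:
  "laurent_eval (Poly_Mapping.map to_ac s) (to_ac a, to_ac b) = to_ac (laurent_eval s (a, b))"
  by (simp add: laurent_eval_def keys_map_to_ac lookup_map_to_ac torus_char_def to_ac_sum to_ac_power_int)

lemma card_zeros_eq_rational_points: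
  fixes s :: "'k::{field,finite} laurent"
  shows "card (zeros s) = card (rational_points CARD('k) (zeros (Poly_Mapping.map to_ac s)))"
proof -
  have mem: "(to_ac a, to_ac b) \<in> zeros (Poly_Mapping.map to_ac s) \<longleftrightarrow> (a, b) \<in> zeros s" for a b
    by (simp add: zeros_def laurent_eval_map_to_ac)
  have "rational_points CARD('k) (zeros (Poly_Mapping.map to_ac s)) = map_prod to_ac to_ac ` zeros s"
  proof (intro equalityI subsetI)
    fix p assume "p \<in> rational_points CARD('k) (zeros (Poly_Mapping.map to_ac s))"
    then obtain x y where xy: "p = (x, y)" "(x, y) \<in> zeros (Poly_Mapping.map to_ac s)"
      "x ^ CARD('k) = x" "y ^ CARD('k) = y" by (auto simp: rational_points_def)
    then obtain a b where "x = to_ac a" "y = to_ac b"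
      using fixed_points_alg_closure[where 'k = 'k] by blast
    then show "p \<in> map_prod to_ac to_ac ` zeros s" using xy mem by force
  next
    fix p assume "p \<in> map_prod to_ac to_ac ` zeros s"
    then obtain a b where "p = (to_ac a, to_ac b)" "(a, b) \<in> zeros s" by auto
    then show "p \<in> rational_points CARD('k) (zeros (Poly_Mapping.map to_ac s))"
      using mem by (simp add: rational_points_def power_card_pow flip: to_ac_power)
  qed
  moreover have "inj_on (map_prod to_ac to_ac) (zeros s)" by (auto simp: inj_on_def)
  ultimately show ?thesis by (simp add: card_image)
qed

lemma map_to_ac_add:
  "Poly_Mapping.map to_ac (f + g) = Poly_Mapping.map to_ac f + Poly_Mapping.map to_ac (g :: 'k::field laurent)"
  by (rule poly_mapping_eqI) (simp add: lookup_map_to_ac lookup_add)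

lemma map_to_ac_single: "Poly_Mapping.map to_ac (Poly_Mapping.single m c) = Poly_Mapping.single m (to_ac c)"
  by (rule poly_mapping_eqI) (simp add: lookup_map_to_ac lookup_single when_def)

lemma map_to_ac_mult:
  "Poly_Mapping.map to_ac (f * g) = Poly_Mapping.map to_ac f * Poly_Mapping.map to_ac (g :: 'k::field laurent)"
proof (induction f rule: laurent_induct)
  case (single m c)
  show ?case
  proof (induction g rule: laurent_induct)
    case (single n d)
    show ?case by (simp add: mult_single map_to_ac_single)
  next
    case (add f g)
    then show ?case by (simp add: map_to_ac_add distrib_left)
  qed
next
  case (add f h)
  then show ?case by (simp add: map_to_ac_add distrib_right)
qed

lemma map_to_ac_prod: "finite I \<Longrightarrow> Poly_Mapping.map to_ac (\<Prod>i\<in>I. f i) = (\<Prod>i\<in>I. Poly_Mapping.map to_ac (f i :: 'k::field laurent))"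
proof (induction I rule: finite_induct)
  case empty
  show ?case by (rule poly_mapping_eqI) (simp add: lookup_map_to_ac lookup_one when_def)
qed (simp add: map_to_ac_mult)

lemma frobenius_fixed_alg_closure:
  "frobenius_fixed TYPE('k alg_closure) CARD('k::{field,finite})"
proof
  show "(x + y) ^ CARD('k) = x ^ CARD('k) + y ^ CARD('k)" for x y :: "'k alg_closure" by (rule power_card_add)
  show "card {x :: 'k alg_closure. x ^ CARD('k) = x} = CARD('k)"
    unfolding fixed_points_alg_closure by (rule card_image[OF inj_to_ac])
qed simp

section \<open>Combining the bounds of all components\<close>

lemma nontrivial_two_lattice_points:
  assumes "nontrivial_lattice_polygon Q"
  obtains m n where "m \<in> lattice_points Q" "n \<in> lattice_points Q" "m \<noteq> n"
proof -
  have Q: "lattice_polygon Q" "\<not> is_singleton Q" using assms by (auto simp: nontrivial_lattice_polygon_def)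
  obtain m where m: "m \<in> lattice_points Q" using lattice_polygon_nonempty[OF Q(1)] by blast
  have "lattice_points Q \<noteq> {m}"
  proof
    assume "lattice_points Q = {m}"
    then have "Q = {lat m}" using lattice_polygon_hull[OF Q(1)] by simp
    then show False using Q(2) by (simp add: is_singleton_def)
  qed
  then show thesis using that m by blast
qed

text \<open>Fixed elements of the algebraic closure are those of the finite field. So the
  coefficients of \<open>t\<close> are fixed, and a conic with fixed coefficients inherits a
  rational point from the finite field.\<close>

lemma genus_zero_bounds:
  fixes s :: "'k::{field,finite} laurent"
  defines "t \<equiv> Poly_Mapping.map to_ac s"
  assumes Q: "nontrivial_lattice_polygon Q" "num_interior_points Q = 0"
    and s: "s \<in> sections_of Q" "s \<noteq> 0" and irr: "irreducible_zeros (zeros t)"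
  shows "frobenius_fixed.step_bound CARD('k) Q (zeros t)"
    "card (rational_points CARD('k) (zeros t)) \<le> CARD('k) + 1"
proof -
  interpret frobenius_fixed "CARD('k)" "TYPE('k alg_closure)" by (rule frobenius_fixed_alg_closure)
  have poly: "lattice_polygon Q" using Q(1) by (simp add: nontrivial_lattice_polygon_def)
  obtain m n where mn: "m \<in> lattice_points Q" "n \<in> lattice_points Q" "m \<noteq> n"
    using nontrivial_two_lattice_points[OF Q(1)] by blast
  have keys: "Poly_Mapping.keys t \<subseteq> lattice_points Q"
    using s(1) by (simp add: t_def keys_map_to_ac sections_of_def)
  have t0: "t \<noteq> 0"
  proof
    assume "t = 0"
    then have "Poly_Mapping.lookup s m = 0" for m using lookup_map_to_ac[of s m] by (simp add: t_def)
    then have "s = 0" by (intro poly_mapping_eqI) simp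
    then show False using s(2) by simp
  qed
  have fixed_iff: "fixed x \<longleftrightarrow> x \<in> range to_ac" for x :: "'k alg_closure"
    unfolding fixed_def using fixed_points_alg_closure[where 'k = 'k] by blast
  have fixed: "fixed (Poly_Mapping.lookup t m)" for m by (simp add: fixed_iff t_def lookup_map_to_ac)
  have point: "\<exists>u v w. fixed u \<and> fixed v \<and> fixed w \<and> (u, v, w) \<noteq> (0, 0, 0) \<and> ternary_form a b c d e g u v w = 0"
    if "fixed a" "fixed b" "fixed c" "fixed d" "fixed e" "fixed g" for a b c d e g :: "'k alg_closure"
  proof -
    obtain a' b' c' d' e' g' where eq: "a = to_ac a'" "b = to_ac b'" "c = to_ac c'" "d = to_ac d'"
      "e = to_ac e'" "g = to_ac g'" using \<open>fixed a\<close> \<open>fixed b\<close> \<open>fixed c\<close> \<open>fixed d\<close> \<open>fixed e\<close> \<open>fixed g\<close>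
      unfolding fixed_iff by (elim rangeE)
    obtain u v w where uvw: "(u, v, w) \<noteq> (0, 0, 0)" "ternary_form a' b' c' d' e' g' u v w = 0"
      using conic_rational_point[of a' b' c' d' e' g'] by blast
    have "ternary_form a b c d e g (to_ac u) (to_ac v) (to_ac w) = to_ac (ternary_form a' b' c' d' e' g' u v w)"
      by (simp add: ternary_form_def eq)
    then show ?thesis using uvw
      by (intro exI[of _ "to_ac u"] exI[of _ "to_ac v"] exI[of _ "to_ac w"]) (simp add: fixed_iff)
  qed
  note b = hollow_bounds[OF poly hollow_lattice_points[OF poly Q(2)] mn keys t0 irr fixed point]
  show "step_bound Q (zeros t)" using b(1) by blast
  show "card (rational_points CARD('k) (zeros t)) \<le> CARD('k) + 1" using b(2) by blast
qed

lemma keys_prod_subset: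
  fixes f :: "nat \<Rightarrow> 'k::field laurent"
  assumes "\<And>i. i \<in> {1..n} \<Longrightarrow> Poly_Mapping.keys (f i) \<subseteq> lattice_points (P i)"
  shows "Poly_Mapping.keys (\<Prod>i=1..n. f i) \<subseteq> lattice_points (\<Sum>i=1..n. P i)"
  using assms
proof (induction n)
  case 0
  show ?case by (simp add: lattice_points_def lat_def zero_prod_def[symmetric])
next
  case (Suc n)
  have IH: "Poly_Mapping.keys (\<Prod>i=1..n. f i) \<subseteq> lattice_points (\<Sum>i=1..n. P i)"
    by (rule Suc.IH) (use Suc.prems in simp)
  show ?case
  proof
    fix k assume "k \<in> Poly_Mapping.keys (\<Prod>i=1..Suc n. f i)"
    then have "k \<in> Poly_Mapping.keys ((\<Prod>i=1..n. f i) * f (Suc n))" by (simp add: mult.commute)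
    then obtain a b where "a \<in> Poly_Mapping.keys (\<Prod>i=1..n. f i)" "b \<in> Poly_Mapping.keys (f (Suc n))" "k = a + b"
      using keys_mult[of "\<Prod>i=1..n. f i" "f (Suc n)"] by blast
    then have "k \<in> lattice_points ((\<Sum>i=1..n. P i) + P (Suc n))"
      using IH Suc.prems[of "Suc n"] lattice_points_plus by (simp, blast)
    then show "k \<in> lattice_points (\<Sum>i=1..Suc n. P i)" by (simp add: add.commute)
  qed
qed

lemma lattice_polygon_sum:
  assumes "\<And>i. i \<in> {1..n} \<Longrightarrow> lattice_polygon (P i)"
  shows "lattice_polygon (\<Sum>i=1..n::nat. P i)"
  using assms
proof (induction n)
  case 0
  have "(0 :: (real \<times> real) set) = convex hull (lat ` {(0, 0)})" by (simp add: lat_def zero_prod_def)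
  then show ?case unfolding lattice_polygon_def by (intro exI[of _ "{(0, 0)}"]) simp
next
  case (Suc n)
  have "lattice_polygon (\<Sum>i=1..n. P i)" by (rule Suc.IH) (use Suc.prems in simp)
  then have "lattice_polygon ((\<Sum>i=1..n. P i) + P (Suc n))"
    using Suc.prems[of "Suc n"] by (intro lattice_polygon_plus) auto
  then show ?case by (simp add: add.commute)
qed

text \<open>Each new factor contributes at least \<open>q\<close> new rational points, up to the increase of the number
  of lattice points.\<close>

lemma (in frobenius_fixed) product_lower:
  assumes P: "\<And>i. i \<in> {1..n} \<Longrightarrow> lattice_polygon (P i)"
    and f: "\<And>i. i \<in> {1..n} \<Longrightarrow> Poly_Mapping.keys (f i) \<subseteq> lattice_points (P i)"
    and step: "\<And>i. i \<in> {1..n} \<Longrightarrow> step_bound (P i) (zeros (f i))"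
    and irr: "\<And>i. i \<in> {1..n} \<Longrightarrow> irreducible_zeros (zeros (f i))"
    and distinct: "\<And>i j. i \<in> {1..n} \<Longrightarrow> j \<in> {1..n} \<Longrightarrow> i \<noteq> j \<Longrightarrow> \<not> zeros (f i) \<subseteq> zeros (f j)"
  shows "n * q + 1 \<le> card (rational_points q (zeros (\<Prod>i=1..n. f i))) +
    card (lattice_points (\<Sum>i=1..n::nat. P i))"
  using assms
proof (induction n)
  case 0
  \<comment> \<open>The empty sum is the origin, whose one lattice point is the source of the 1 in
    the bound.\<close>
  have "lattice_points (0 :: (real \<times> real) set) = {0}"
    by (auto simp: lattice_points_def lat_def zero_prod_def prod_eq_iff)
  then show ?case by simp
next
  case (Suc n)
  let ?f = "\<Prod>i=1..n. f i" and ?Q = "\<Sum>i=1..n. P i" and ?g = "f (Suc n)"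
  have IH: "n * q + 1 \<le> card (rational_points q (zeros ?f)) + card (lattice_points ?Q)"
    by (rule Suc.IH) (use Suc.prems in auto)
  have Q: "lattice_polygon ?Q" by (rule lattice_polygon_sum) (use Suc.prems in auto)
  have keys: "Poly_Mapping.keys ?f \<subseteq> lattice_points ?Q" by (rule keys_prod_subset) (use Suc.prems in auto)
  have irrg: "irreducible_zeros (zeros ?g)" using Suc.prems by auto
  \<comment> \<open>An irreducible curve inside the union of the earlier ones would lie inside one
    of them.\<close>
  have "\<not> zeros ?g \<subseteq> zeros ?f"
  proof
    assume "zeros ?g \<subseteq> zeros ?f"
    then obtain i where "i \<in> {1..n}" "zeros ?g \<subseteq> zeros (f i)"
      using irreducible_zeros_prod[OF irrg finite_atLeastAtMost] by metis
    then show False using Suc.prems(5)[of "Suc n" i] by auto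
  qed
  then have s: "q + card (lattice_points ?Q) \<le>
      card (rational_points q (zeros ?g - zeros ?f)) + card (lattice_points (?Q + P (Suc n)))"
    using Suc.prems(3)[of "Suc n"] Q keys unfolding step_bound_def by auto
  have "rational_points q (zeros (?f * ?g)) =
      rational_points q (zeros ?f) \<union> rational_points q (zeros ?g - zeros ?f)"
    unfolding zeros_mult by (auto simp: rational_points_def)
  moreover have "rational_points q (zeros ?f) \<inter> rational_points q (zeros ?g - zeros ?f) = {}"
    by (auto simp: rational_points_def)
  ultimately have "card (rational_points q (zeros (?f * ?g))) =
      card (rational_points q (zeros ?f)) + card (rational_points q (zeros ?g - zeros ?f))"
    using finite_rational_points[OF card_fixed q_pos] by (simp add: card_Un_disjoint)
  moreover have "(\<Prod>i=1..Suc n. f i) = ?f * ?g" "(\<Sum>i=1..Suc n. P i) = ?Q + P (Suc n)"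
    by (simp_all add: mult.commute add.commute)
  ultimately show ?case using IH s by simp
qed

lemma (in frobenius_fixed) product_upper:
  fixes f :: "nat \<Rightarrow> 'a laurent"
  assumes "\<And>i. i \<in> {1..n} \<Longrightarrow> card (rational_points q (zeros (f i))) \<le> q + 1"
  shows "card (rational_points q (zeros (\<Prod>i=1..n. f i))) \<le> n * (q + 1)"
proof -
  have "rational_points q (zeros (\<Prod>i=1..n. f i)) = (\<Union>i\<in>{1..n}. rational_points q (zeros (f i)))"
    by (auto simp: zeros_prod rational_points_def)
  then have "card (rational_points q (zeros (\<Prod>i=1..n. f i))) \<le> (\<Sum>i=1..n. card (rational_points q (zeros (f i))))"
    by (simp add: card_UN_le)
  also have "\<dots> \<le> (\<Sum>i=1..n. q + 1)" by (intro sum_mono assms)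
  finally show ?thesis by simp
qed

theorem corollary5p3:
  fixes P :: "(real \<times> real) set"
    and P' P'' :: "nat \<Rightarrow> (real \<times> real) set"
    and s' s'' :: "nat \<Rightarrow> 'k::{field,finite} laurent"
    and g' g'' :: "nat \<Rightarrow> int"
    and \<Sigma> :: "lattice_cone set"
    and m l :: nat
  assumes "lattice_polygon P" and "num_interior_points P > 0"
    and "\<forall>i\<in>{1..m}. nontrivial_lattice_polygon (P' i)"
    and "\<forall>k\<in>{1..l}. nontrivial_lattice_polygon (P'' k)"
    and "(\<Sum>i=1..m. P' i) \<subseteq> P" and "(\<Sum>k=1..l. P'' k) \<subseteq> P"
    and "smooth_complete_fan \<Sigma>" and "refines_outer_normal_fan \<Sigma> P"
    and "\<forall>i\<in>{1..m}. outer_edge_normals (P' i) \<subseteq> fan_rays \<Sigma>"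
    and "\<forall>k\<in>{1..l}. outer_edge_normals (P'' k) \<subseteq> fan_rays \<Sigma>"
    and "\<forall>i\<in>{1..m}. s' i \<in> sections_of (P' i) \<and> s' i \<noteq> 0"
    and "\<forall>k\<in>{1..l}. s'' k \<in> sections_of (P'' k) \<and> s'' k \<noteq> 0"
    and "\<forall>i\<in>{1..m}. zariski_irreducible \<Sigma> (geometric_zero_locus \<Sigma> (P' i) (s' i))"
    and "\<forall>k\<in>{1..l}. zariski_irreducible \<Sigma> (geometric_zero_locus \<Sigma> (P'' k) (s'' k))"
    and distinct_curves: "\<forall>i\<in>{1..m}. \<forall>j\<in>{1..m}. i \<noteq> j \<longrightarrow>
      geometric_zero_locus \<Sigma> (P' i) (s' i) \<noteq> geometric_zero_locus \<Sigma> (P' j) (s' j)"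
    and not_boundary:
      "\<forall>i\<in>{1..m}. geometric_zero_locus \<Sigma> (P' i) (s' i) \<inter> open_torus \<Sigma> \<noteq> {}"
    and "\<forall>i\<in>{1..m}. g' i = arithmetic_genus \<Sigma> (polygon_divisor (P' i))"
    and "\<forall>k\<in>{1..l}. g'' k = arithmetic_genus \<Sigma> (polygon_divisor (P'' k))"
    and "m > l"
    and "\<forall>i\<in>{1..m}. g' i = int (num_interior_points (P' i)) \<and> num_interior_points (P' i) = 0"
    and "\<forall>k\<in>{1..l}. g'' k = int (num_interior_points (P'' k)) \<and> num_interior_points (P'' k) = 0"
    and "CARD('k) > num_lattice_points P + m"
  shows "card (torus_zeros (\<Prod>i=1..m. s' i)) > card (torus_zeros (\<Prod>k=1..l. s'' k))"
proof -
  interpret frobenius_fixed "CARD('k)" "TYPE('k alg_closure)" by (rule frobenius_fixed_alg_closure)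
  let ?q = "CARD('k)"
  define t' t'' where "t' i = Poly_Mapping.map to_ac (s' i)" and "t'' k = Poly_Mapping.map to_ac (s'' k)" for i k
  note fan = \<open>smooth_complete_fan \<Sigma>\<close>
  have P': "lattice_polygon (P' i)" if "i \<in> {1..m}" for i
    using assms(3) that by (simp add: nontrivial_lattice_polygon_def)
  have P'': "lattice_polygon (P'' k)" if "k \<in> {1..l}" for k
    using assms(4) that by (simp add: nontrivial_lattice_polygon_def)
  have ne': "zeros (t' i) \<noteq> {}" if "i \<in> {1..m}" for i
    by (rule zeros_nonempty_if_meets_torus[OF fan lattice_polygon_nonempty[OF P'[OF that]]])
      (use bspec[OF not_boundary that] in \<open>simp add: t'_def geometric_zero_locus_def\<close>)
  have zirr': "zariski_irreducible \<Sigma> (zero_locus \<Sigma> (P' i) (t' i))" if "i \<in> {1..m}" for i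
    using assms(13) that by (simp add: t'_def geometric_zero_locus_def)
  have irr': "irreducible_zeros (zeros (t' i))" if "i \<in> {1..m}" for i
    by (rule irreducible_zeros_of_zariski[OF fan lattice_polygon_nonempty[OF P'[OF that]] zirr'[OF that] ne'[OF that]])
  have sec': "t' i \<in> sections_of (P' i)" if "i \<in> {1..m}" for i
    using assms(11) that by (simp add: t'_def sections_of_def keys_map_to_ac)
  have t'0: "t' i \<noteq> 0" if "i \<in> {1..m}" for i
    using assms(11) that unfolding t'_def by (metis keys_map_to_ac keys_zero keys_eq_empty_laurent)
  \<comment> \<open>One inclusion in the torus implies the reverse one; both pass to the closures on
    the surface and make the two curves equal.\<close>
  have distinct: "\<not> zeros (t' i) \<subseteq> zeros (t' j)" if ij: "i \<in> {1..m}" "j \<in> {1..m}" "i \<noteq> j" for i j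
  proof
    assume sub: "zeros (t' i) \<subseteq> zeros (t' j)"
    have sub': "zeros (t' j) \<subseteq> zeros (t' i)"
      by (rule irreducible_zeros_antisym[OF irr'[OF ij(1)] irr'[OF ij(2)] t'0[OF ij(2)] sub])
    have "zero_locus \<Sigma> (P' a) (t' a) \<subseteq> zero_locus \<Sigma> (P' b) (t' b)"
      if ab: "a \<in> {1..m}" "b \<in> {1..m}" "zeros (t' a) \<subseteq> zeros (t' b)" for a b
      using zero_locus_determined_by_torus[OF fan lattice_polygon_nonempty[OF P'[OF ab(1)]] zirr'[OF ab(1)]
          ne'[OF ab(1)] P'[OF ab(2)] _ sec'[OF ab(2)] ab(3)] assms(9) ab(2) by blast
    then have "zero_locus \<Sigma> (P' i) (t' i) = zero_locus \<Sigma> (P' j) (t' j)" using ij sub sub' by blast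
    then show False using distinct_curves ij by (simp add: t'_def geometric_zero_locus_def)
  qed
  have lower: "m * ?q + 1 \<le> card (rational_points ?q (zeros (\<Prod>i=1..m. t' i))) + card (lattice_points (\<Sum>i=1..m. P' i))"
  proof (rule product_lower)
    show "step_bound (P' i) (zeros (t' i))" if "i \<in> {1..m}" for i
      using genus_zero_bounds(1)[of "P' i" "s' i"] assms(3,11,20) irr'[OF that] that by (simp add: t'_def)
    show "Poly_Mapping.keys (t' i) \<subseteq> lattice_points (P' i)" if "i \<in> {1..m}" for i
      using sec'[OF that] by (simp add: sections_of_def)
  qed (use P' irr' distinct in blast)+
  have upper: "card (rational_points ?q (zeros (\<Prod>k=1..l. t'' k))) \<le> l * (?q + 1)"
  proof (rule product_upper)
    fix k assume k: "k \<in> {1..l}"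
    \<comment> \<open>A component of \<open>s''\<close> may lie in the boundary of the surface; it
      then contributes no point.\<close>
    show "card (rational_points ?q (zeros (t'' k))) \<le> ?q + 1"
    proof (cases "zeros (t'' k) = {}")
      case True
      then show ?thesis by (simp add: rational_points_def)
    next
      case False
      have "zariski_irreducible \<Sigma> (zero_locus \<Sigma> (P'' k) (t'' k))"
        using assms(14) k by (simp add: t''_def geometric_zero_locus_def)
      then have "irreducible_zeros (zeros (t'' k))"
        using irreducible_zeros_of_zariski[OF fan lattice_polygon_nonempty[OF P''[OF k]] _ False] by blast
      then show ?thesis
        using genus_zero_bounds(2)[of "P'' k" "s'' k"] assms(4,12,21) k by (simp add: t''_def)
    qed
  qed
  have "card (lattice_points (\<Sum>i=1..m. P' i)) \<le> num_lattice_points P"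
    unfolding num_lattice_points_def by (rule card_lattice_points_mono[OF assms(1,5)])
  \<comment> \<open>With \<open>m = l + 1 + d\<close>, the case \<open>d = 0\<close> reads
    \<open>l + #(P) < q + 1\<close>; a larger \<open>d\<close> adds multiples of \<open>q\<close> on
    the right.\<close>
  moreover have "l * (?q + 1) + num_lattice_points P < m * ?q + 1"
  proof -
    obtain d where d: "m = l + 1 + d" using \<open>m > l\<close> by (metis Suc_eq_plus1 less_iff_Suc_add add_Suc)
    have "l + num_lattice_points P < ?q" using assms(22) \<open>m > l\<close> by linarith
    then show ?thesis unfolding d by (simp add: algebra_simps)
  qed
  moreover have "card (torus_zeros (\<Prod>i=1..m. s' i)) = card (rational_points ?q (zeros (\<Prod>i=1..m. t' i)))"
    "card (torus_zeros (\<Prod>k=1..l. s'' k)) = card (rational_points ?q (zeros (\<Prod>k=1..l. t'' k)))"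
    unfolding torus_zeros_eq t'_def t''_def by (simp_all add: card_zeros_eq_rational_points map_to_ac_prod)
  ultimately show ?thesis using lower upper by linarith
qed

end
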